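(* The identity checking problem $\textsc{Check-Id}(\mathcal{K}_4)$ for the Kauffman monoid $\mathcal{K}_4$ lies in the complexity class $\mathsf{P}$.
   Context: The Kauffman monoid $\mathcal{K}_4$ is the monoid presented by generators $c,h_1,h_2,h_3$ subject to the relations: $h_1h_3=h_3h_1$; $h_ih_jh_i=h_i$ if $|i-j|=1$, $i,j\in\{1,2,3\}$; $h_i^2=ch_i=h_ic$ for each $i=1,2,3$. $X$ is a fixed countably infinite set (alphabet) and $X^+$ is the free semigroup over $X$ (nonempty finite words under concatenation). An identity is an expression $w\bumpeq w'$ with $w,w'\in X^+$; it holds in a semigroup $\mathcal{S}$ if $w\varphi=w'\varphi$ for every semigroup homomorphism $\varphi\colon X^+\to\mathcal{S}$. For a fixed semigroup $\mathcal{S}$, the problem $\textsc{Check-Id}(\mathcal{S})$ is the decision problem whose instance is an arbitrary identity $w\bumpeq w'$, with answer YES if the identity holds in $\mathcal{S}$ and NO otherwise. Here $\mathcal{S}$ is fixed and complexity is measured in terms of the size of the identity, i.e. the length $|ww'|$ of the word $ww'$. *)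

theory Defs
  imports "HOL-Computational_Algebra.Polynomial"
begin

section \<open>The Kauffman monoid\<close>

datatype kgen = C | H1 | H2 | H3

inductive kauffman4_rel :: "kgen list \<Rightarrow> kgen list \<Rightarrow> bool" where
  far:    "kauffman4_rel [H1, H3] [H3, H1]"
| near12: "kauffman4_rel [H1, H2, H1] [H1]"
| near21: "kauffman4_rel [H2, H1, H2] [H2]"
| near23: "kauffman4_rel [H2, H3, H2] [H2]"
| near32: "kauffman4_rel [H3, H2, H3] [H3]"
| square: "h \<in> {H1, H2, H3} \<Longrightarrow> kauffman4_rel [h, h] [C, h]"
| centre: "h \<in> {H1, H2, H3} \<Longrightarrow> kauffman4_rel [C, h] [h, C]"

text \<open>The least monoid congruence on words containing the defining relations.\<close>

inductive kauffman4_cong :: "kgen list \<Rightarrow> kgen list \<Rightarrow> bool" where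
  base:  "kauffman4_rel u v \<Longrightarrow> kauffman4_cong u v"
| refl:  "kauffman4_cong u u"
| sym:   "kauffman4_cong u v \<Longrightarrow> kauffman4_cong v u"
| trans: "kauffman4_cong u v \<Longrightarrow> kauffman4_cong v w \<Longrightarrow> kauffman4_cong u w"
| mult:  "kauffman4_cong u v \<Longrightarrow> kauffman4_cong u' v' \<Longrightarrow> kauffman4_cong (u @ u') (v @ v')"

quotient_type kauffman4 = "kgen list" / kauffman4_cong
proof (rule equivpI)
  show "reflp kauffman4_cong" by (rule reflpI) (rule kauffman4_cong.refl)
  show "symp kauffman4_cong" by (rule sympI) (rule kauffman4_cong.sym)
  show "transp kauffman4_cong" by (rule transpI) (rule kauffman4_cong.trans)
qed

instantiation kauffman4 :: monoid_mult
begin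

lift_definition one_kauffman4 :: kauffman4 is "[]" .

lift_definition times_kauffman4 :: "kauffman4 \<Rightarrow> kauffman4 \<Rightarrow> kauffman4" is "(@)"
  by (rule kauffman4_cong.mult)

instance
  by (intro_classes; transfer) (simp_all add: kauffman4_cong.refl)

end


section \<open>Identities\<close>

text \<open>
  The alphabet is \<^typ>\<open>nat\<close>, and the free semigroup over it consists of the nonempty lists.
\<close>

definition free_semigroup_hom :: "(nat list \<Rightarrow> 's::semigroup_mult) \<Rightarrow> bool" where
  "free_semigroup_hom \<phi> \<longleftrightarrow> (\<forall>u v. u \<noteq> [] \<longrightarrow> v \<noteq> [] \<longrightarrow> \<phi> (u @ v) = \<phi> u * \<phi> v)"

definition holds_identity :: "'s::semigroup_mult itself \<Rightarrow> nat list \<Rightarrow> nat list \<Rightarrow> bool" where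
  "holds_identity S w w' \<longleftrightarrow> (\<forall>\<phi> :: nat list \<Rightarrow> 's. free_semigroup_hom \<phi> \<longrightarrow> \<phi> w = \<phi> w')"


section \<open>The class P\<close>

text \<open>
  Deterministic Turing machines with finitely many two-way infinite tapes. States and tape
  symbols are initial segments of the natural numbers. The symbol 0 is the blank, and the input
  bits \<^term>\<open>False\<close> and \<^term>\<open>True\<close> are written as 1 and 2. The transition function receives
  the state and the scanned symbols, one per tape, and returns the new state, the symbols to
  write and the head moves.
\<close>

datatype move = MLeft | MStay | MRight

record tm =
  num_tapes   :: nat
  num_symbols :: nat
  num_states  :: nat
  start_state  :: nat
  accept_state :: nat
  reject_state :: nat
  transition :: "nat \<Rightarrow> nat list \<Rightarrow> nat \<times> nat list \<times> move list"

definition wf_tm :: "tm \<Rightarrow> bool" where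
  "wf_tm M \<longleftrightarrow>
     1 \<le> num_tapes M \<and> 3 \<le> num_symbols M \<and>
     start_state M < num_states M \<and> accept_state M < num_states M \<and>
     reject_state M < num_states M \<and> accept_state M \<noteq> reject_state M \<and>
     (\<forall>q < num_states M. \<forall>s. length s = num_tapes M \<and> set s \<subseteq> {..<num_symbols M} \<longrightarrow>
        (case transition M q s of (q', s', d) \<Rightarrow>
           q' < num_states M \<and>
           length s' = num_tapes M \<and> set s' \<subseteq> {..<num_symbols M} \<and>
           length d = num_tapes M))"

text \<open>A tape is given by its contents and the position of its head.\<close>

type_synonym tape = "(int \<Rightarrow> nat) \<times> int"

definition tape_read :: "tape \<Rightarrow> nat" where
  "tape_read t = fst t (snd t)"

definition move_offset :: "move \<Rightarrow> int" where
  "move_offset d = (case d of MLeft \<Rightarrow> -1 | MStay \<Rightarrow> 0 | MRight \<Rightarrow> 1)"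

definition tape_update :: "nat \<Rightarrow> move \<Rightarrow> tape \<Rightarrow> tape" where
  "tape_update a d t = ((fst t)(snd t := a), snd t + move_offset d)"

type_synonym config = "nat \<times> tape list"

definition tm_step :: "tm \<Rightarrow> config \<Rightarrow> config" where
  "tm_step M c =
     (let (q, ts) = c in
      if q = accept_state M \<or> q = reject_state M then (q, ts)
      else
        let (q', s', d) = transition M q (map tape_read ts)
        in (q', map (\<lambda>(t, a, m). tape_update a m t) (zip ts (zip s' d))))"

definition blank_tape :: tape where
  "blank_tape = (\<lambda>_. 0, 0)"

definition input_tape :: "bool list \<Rightarrow> tape" where
  "input_tape x =
     (\<lambda>i. if 0 \<le> i \<and> i < int (length x) then (if x ! nat i then 2 else 1) else 0, 0)"

definition start_config :: "tm \<Rightarrow> bool list \<Rightarrow> config" where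
  "start_config M x = (start_state M, input_tape x # replicate (num_tapes M - 1) blank_tape)"

definition state_after :: "tm \<Rightarrow> bool list \<Rightarrow> nat \<Rightarrow> nat" where
  "state_after M x t = fst ((tm_step M ^^ t) (start_config M x))"

text \<open>
  Halting configurations are fixed by \<^const>\<open>tm_step\<close>, so being in a halting state after
  exactly \<open>t\<close> steps means having halted within \<open>t\<close> steps.
\<close>

definition accepts_within :: "tm \<Rightarrow> bool list \<Rightarrow> nat \<Rightarrow> bool" where
  "accepts_within M x t \<longleftrightarrow> state_after M x t = accept_state M"

definition rejects_within :: "tm \<Rightarrow> bool list \<Rightarrow> nat \<Rightarrow> bool" where
  "rejects_within M x t \<longleftrightarrow> state_after M x t = reject_state M"

definition class_P :: "bool list set set" where
  "class_P =
     {L. \<exists>M (p :: nat poly). wf_tm M \<and>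
           (\<forall>x. if x \<in> L then accepts_within M x (poly p (length x))
                else rejects_within M x (poly p (length x)))}"


section \<open>The identity checking problem\<close>

text \<open>
  A word is written as a bit string made of two-bit blocks. A letter is given by its binary
  digits, least significant first, each digit \<open>b\<close> becoming the block \<open>1b\<close>, followed by the end
  marker \<open>00\<close>. The two sides of an identity are separated by the block \<open>01\<close>.
\<close>

fun encode_nat :: "nat \<Rightarrow> bool list" where
  "encode_nat n = (if n = 0 then [] else True # odd n # encode_nat (n div 2))"

declare encode_nat.simps [simp del]

definition encode_letter :: "nat \<Rightarrow> bool list" where
  "encode_letter n = encode_nat n @ [False, False]"

definition encode_word :: "nat list \<Rightarrow> bool list" where
  "encode_word w = concat (map encode_letter w)"

definition encode_identity :: "nat list \<Rightarrow> nat list \<Rightarrow> bool list" where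
  "encode_identity w w' = encode_word w @ [False, True] @ encode_word w'"

definition check_id :: "'s::semigroup_mult itself \<Rightarrow> bool list set" where
  "check_id S = {encode_identity w w' | w w'. w \<noteq> [] \<and> w' \<noteq> [] \<and> holds_identity S w w'}"


section \<open>Adequacy of the encoding\<close>

lemma encode_letter_append_inject:
  "encode_letter m @ r = encode_letter n @ s \<longleftrightarrow> m = n \<and> r = s"
proof
  show "encode_letter m @ r = encode_letter n @ s \<Longrightarrow> m = n \<and> r = s"
  proof (induction m arbitrary: n rule: less_induct)
    case (less m)
    show ?case
    proof (cases "m = 0 \<or> n = 0")
      case True
      then show ?thesis using less.prems
        by (auto simp: encode_letter_def encode_nat.simps[of m] encode_nat.simps[of n] split: if_splits)
    next
      case False
      then have eq: "odd m = odd n"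
        "encode_letter (m div 2) @ r = encode_letter (n div 2) @ s"
        using less.prems
        by (auto simp: encode_letter_def encode_nat.simps[of m] encode_nat.simps[of n])
      then have *: "m div 2 = n div 2" "r = s" using less.IH[of "m div 2"] False by auto
      moreover have "m mod 2 = n mod 2" using eq(1) by (simp add: mod2_eq_if)
      ultimately show ?thesis by (metis div_mult_mod_eq)
    qed
  qed
qed simp

lemma encode_letter_neq_sep: "encode_letter n @ r \<noteq> False # True # s"
  by (simp add: encode_letter_def encode_nat.simps[of n])

lemma encode_word_inject: "encode_word v = encode_word w \<longleftrightarrow> v = w"
proof (induction v arbitrary: w)
  case Nil
  then show ?case by (cases w) (auto simp: encode_word_def encode_letter_def)
next
  case (Cons a v)
  show ?case
  proof (cases w)
    case Nil
    then show ?thesis by (auto simp: encode_word_def encode_letter_def)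
  next
    case (Cons b u)
    then show ?thesis using Cons.IH[of u]
      by (simp add: encode_word_def encode_letter_append_inject)
  qed
qed

lemma encode_identity_inject:
  "encode_identity v v' = encode_identity w w' \<longleftrightarrow> v = w \<and> v' = w'"
proof (induction v arbitrary: w)
  case Nil
  show ?case
  proof (cases w)
    case Nil
    then show ?thesis
      by (simp add: encode_identity_def encode_word_inject)
  next
    case (Cons b u)
    then show ?thesis
      by (simp add: encode_identity_def encode_word_def encode_letter_neq_sep[symmetric])
  qed
next
  case (Cons a v)
  show ?case
  proof (cases w)
    case Nil
    then show ?thesis
      by (auto simp: encode_identity_def encode_word_def encode_letter_neq_sep)
  next
    case (Cons b u)
    then show ?thesis using Cons.IH[of u]
      by (simp add: encode_identity_def encode_word_def encode_letter_append_inject)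
  qed
qed

lemma encode_identity_in_check_id:
  assumes "w \<noteq> []" "w' \<noteq> []"
  shows "encode_identity w w' \<in> check_id S \<longleftrightarrow> holds_identity S w w'"
  using assms by (auto simp: check_id_def encode_identity_inject)

text \<open>
  The size of an identity is the length of \<open>w @ w'\<close>. Renaming letters does not affect whether an
  identity holds, so the letters may be taken among the first \<open>length (w @ w')\<close> ones; for such
  identities, polynomial time in the length of the encoding is polynomial time in the size.
\<close>

lemma holds_identity_rename_imp:
  fixes S :: "'s::semigroup_mult itself"
  assumes "holds_identity S w w'"
  shows "holds_identity S (map f w) (map f w')"
  unfolding holds_identity_def
proof (intro allI impI)
  fix \<phi> :: "nat list \<Rightarrow> 's" assume "free_semigroup_hom \<phi>"
  then have "free_semigroup_hom (\<lambda>u. \<phi> (map f u))" by (simp add: free_semigroup_hom_def)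
  then show "\<phi> (map f w) = \<phi> (map f w')" using assms unfolding holds_identity_def by blast
qed

lemma holds_identity_rename:
  assumes "inj_on f (set (w @ w'))"
  shows "holds_identity S (map f w) (map f w') \<longleftrightarrow> holds_identity S w w'"
proof
  let ?g = "the_inv_into (set (w @ w')) f"
  have "map ?g (map f w) = w" "map ?g (map f w') = w'"
    using assms by (auto intro!: map_idI simp: the_inv_into_f_f)
  then show "holds_identity S (map f w) (map f w') \<Longrightarrow> holds_identity S w w'"
    by (metis holds_identity_rename_imp)
qed (rule holds_identity_rename_imp)

lemma length_encode_letter: "length (encode_letter n) \<le> 2 * n + 2"
proof -
  have "length (encode_nat n) \<le> 2 * n"
  proof (induction n rule: less_induct)
    case (less n)
    show ?case
    proof (cases "n = 0")
      case False
      then have "length (encode_nat (n div 2)) \<le> 2 * (n div 2)" "n div 2 + 1 \<le> n"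
        using less.IH[of "n div 2"] by auto
      then show ?thesis using False by (simp add: encode_nat.simps[of n])
    qed (simp add: encode_nat.simps)
  qed
  then show ?thesis by (simp add: encode_letter_def)
qed

lemma length_encode_word:
  assumes "set w \<subseteq> {..<n}"
  shows "length (encode_word w) \<le> length w * (2 * n + 2)"
  using assms
proof (induction w)
  case (Cons a w)
  then have "length (encode_letter a) \<le> 2 * n + 2"
    using length_encode_letter[of a] by auto
  with Cons show ?case by (simp add: encode_word_def)
qed (simp add: encode_word_def)

lemma length_encode_identity:
  assumes "set (w @ w') \<subseteq> {..<length (w @ w')}"
  shows "length (encode_identity w w') \<le> length (w @ w') * (2 * length (w @ w') + 2) + 2"
  using length_encode_word[of w "length (w @ w')"] length_encode_word[of w' "length (w @ w')"] assms
  by (simp add: encode_identity_def add_mult_distrib)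

lemma tm_step_halted:
  assumes "fst c = accept_state M \<or> fst c = reject_state M"
  shows "(tm_step M ^^ k) c = c"
  using assms by (induction k) (auto simp: tm_step_def split: prod.splits)

lemma state_after_mono:
  assumes "state_after M x t = accept_state M \<or> state_after M x t = reject_state M" "t \<le> t'"
  shows "state_after M x t' = state_after M x t"
proof -
  obtain k where "t' = k + t" using assms(2) by (metis add.commute le_Suc_ex)
  then show ?thesis using assms(1) by (simp add: state_after_def funpow_add tm_step_halted)
qed

lemma poly_nat_mono:
  fixes p :: "nat poly"
  assumes "x \<le> y"
  shows "poly p x \<le> poly p y"
  by (induction p) (auto intro!: add_mono mult_mono assms)

lemma check_id_in_class_P_size:
  assumes "check_id S \<in> class_P"
  shows "\<exists>M (p :: nat poly). wf_tm M \<and>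
    (\<forall>w w'. w \<noteq> [] \<longrightarrow> w' \<noteq> [] \<longrightarrow> set (w @ w') \<subseteq> {..<length (w @ w')} \<longrightarrow>
       (if holds_identity S w w'
        then accepts_within M (encode_identity w w') (poly p (length (w @ w')))
        else rejects_within M (encode_identity w w') (poly p (length (w @ w')))))"
proof -
  obtain M and p :: "nat poly" where M: "wf_tm M"
    and *: "\<And>x. if x \<in> check_id S then accepts_within M x (poly p (length x))
                 else rejects_within M x (poly p (length x))"
    using assms unfolding class_P_def by blast
  let ?p = "pcompose p [:2, 2, 2:]"
  have "if holds_identity S w w'
        then accepts_within M (encode_identity w w') (poly ?p (length (w @ w')))
        else rejects_within M (encode_identity w w') (poly ?p (length (w @ w')))"
    if "w \<noteq> []" "w' \<noteq> []" "set (w @ w') \<subseteq> {..<length (w @ w')}" for w w'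
  proof -
    let ?x = "encode_identity w w'" and ?n = "length (w @ w')"
    have "length ?x \<le> poly [:2, 2, 2:] ?n"
      using length_encode_identity[OF that(3)] by (simp add: algebra_simps)
    then have "poly p (length ?x) \<le> poly ?p ?n"
      unfolding poly_pcompose by (rule poly_nat_mono)
    then show ?thesis
      using *[of ?x] state_after_mono[of M ?x "poly p (length ?x)" "poly ?p ?n"]
        encode_identity_in_check_id[OF that(1,2), of S]
      by (auto simp: accepts_within_def rejects_within_def split: if_splits)
  qed
  with M show ?thesis by blast
qed

end

theory Submission
  imports Defs
begin

text \<open>
  Modulo powers of the central generator the noncentral elements of \<open>K\<^sub>4\<close> have two ends, and a
  product is determined by its outer ends, the sum of the exponents, and the pairs of touching inner
  ends. Hence the value of a word under a substitution depends only on the multiset of adjacent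
  letters, end markers included, that remain once the centrally substituted letters are deleted from
  the word. Conversely all these multisets can be recovered from substitutions into the part of the
  monoid generated by \<open>h\<^sub>1\<close> and \<open>h\<^sub>2\<close>. By inclusion and exclusion over the deleted set, two words
  agree on all of them iff for all \<open>x\<close>, \<open>S\<close>, \<open>y\<close> they have equally many occurrences of \<open>x\<close> followed
  by \<open>y\<close> such that \<open>S\<close> is the set of letters in between and \<open>x, y \<notin> S\<close>.

  This criterion is expressible by a first-order formula with equicardinality over the positions of
  the input. Such formulas are evaluated by multi-tape Turing machines that, after copying the input,
  only move heads: a variable is a head position, and counting is done by the position of an
  auxiliary head.
\<close>

section \<open>A model of the Kauffman monoid\<close>

text \<open>The obstacle to polynomial time is that deleted sets are exponentially many. Prescribing
  the exact set \<open>S\<close> between two occurrences removes it: a triple \<open>x\<close>,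
  \<open>S\<close>, \<open>y\<close> with nonzero count is realised by a pair of positions, so only
  quadratically many triples matter. Nor does \<open>S\<close> have to be stored, since such a pair
  names it and equality of two sets named in this way is first-order over positions.

  A second obstacle is that an exponent reveals only a sum over all adjacent pairs. With two types
  of ends a pair contributes when its inner types agree, and the types of left and right ends can be
  chosen independently for every letter; comparing a few such choices isolates the occurrences of
  one ordered pair.

  The detour through formulas keeps the machine part small: a single induction over formulas yields
  correctness together with the time bound, because a sweep of one variable multiplies the time by a
  linear factor and the formula is fixed.\<close>

datatype idx = I1 | I2 | I3

definition outer :: "idx \<Rightarrow> bool" where
  "outer i \<longleftrightarrow> i \<noteq> I2"

text \<open>\<open>E i n j\<close> stands for \<open>c\<^sup>n h\<^sub>i \<dots> h\<^sub>j\<close> with the indices from \<open>i\<close> to \<open>j\<close> in between. \<open>F a n b\<close>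
  stands for \<open>c\<^sup>n\<close> times a diagram without through strings, such as \<open>h\<^sub>1 h\<^sub>3\<close>; an end is \<open>True\<close> if it
  joins 1 to 2 and 3 to 4, and \<open>False\<close> if it joins 2 to 3 and 1 to 4.\<close>

datatype kel = Cen nat | E idx nat idx | F bool nat bool

instantiation kel :: monoid_mult
begin

definition one_kel :: kel where "1 = Cen 0"

text \<open>A 1 added to the exponents is a closed loop. Two \<open>E\<close> elements lose all
  through strings exactly when the touching ends are those of \<open>h\<^sub>1\<close> and
  \<open>h\<^sub>3\<close>. Two \<open>F\<close> elements always close one loop, and a second one if
  the touching ends agree.\<close>

fun times_kel :: "kel \<Rightarrow> kel \<Rightarrow> kel" where
  "Cen m * Cen n = Cen (m + n)"
| "Cen m * E i n j = E i (m + n) j"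
| "Cen m * F a n b = F a (m + n) b"
| "E i m j * Cen n = E i (m + n) j"
| "E i m j * E k n l =
     (if j \<noteq> k \<and> outer j = outer k then F (outer i) (m + n) (outer l)
      else E i (m + n + of_bool (j = k)) l)"
| "E i m j * F a n b = F (outer i) (m + n + of_bool (outer j = a)) b"
| "F a m b * Cen n = F a (m + n) b"
| "F a m b * E k n l = F a (m + n + of_bool (b = outer k)) (outer l)"
| "F a m b * F c n d = F a (m + n + 1 + of_bool (b = c)) d"

instance
proof
  fix a b c :: kel
  show "a * b * c = a * (b * c)"
    by (cases a; cases b; cases c) auto
  show "1 * a = a" "a * 1 = a"
    by (cases a; simp add: one_kel_def)+
qed

end

section \<open>Isomorphism of the Kauffman monoid with the model\<close>

fun kel_gen :: "kgen \<Rightarrow> kel" where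
  "kel_gen C = Cen 1"
| "kel_gen H1 = E I1 0 I1"
| "kel_gen H2 = E I2 0 I2"
| "kel_gen H3 = E I3 0 I3"

lemma kel_gen_cong:
  "kauffman4_cong u v \<Longrightarrow> prod_list (map kel_gen u) = prod_list (map kel_gen v)"
proof (induction rule: kauffman4_cong.induct)
  case (base u v)
  then show ?case
    by (induction rule: kauffman4_rel.induct) (auto simp: one_kel_def outer_def)
qed auto

lift_definition kel_of :: "kauffman4 \<Rightarrow> kel" is "\<lambda>u. prod_list (map kel_gen u)"
  by (rule kel_gen_cong)

lemma kel_of_mult: "kel_of (a * b) = kel_of a * kel_of b"
  by transfer simp

lift_definition kgen4 :: "kgen \<Rightarrow> kauffman4" is "\<lambda>g. [g]" .

lemma kgen4_far: "kgen4 H3 * kgen4 H1 = kgen4 H1 * kgen4 H3"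
  by transfer (auto intro: kauffman4_cong.sym kauffman4_cong.base kauffman4_rel.intros)

lemma kgen4_near:
  "kgen4 H1 * (kgen4 H2 * kgen4 H1) = kgen4 H1"
  "kgen4 H2 * (kgen4 H1 * kgen4 H2) = kgen4 H2"
  "kgen4 H2 * (kgen4 H3 * kgen4 H2) = kgen4 H2"
  "kgen4 H3 * (kgen4 H2 * kgen4 H3) = kgen4 H3"
  by (transfer, auto intro: kauffman4_cong.base kauffman4_rel.intros)+

lemma kgen4_square:
  "h \<in> {H1, H2, H3} \<Longrightarrow> kgen4 h * kgen4 h = kgen4 C * kgen4 h"
  by (transfer, simp, intro kauffman4_cong.base kauffman4_rel.square, simp)

lemma kgen4_centre: "kgen4 h * kgen4 C = kgen4 C * kgen4 h"
proof (cases "h = C")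
  case False
  then have "h \<in> {H1, H2, H3}" by (cases h) auto
  then show ?thesis
    by (transfer, simp, intro kauffman4_cong.sym[OF kauffman4_cong.base] kauffman4_rel.centre, simp)
qed simp

lemma kgen4_centre_power: "kgen4 h * kgen4 C ^ n = kgen4 C ^ n * kgen4 h"
  by (induction n) (simp_all add: mult.assoc, metis kgen4_centre mult.assoc)

fun e_word :: "idx \<Rightarrow> idx \<Rightarrow> kgen list" where
  "e_word I1 I1 = [H1]" | "e_word I1 I2 = [H1, H2]" | "e_word I1 I3 = [H1, H2, H3]"
| "e_word I2 I1 = [H2, H1]" | "e_word I2 I2 = [H2]" | "e_word I2 I3 = [H2, H3]"
| "e_word I3 I1 = [H3, H2, H1]" | "e_word I3 I2 = [H3, H2]" | "e_word I3 I3 = [H3]"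

fun f_word :: "bool \<Rightarrow> bool \<Rightarrow> kgen list" where
  "f_word True True = [H1, H3]" | "f_word True False = [H1, H3, H2]"
| "f_word False True = [H2, H1, H3]" | "f_word False False = [H2, H1, H3, H2]"

fun of_kel :: "kel \<Rightarrow> kauffman4" where
  "of_kel (Cen n) = kgen4 C ^ n"
| "of_kel (E i n j) = kgen4 C ^ n * prod_list (map kgen4 (e_word i j))"
| "of_kel (F a n b) = kgen4 C ^ n * prod_list (map kgen4 (f_word a b))"

text \<open>Surjectivity of the normal forms: \<open>1\<close> is the normal form
  \<open>Cen 0\<close>, and left multiplication by a generator leads from normal form to normal
  form. The proof is rewriting with the relations oriented from left to right.\<close>

lemma kgen4_mult_of_kel: "kgen4 g * of_kel k = of_kel (kel_gen g * k)"
proof -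
  have assoc': "a * (b * x) = c * x" if "a * b = c" for a b c x :: kauffman4
    using that by (simp add: mult.assoc[symmetric])
  have assoc'': "a * (b * (d * x)) = c * x" if "a * (b * d) = c" for a b c d x :: kauffman4
    using that by (simp add: mult.assoc[symmetric])
  \<comment> \<open>Turning \<open>h\<^sub>3 h\<^sub>1\<close> into
    \<open>h\<^sub>1 h\<^sub>3\<close> tears apart the redexes
    \<open>h\<^sub>1 h\<^sub>2 h\<^sub>1\<close> and \<open>h\<^sub>3 h\<^sub>2 h\<^sub>3\<close>.
    The facts 1 and 3 are the resulting critical pairs, 2 and 4 their versions with a tail.\<close>
  have 1: "kgen4 H1 * (kgen4 H3 * (kgen4 H2 * kgen4 H1)) = kgen4 H1 * kgen4 H3"
    by (metis kgen4_far kgen4_near(1) mult.assoc)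
  have 2: "kgen4 H1 * (kgen4 H3 * (kgen4 H2 * (kgen4 H1 * x))) = kgen4 H1 * (kgen4 H3 * x)" for x
    by (metis 1 mult.assoc)
  have 3: "kgen4 H3 * (kgen4 H2 * (kgen4 H1 * kgen4 H3)) = kgen4 H1 * kgen4 H3"
    by (metis kgen4_far kgen4_near(4) mult.assoc)
  have 4: "kgen4 H3 * (kgen4 H2 * (kgen4 H1 * (kgen4 H3 * x))) = kgen4 H1 * (kgen4 H3 * x)" for x
    by (metis 3 mult.assoc)
  have sq: "kgen4 H1 * kgen4 H1 = kgen4 C * kgen4 H1" "kgen4 H2 * kgen4 H2 = kgen4 C * kgen4 H2"
     "kgen4 H3 * kgen4 H3 = kgen4 C * kgen4 H3" by (simp_all add: kgen4_square)
  have cen: "kgen4 h * (kgen4 C ^ n * x) = kgen4 C ^ n * (kgen4 h * x)"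
    "kgen4 h * (kgen4 C * x) = kgen4 C * (kgen4 h * x)" if "h \<noteq> C" for h n x
    by (metis kgen4_centre_power mult.assoc) (metis kgen4_centre mult.assoc)
  note rules = kgen4_far kgen4_far[THEN assoc'] kgen4_near kgen4_near[THEN assoc''] sq sq[THEN assoc']
    1 2 3 4 cen power_Suc2 power_Suc mult.assoc
  have swap: "kgen4 C ^ n * (kgen4 C * x) = kgen4 C * (kgen4 C ^ n * x)" for n x
    by (metis power_commutes mult.assoc)
  show ?thesis
  proof (cases k)
    case (Cen n)
    then show ?thesis by (cases g) (simp_all add: kgen4_centre_power)
  next
    case (E i n j)
    then show ?thesis
      by (cases g; cases i; cases j) (simp_all add: rules swap outer_def)
  next
    case (F a n b)
    then show ?thesis
      by (cases g; cases a; cases b) (simp_all add: rules swap outer_def)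
  qed
qed

lemma of_kel_kel_of: "of_kel (kel_of z) = z"
proof -
  have "of_kel (prod_list (map kel_gen u)) = abs_kauffman4 u" for u
  proof (induction u)
    case Nil
    then show ?case by (simp add: one_kel_def one_kauffman4.abs_eq)
  next
    case (Cons g u)
    then have "of_kel (prod_list (map kel_gen (g # u))) = kgen4 g * abs_kauffman4 u"
      by (simp add: kgen4_mult_of_kel[symmetric])
    then show ?case by (simp add: kgen4.abs_eq times_kauffman4.abs_eq)
  qed
  then show ?thesis by (induction z) (simp add: kel_of.abs_eq)
qed

text \<open>The injectivity half: a normal form evaluates in the model to the element it stands for,
  so the relations never identify two normal forms.\<close>

lemma kel_of_of_kel: "kel_of (of_kel k) = k"
proof -
  have gen: "kel_of (kgen4 g) = kel_gen g" for g
    by transfer simp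
  have one: "kel_of 1 = 1" by transfer simp
  have pow: "kel_of (kgen4 C ^ n) = Cen n" for n
    by (induction n) (simp_all add: one kel_of_mult gen, simp add: one_kel_def)
  have lst: "kel_of (prod_list (map kgen4 u)) = prod_list (map kel_gen u)" for u
    by (induction u) (simp_all add: one kel_of_mult gen)
  show ?thesis
  proof (cases k)
    case (Cen n)
    then show ?thesis by (simp add: pow)
  next
    case (E i n j)
    then show ?thesis
      by (cases i; cases j) (simp_all add: kel_of_mult pow gen outer_def one)
  next
    case (F a n b)
    then show ?thesis
      by (cases a; cases b) (simp_all add: kel_of_mult pow gen outer_def one)
  qed
qed

lemma of_kel_mult: "of_kel (a * b) = of_kel a * of_kel b"
  by (metis kel_of_mult kel_of_of_kel of_kel_kel_of)

section \<open>Identities as equations under substitutions\<close>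

lemma free_semigroup_hom_prod_list:
  fixes \<phi> :: "nat list \<Rightarrow> 'm :: monoid_mult"
  assumes "free_semigroup_hom \<phi>" "w \<noteq> []"
  shows "\<phi> w = prod_list (map (\<lambda>x. \<phi> [x]) w)"
  using assms(2)
proof (induction w rule: list_nonempty_induct)
  case (cons x xs)
  have "\<phi> ([x] @ xs) = \<phi> [x] * \<phi> xs"
    using assms(1) cons(1) unfolding free_semigroup_hom_def by blast
  with cons show ?case by simp
qed simp

text \<open>On nonempty words a homomorphism is determined by the images of the letters; its value
  at \<open>[]\<close> is arbitrary and never enters.\<close>

lemma holds_identity_monoid:
  assumes "w \<noteq> []" "w' \<noteq> []"
  shows "holds_identity TYPE('m :: monoid_mult) w w' \<longleftrightarrow>
    (\<forall>g :: nat \<Rightarrow> 'm. prod_list (map g w) = prod_list (map g w'))"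
proof
  assume *: "holds_identity TYPE('m) w w'"
  show "\<forall>g :: nat \<Rightarrow> 'm. prod_list (map g w) = prod_list (map g w')"
  proof
    fix g :: "nat \<Rightarrow> 'm"
    have "free_semigroup_hom (\<lambda>u. prod_list (map g u))"
      by (simp add: free_semigroup_hom_def)
    with * show "prod_list (map g w) = prod_list (map g w')"
      unfolding holds_identity_def by blast
  qed
next
  assume *: "\<forall>g :: nat \<Rightarrow> 'm. prod_list (map g w) = prod_list (map g w')"
  show "holds_identity TYPE('m) w w'"
    unfolding holds_identity_def
    using * free_semigroup_hom_prod_list assms by metis
qed

lemma holds_identity_kauffman4_kel:
  "holds_identity TYPE(kauffman4) w w' \<longleftrightarrow> holds_identity TYPE(kel) w w'"
proof
  assume *: "holds_identity TYPE(kauffman4) w w'"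
  show "holds_identity TYPE(kel) w w'"
    unfolding holds_identity_def
  proof (intro allI impI)
    fix \<phi> :: "nat list \<Rightarrow> kel" assume "free_semigroup_hom \<phi>"
    then have "free_semigroup_hom (\<lambda>u. of_kel (\<phi> u))"
      by (simp add: free_semigroup_hom_def of_kel_mult)
    with * have "of_kel (\<phi> w) = of_kel (\<phi> w')" unfolding holds_identity_def by blast
    then show "\<phi> w = \<phi> w'" by (metis kel_of_of_kel)
  qed
next
  assume *: "holds_identity TYPE(kel) w w'"
  show "holds_identity TYPE(kauffman4) w w'"
    unfolding holds_identity_def
  proof (intro allI impI)
    fix \<phi> :: "nat list \<Rightarrow> kauffman4" assume "free_semigroup_hom \<phi>"
    then have "free_semigroup_hom (\<lambda>u. kel_of (\<phi> u))"
      by (simp add: free_semigroup_hom_def kel_of_mult)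
    with * have "kel_of (\<phi> w) = kel_of (\<phi> w')" unfolding holds_identity_def by blast
    then show "\<phi> w = \<phi> w'" by (metis of_kel_kel_of)
  qed
qed

section \<open>Values of words\<close>

fun is_Cen :: "kel \<Rightarrow> bool" where
  "is_Cen (Cen n) = True" | "is_Cen _ = False"

fun is_F :: "kel \<Rightarrow> bool" where
  "is_F (F a n b) = True" | "is_F _ = False"

fun expo :: "kel \<Rightarrow> nat" where
  "expo (Cen n) = n" | "expo (E i n j) = n" | "expo (F a n b) = n"

text \<open>The default \<open>I1\<close> for \<open>F\<close> elements can make
  \<open>clash\<close> hold spuriously. This is harmless, since a list containing an
  \<open>F\<close> is \<open>singular\<close> anyway.\<close>

fun left_idx :: "kel \<Rightarrow> idx" where
  "left_idx (E i n j) = i" | "left_idx _ = I1"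

fun right_idx :: "kel \<Rightarrow> idx" where
  "right_idx (E i n j) = j" | "right_idx _ = I1"

fun left_end :: "kel \<Rightarrow> bool" where
  "left_end (E i n j) = outer i" | "left_end (F a n b) = a" | "left_end _ = True"

fun right_end :: "kel \<Rightarrow> bool" where
  "right_end (E i n j) = outer j" | "right_end (F a n b) = b" | "right_end _ = True"

definition touch :: "kel \<Rightarrow> kel \<Rightarrow> bool" where
  "touch a b \<longleftrightarrow> right_end a = left_end b"

definition clash :: "kel \<Rightarrow> kel \<Rightarrow> bool" where
  "clash a b \<longleftrightarrow> touch a b \<and> right_idx a \<noteq> left_idx b"

definition adjacent :: "'a list \<Rightarrow> ('a \<times> 'a) list" where
  "adjacent v = zip v (tl v)"

definition touches :: "kel list \<Rightarrow> nat" where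
  "touches ks = length (filter (\<lambda>(a, b). touch a b) (adjacent ks))"

definition singular :: "kel list \<Rightarrow> bool" where
  "singular ks \<longleftrightarrow> (\<exists>k\<in>set ks. is_F k) \<or> (\<exists>(a, b)\<in>set (adjacent ks). clash a b)"

text \<open>The correction by 1 belongs to the first loss of the through strings. If that is a clash
  of two \<open>E\<close> elements, it is counted in \<open>touches\<close> but closes no loop. If
  it is an \<open>F\<close> factor, that factor is counted as one, which is the loop gained by every
  later \<open>F\<close> but not by the first.\<close>

definition noncentral_value :: "kel list \<Rightarrow> kel" where
  "noncentral_value ks =
     (let e = sum_list (map expo ks) + touches ks in
      if singular ks
      then F (left_end (hd ks)) (e + length (filter is_F ks) - 1) (right_end (last ks))
      else E (left_idx (hd ks)) e (right_idx (last ks)))"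

lemma adjacent_simps [simp]:
  "adjacent [] = []" "adjacent [a] = []" "adjacent (a # b # v) = (a, b) # adjacent (b # v)"
  by (simp_all add: adjacent_def)

text \<open>Keeps the truncated subtraction in \<open>noncentral_value\<close> exact.\<close>

lemma singular_pos:
  assumes "singular ks"
  shows "0 < touches ks + length (filter is_F ks)"
proof -
  consider k where "k \<in> set ks" "is_F k" | p where "p \<in> set (adjacent ks)" "clash (fst p) (snd p)"
    using assms by (auto simp: singular_def)
  then show ?thesis
  proof cases
    case 1
    then have "k \<in> set (filter is_F ks)" by simp
    then show ?thesis by (metis add_pos_nonneg length_pos_if_in_set add.commute zero_le)
  next
    case 2
    then have "p \<in> set (filter (\<lambda>(a, b). touch a b) (adjacent ks))"
      by (auto simp: clash_def)
    then show ?thesis unfolding touches_def by (metis add_pos_nonneg length_pos_if_in_set zero_le)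
  qed
qed

lemma prod_list_noncentral:
  assumes "ks \<noteq> []" "\<forall>k\<in>set ks. \<not> is_Cen k"
  shows "prod_list ks = noncentral_value ks"
  using assms
proof (induction ks rule: list_nonempty_induct)
  case (single k)
  then show ?case
    by (cases k) (auto simp: noncentral_value_def singular_def touches_def)
next
  case (cons k ks)
  then obtain l ls where ks: "ks = l # ls" by (cases ks) auto
  have IH: "prod_list ks = noncentral_value ks" using cons by auto
  have 1: "singular (k # ks) \<longleftrightarrow> is_F k \<or> clash k l \<or> singular ks"
    by (auto simp: ks singular_def)
  have 2: "touches (k # ks) = of_bool (touch k l) + touches ks"
    by (simp add: ks touches_def)
  have nc: "\<not> is_Cen k" "\<not> is_Cen l" using cons.prems ks by auto
  have nl: "\<not> singular ks \<Longrightarrow> \<not> is_F l" by (simp add: ks singular_def)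
  have pos: "singular ks \<Longrightarrow> 0 < touches ks + length (filter is_F ks)"
    by (rule singular_pos)
  have hl: "hd ks = l" "last (k # ks) = last ks" by (simp_all add: ks)
  have last: "\<not> singular ks \<Longrightarrow> \<not> is_F (last ks)" "\<not> is_Cen (last ks)"
    using cons.prems cons.hyps by (auto simp: singular_def)
  have "prod_list (k # ks) = k * noncentral_value ks" by (simp add: IH)
  also have "\<dots> = noncentral_value (k # ks)"
  proof (cases "singular ks")
    case True
    \<comment> \<open>Here \<open>t\<close> stands for \<open>touches\<close> plus the number of
      \<open>F\<close> factors; its positivity allows the contribution of \<open>k\<close> to be
      added under the truncated subtraction.\<close>
    have "k * F a (e + t - 1) b = F (left_end k) (expo k + e + (of_bool (right_end k = a) + t) +
        of_bool (is_F k) - 1) b" if "0 < t" for e t a b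
      using nc(1) that by (cases k) auto
    note * = this[OF pos[OF True], where e = "sum_list (map expo ks)"]
    show ?thesis using * cons.hyps
      by (simp add: noncentral_value_def Let_def True 1 2 hl touch_def ac_simps)
  next
    case False
    then obtain i n j i' n' j' where l: "l = E i n j" and e: "last ks = E i' n' j'"
      using nc(2) nl last by (cases l; cases "last ks") auto
    have "filter is_F ks = []" using False by (auto simp: singular_def filter_empty_conv)
    then show ?thesis using False nc 1 2 hl
      by (cases k) (auto simp: noncentral_value_def Let_def touch_def clash_def l e)
  qed
  finally show ?case .
qed

lemma Cen_commute: "Cen n * k = k * Cen n"
  by (cases k) auto

lemma prod_list_central:
  "prod_list ks = Cen (sum_list (map expo (filter is_Cen ks))) * prod_list (filter (Not \<circ> is_Cen) ks)"
proof (induction ks)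
  case (Cons k ks)
  show ?case
  proof (cases "is_Cen k")
    case True
    then obtain n where "k = Cen n" by (cases k) auto
    with Cons show ?thesis by (simp add: mult.assoc[symmetric])
  next
    case False
    with Cons show ?thesis by simp (metis Cen_commute mult.assoc)
  qed
qed (simp add: one_kel_def)

section \<open>The combinatorial form of the identities\<close>

definition padded :: "'a list \<Rightarrow> 'a option list" where
  "padded v = None # map Some v @ [None]"

lemma adjacent_snoc: "v \<noteq> [] \<Longrightarrow> adjacent (v @ [a]) = adjacent v @ [(last v, a)]"
proof (induction v rule: induct_list012)
  case (3 x y zs)
  then show ?case by simp
qed auto

lemma adjacent_map: "adjacent (map f v) = map (map_prod f f) (adjacent v)"
  by (simp add: adjacent_def zip_map_map map_tl[symmetric] map_prod_def)

lemma adjacent_padded: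
  "v \<noteq> [] \<Longrightarrow> adjacent (padded v) =
     (None, Some (hd v)) # map (map_prod Some Some) (adjacent v) @ [(Some (last v), None)]"
proof -
  assume "v \<noteq> []"
  then have "adjacent (padded v) = (None, Some (hd v)) # adjacent (map Some v @ [None])"
    by (cases v) (simp_all add: padded_def)
  also have "adjacent (map Some v @ [None]) = adjacent (map Some v) @ [(Some (last v), None)]"
    using \<open>v \<noteq> []\<close> by (simp add: adjacent_snoc last_map)
  finally show ?thesis by (simp add: adjacent_map)
qed

lemma length_adjacent_padded: "length (adjacent (padded v)) = Suc (length v)"
  by (simp add: adjacent_def padded_def)

text \<open>The end markers do the work: the pairs containing \<open>None\<close> show the outer
  letters, and every occurrence of a letter is a first component exactly once, which recovers the
  multiset of letters.\<close>

lemma adjacent_padded_eqD: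
  assumes eq: "mset (adjacent (padded v)) = mset (adjacent (padded v'))"
  shows "length v = length v'"
    "v \<noteq> [] \<Longrightarrow> hd v = hd v'" "v \<noteq> [] \<Longrightarrow> last v = last v'"
    "mset (adjacent v) = mset (adjacent v')"
    "mset v = mset v'"
proof -
  show len: "length v = length v'"
    using arg_cong[OF eq, of size] unfolding size_mset length_adjacent_padded by simp
  have set: "set (adjacent (padded v)) = set (adjacent (padded v'))"
    by (rule mset_eq_setD[OF eq])
  show hd: "hd v = hd v'" if "v \<noteq> []"
  proof -
    have "(None, Some (hd v)) \<in> set (adjacent (padded v'))"
      unfolding set[symmetric] adjacent_padded[OF that] by simp
    then show ?thesis using len that by (cases "v' = []") (auto simp: adjacent_padded)
  qed
  show last: "last v = last v'" if "v \<noteq> []"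
  proof -
    have "(Some (last v), None) \<in> set (adjacent (padded v'))"
      unfolding set[symmetric] adjacent_padded[OF that] by simp
    then show ?thesis using len that by (cases "v' = []") (auto simp: adjacent_padded)
  qed
  have "mset (adjacent v) = mset (adjacent v') \<and> mset v = mset v'"
  proof (cases "v = []")
    case True
    then show ?thesis using len by simp
  next
    case False
    then have "v' \<noteq> []" using len by auto
    have "image_mset (map_prod Some Some) (mset (adjacent v)) =
      image_mset (map_prod Some Some) (mset (adjacent v'))"
      using eq adjacent_padded[OF False] adjacent_padded[OF \<open>v' \<noteq> []\<close>] hd[OF False] last[OF False]
      by simp
    moreover have "inj (image_mset (map_prod Some Some))"
      by (intro multiset.inj_map) (auto simp: inj_def)
    ultimately have 1: "mset (adjacent v) = mset (adjacent v')"
      by (rule injD[rotated])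
    have "map fst (adjacent (padded u)) = None # map Some u" for u :: "'a list"
      by (simp add: adjacent_def padded_def map_fst_zip_take)
    then have "image_mset fst (mset (adjacent (padded u))) = mset (None # map Some u)" for u :: "'a list"
      by (simp only: mset_map[symmetric])
    from this[of v] this[of v'] have "mset (None # map Some v) = mset (None # map Some v')"
      by (simp only: eq)
    then have "image_mset Some (mset v) = image_mset Some (mset v')" by simp
    then have "mset v = mset v'"
      by (rule injD[OF multiset.inj_map[OF inj_Some]])
    with 1 show ?thesis by simp
  qed
  then show "mset (adjacent v) = mset (adjacent v')" "mset v = mset v'" by auto
qed

lemma length_filter_mset_eq: "mset xs = mset ys \<Longrightarrow> length (filter P xs) = length (filter P ys)"
proof -
  assume "mset xs = mset ys"
  then have "size (mset (filter P xs)) = size (mset (filter P ys))" by (simp only: mset_filter)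
  then show ?thesis by (simp only: size_mset)
qed

lemma sum_list_mset_eq:
  fixes f :: "'a \<Rightarrow> nat"
  shows "mset xs = mset ys \<Longrightarrow> sum_list (map f xs) = sum_list (map f ys)"
  by (simp flip: sum_mset_sum_list)

section \<open>Identities and adjacencies after deletion\<close>

definition same_adjacencies :: "'a list \<Rightarrow> 'a list \<Rightarrow> bool" where
  "same_adjacencies w w' \<longleftrightarrow>
     (\<forall>D. finite D \<longrightarrow> mset (adjacent (padded (filter (\<lambda>x. x \<notin> D) w))) =
          mset (adjacent (padded (filter (\<lambda>x. x \<notin> D) w'))))"

text \<open>Only letters of \<open>w\<close> and \<open>w'\<close> influence the filters, so an
  arbitrary \<open>D\<close> can be cut down to a finite set. Finiteness in the definition serves
  the later sum over the subsets of \<open>D\<close>.\<close>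

lemma same_adjacenciesD:
  assumes "same_adjacencies w w'"
  shows "mset (adjacent (padded (filter (\<lambda>x. x \<notin> D) w))) =
    mset (adjacent (padded (filter (\<lambda>x. x \<notin> D) w')))"
proof -
  let ?D = "D \<inter> (set w \<union> set w')"
  have "mset (adjacent (padded (filter (\<lambda>x. x \<notin> ?D) w))) =
    mset (adjacent (padded (filter (\<lambda>x. x \<notin> ?D) w')))"
    by (rule assms[unfolded same_adjacencies_def, rule_format]) simp
  moreover have "filter (\<lambda>x. x \<notin> ?D) w = filter (\<lambda>x. x \<notin> D) w"
    "filter (\<lambda>x. x \<notin> ?D) w' = filter (\<lambda>x. x \<notin> D) w'"
    by (rule filter_cong; auto)+
  ultimately show ?thesis by simp
qed

text \<open>Letters with central values commute out and contribute the sum of their exponents. What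
  remains is a \<open>noncentral_value\<close>, every ingredient of which can be read off from the
  adjacencies left after deleting these letters.\<close>

lemma same_adjacencies_imp_prod_list_eq:
  fixes g :: "'a \<Rightarrow> kel"
  assumes "same_adjacencies w w'"
  shows "prod_list (map g w) = prod_list (map g w')"
proof -
  let ?D = "{x. is_Cen (g x)}"
  let ?v = "filter (\<lambda>x. x \<notin> ?D) w" and ?v' = "filter (\<lambda>x. x \<notin> ?D) w'"
  note eq = adjacent_padded_eqD[OF same_adjacenciesD[OF assms, of ?D]]
  have "mset w = mset w'"
    using adjacent_padded_eqD(5)[OF same_adjacenciesD[OF assms, of "{}"]] by simp
  then have "mset (filter is_Cen (map g w)) = mset (filter is_Cen (map g w'))"
    by simp
  then have cen: "sum_list (map expo (filter is_Cen (map g w))) =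
      sum_list (map expo (filter is_Cen (map g w')))"
    by (rule sum_list_mset_eq)
  have f: "filter (Not \<circ> is_Cen) (map g u) = map g (filter (\<lambda>x. x \<notin> ?D) u)" for u
    by (simp add: filter_map comp_def)
  have "prod_list (map g ?v) = prod_list (map g ?v')"
  proof (cases "?v = []")
    case True
    then have "?v' = []" using eq(1) by simp
    with True show ?thesis by (simp only:)
  next
    case False
    then have "?v' \<noteq> []" using eq(1) by (metis length_0_conv)
    have adj: "mset (adjacent (map g ?v)) = mset (adjacent (map g ?v'))"
      unfolding adjacent_map mset_map by (simp only: eq(4))
    have m: "mset (map g ?v) = mset (map g ?v')"
      unfolding mset_map by (simp only: eq(5))
    have "touches (map g ?v) = touches (map g ?v')"
      unfolding touches_def by (rule length_filter_mset_eq[OF adj])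
    moreover have "singular (map g ?v) = singular (map g ?v')"
      unfolding singular_def mset_eq_setD[OF adj] mset_eq_setD[OF m] ..
    moreover have "length (filter is_F (map g ?v)) = length (filter is_F (map g ?v'))"
      by (rule length_filter_mset_eq[OF m])
    moreover have "sum_list (map expo (map g ?v)) = sum_list (map expo (map g ?v'))"
      by (rule sum_list_mset_eq[OF m])
    ultimately have "noncentral_value (map g ?v) = noncentral_value (map g ?v')"
      by (simp only: noncentral_value_def hd_map[OF False] hd_map[OF \<open>?v' \<noteq> []\<close>]
          last_map[OF False] last_map[OF \<open>?v' \<noteq> []\<close>] eq(2,3)[OF False])
    then show ?thesis using False \<open>?v' \<noteq> []\<close>
      by (subst (1 2) prod_list_noncentral) auto
  qed
  then show ?thesis
    by (subst (1 2) prod_list_central) (simp only: f cen)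
qed

text \<open>For \<open>X, Y \<in> {0, 1}\<close> the truth value of \<open>X = Y\<close> is \<open>1 - X - Y + 2XY\<close>, so the alternating sum
  isolates the term \<open>2XY\<close>.\<close>

lemma count_pair_sums:
  fixes xs :: "('a \<times> 'a) list"
  defines "S \<equiv> \<lambda>J I. int (length (filter (\<lambda>(x, y). (x \<in> J) = (y \<in> I)) xs))"
  shows "2 * int (count (mset xs) (a, b)) = S {a} {b} - S {a} {} - S {} {b} + S {} {}"
  unfolding S_def by (induction xs) (auto simp: split_beta)

text \<open>Letters of \<open>D\<close> go to 1; for the others \<open>I\<close> and
  \<open>J\<close> choose left and right end between \<open>I1\<close> and \<open>I2\<close>. On
  these two indices \<open>outer\<close> is injective, so nothing clashes: the product stays of type
  \<open>E\<close>, its exponent is the bare number of touching pairs, and its indices test the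
  first and the last letter.\<close>

lemma prod_list_eq_imp_same_adjacencies:
  fixes w w' :: "'a list"
  assumes "\<And>g :: 'a \<Rightarrow> kel. prod_list (map g w) = prod_list (map g w')"
  shows "same_adjacencies w w'"
  unfolding same_adjacencies_def
proof (intro allI impI)
  fix D :: "'a set"
  let ?v = "filter (\<lambda>x. x \<notin> D) w" and ?v' = "filter (\<lambda>x. x \<notin> D) w'"
  let ?i = "\<lambda>I x. if x \<in> I then I1 else I2"
  let ?g = "\<lambda>I J x. if x \<in> D then 1 else E (?i I x) 0 (?i J x)"
  have del: "prod_list (map (?g I J) u) = prod_list (map (?g I J) (filter (\<lambda>x. x \<notin> D) u))" for I J u
    by (induction u) simp_all
  have val: "prod_list (map (?g I J) u) =
      (if filter (\<lambda>x. x \<notin> D) u = [] then 1 else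
       E (?i I (hd (filter (\<lambda>x. x \<notin> D) u)))
         (length (filter (\<lambda>(x, y). (x \<in> J) = (y \<in> I)) (adjacent (filter (\<lambda>x. x \<notin> D) u))))
         (?i J (last (filter (\<lambda>x. x \<notin> D) u))))" for I J u
  proof (cases "filter (\<lambda>x. x \<notin> D) u = []")
    case True
    then show ?thesis by (subst del) simp
  next
    case False
    let ?u = "filter (\<lambda>x. x \<notin> D) u"
    let ?h = "\<lambda>x. E (?i I x) 0 (?i J x)"
    have map_eq: "map (?g I J) ?u = map ?h ?u" by simp
    have "prod_list (map (?g I J) u) = prod_list (map ?h ?u)"
      by (subst del) (simp only: map_eq)
    also have "\<dots> = noncentral_value (map ?h ?u)"
      using False by (intro prod_list_noncentral) auto
    also have "\<dots> = E (?i I (hd ?u)) (touches (map ?h ?u)) (?i J (last ?u))"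
    proof -
      have "\<not> singular (map ?h ?u)"
      proof -
        have "\<not> clash (?h a) (?h b)" for a b
          by (simp add: clash_def touch_def outer_def)
        then show ?thesis
          unfolding singular_def adjacent_map by auto
      qed
      moreover have "sum_list (map expo (map ?h ?u)) = 0" by (simp add: comp_def)
      ultimately show ?thesis using False
        by (simp add: noncentral_value_def hd_map last_map del: map_map)
    qed
    also have "touches (map ?h ?u) = length (filter (\<lambda>(x, y). (x \<in> J) = (y \<in> I)) (adjacent ?u))"
      unfolding touches_def adjacent_map filter_map length_map
      by (rule arg_cong[where f = length], rule filter_cong)
        (simp_all add: touch_def outer_def comp_def split_beta)
    finally show ?thesis using False by simp
  qed
  note eq = assms[of "?g I J" for I J, unfolded val]
  have emp: "?v = [] \<longleftrightarrow> ?v' = []"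
    using eq[of UNIV UNIV] by (auto simp: one_kel_def split: if_splits)
  show "mset (adjacent (padded ?v)) = mset (adjacent (padded ?v'))"
  proof (cases "?v = []")
    case True
    then show ?thesis using emp by simp
  next
    case False
    then have F': "?v' \<noteq> []" using emp by simp
    have eq': "?i I (hd ?v) = ?i I (hd ?v')" "?i J (last ?v) = ?i J (last ?v')"
      "length (filter (\<lambda>(x, y). (x \<in> J) = (y \<in> I)) (adjacent ?v)) =
       length (filter (\<lambda>(x, y). (x \<in> J) = (y \<in> I)) (adjacent ?v'))" for I J
      using eq[of I J, unfolded if_not_P[OF False] if_not_P[OF F'] kel.inject] by blast+
    have hd: "hd ?v = hd ?v'" using eq'(1)[of "{hd ?v}"] by (auto split: if_splits)
    have last: "last ?v = last ?v'" using eq'(2)[of "{last ?v}"] by (auto split: if_splits)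
    have "count (mset (adjacent ?v)) p = count (mset (adjacent ?v')) p" for p
    proof -
      obtain a b where p: "p = (a, b)" by (cases p)
      have "2 * int (count (mset (adjacent ?v)) p) = 2 * int (count (mset (adjacent ?v')) p)"
        unfolding p count_pair_sums by (simp only: eq'(3))
      then show ?thesis by simp
    qed
    then have "mset (adjacent ?v) = mset (adjacent ?v')" by (rule multiset_eqI)
    then show ?thesis using False F' hd last by (simp add: adjacent_padded)
  qed
qed

theorem holds_identity_kauffman4_iff:
  assumes "w \<noteq> []" "w' \<noteq> []"
  shows "holds_identity TYPE(kauffman4) w w' \<longleftrightarrow> same_adjacencies w w'"
  unfolding holds_identity_kauffman4_kel holds_identity_monoid[OF assms]
  using same_adjacencies_imp_prod_list_eq prod_list_eq_imp_same_adjacencies by blast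

section \<open>Adjacencies sorted by the exact set of letters in between\<close>

definition gap_pair :: "'a list \<Rightarrow> nat \<Rightarrow> nat \<Rightarrow> bool" where
  "gap_pair u p q \<longleftrightarrow> p < q \<and> q < length u \<and>
     u ! p \<notin> (!) u ` {p<..<q} \<and> u ! q \<notin> (!) u ` {p<..<q}"

text \<open>Counting left positions counts pairs: as \<open>y\<close> does not occur in between,
  \<open>q\<close> is the first occurrence of \<open>y\<close> after \<open>p\<close>.\<close>

definition gaps :: "'a list \<Rightarrow> 'a \<Rightarrow> 'a set \<Rightarrow> 'a \<Rightarrow> nat set" where
  "gaps u x S y = {p. \<exists>q. gap_pair u p q \<and> u ! p = x \<and> u ! q = y \<and> (!) u ` {p<..<q} = S}"

text \<open>For \<open>x\<close> and \<open>y\<close> outside \<open>D\<close>, these are the places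
  where \<open>x\<close> and \<open>y\<close> become adjacent once \<open>D\<close> is
  deleted.\<close>

definition short_gaps :: "'a list \<Rightarrow> 'a \<Rightarrow> 'a set \<Rightarrow> 'a \<Rightarrow> nat set" where
  "short_gaps u x D y =
     {p. \<exists>q. p < q \<and> q < length u \<and> u ! p = x \<and> u ! q = y \<and> (!) u ` {p<..<q} \<subseteq> D}"

lemma finite_gaps: "finite (gaps u x S y)" "finite (short_gaps u x D y)"
  by (rule finite_subset[of _ "{..<length u}"]; auto simp: gaps_def short_gaps_def gap_pair_def)+

lemma card_nat_split:
  assumes "finite {p. P p}"
  shows "card {p :: nat. P p} = of_bool (P 0) + card {p. P (Suc p)}"
proof -
  have fin: "finite (Suc ` {p. P (Suc p)})"
    by (rule finite_subset[OF _ assms]) auto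
  have "{p. P p} = (if P 0 then {0} else {}) \<union> Suc ` {p. P (Suc p)}"
    (is "?L = ?A \<union> ?B")
  proof (rule set_eqI)
    show "n \<in> ?L \<longleftrightarrow> n \<in> ?A \<union> ?B" for n by (cases n) auto
  qed
  moreover have "card (?A \<union> ?B) = card ?A + card ?B"
    using fin by (intro card_Un_disjoint) auto
  ultimately show ?thesis by (simp add: card_image)
qed

lemma image_nth_Cons: "(!) (a # u) ` {Suc p<..<Suc q} = (!) u ` {p<..<q}"
proof -
  have "{Suc p<..<Suc q} = Suc ` {p<..<q}"
    (is "?L = ?R")
  proof (rule set_eqI)
    show "n \<in> ?L \<longleftrightarrow> n \<in> ?R" for n by (cases n) auto
  qed
  then show ?thesis by (auto simp: image_image)
qed

lemma hd_filter_iff: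
  assumes "y \<notin> D"
  shows "filter (\<lambda>x. x \<notin> D) u \<noteq> [] \<and> hd (filter (\<lambda>x. x \<notin> D) u) = y \<longleftrightarrow>
    (\<exists>q<length u. u ! q = y \<and> (!) u ` {..<q} \<subseteq> D)"
  using assms
proof (induction u)
  case (Cons a u)
  have *: "(!) (a # u) ` {..<Suc q} = insert a ((!) u ` {..<q})" for q
    by (simp add: lessThan_Suc_eq_insert_0 image_image)
  have "(\<exists>q<length (a # u). (a # u) ! q = y \<and> (!) (a # u) ` {..<q} \<subseteq> D) \<longleftrightarrow>
    a = y \<or> (\<exists>q<length u. u ! q = y \<and> insert a ((!) u ` {..<q}) \<subseteq> D)"
    (is "?L \<longleftrightarrow> ?R")
  proof
    assume ?L
    then obtain q where q: "q < length (a # u)" "(a # u) ! q = y" "(!) (a # u) ` {..<q} \<subseteq> D" by blast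
    show ?R
    proof (cases q)
      case 0
      then show ?thesis using q by simp
    next
      case (Suc q')
      then have "u ! q' = y" "q' < length u" using q by auto
      moreover have "insert a ((!) u ` {..<q'}) \<subseteq> D" using q(3) unfolding Suc * .
      ultimately show ?thesis by blast
    qed
  next
    assume ?R
    then show ?L
    proof
      assume "a = y"
      then show ?L by (intro exI[of _ 0]) simp
    next
      assume "\<exists>q<length u. u ! q = y \<and> insert a ((!) u ` {..<q}) \<subseteq> D"
      then obtain q where "q < length u" "u ! q = y" "insert a ((!) u ` {..<q}) \<subseteq> D" by blast
      then show ?L by (intro exI[of _ "Suc q"]) (simp add: *)
    qed
  qed
  with Cons show ?case by auto
qed simp

text \<open>Induction on the word: a new first letter creates at most one adjacency, with the first
  surviving letter of the tail, and shifts the old positions by one.\<close>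

lemma count_adjacent_filter:
  assumes "x \<notin> D" "y \<notin> D"
  shows "count (mset (adjacent (filter (\<lambda>x. x \<notin> D) u))) (x, y) = card (short_gaps u x D y)"
proof (induction u)
  case Nil
  then show ?case by (simp add: short_gaps_def)
next
  case (Cons a u)
  let ?f = "filter (\<lambda>x. x \<notin> D)"
  have tail: "Suc p \<in> short_gaps (a # u) x D y \<longleftrightarrow> p \<in> short_gaps u x D y" for p
  proof
    assume "Suc p \<in> short_gaps (a # u) x D y"
    then obtain q where q: "Suc p < q" "q < length (a # u)" "(a # u) ! Suc p = x" "(a # u) ! q = y"
      "(!) (a # u) ` {Suc p<..<q} \<subseteq> D" unfolding short_gaps_def by blast
    then obtain q' where q': "q = Suc q'" by (cases q) auto
    have "(!) u ` {p<..<q'} \<subseteq> D"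
      using q(5) unfolding q' image_nth_Cons .
    with q q' show "p \<in> short_gaps u x D y"
      unfolding short_gaps_def by auto
  next
    assume "p \<in> short_gaps u x D y"
    then obtain q where q: "p < q" "q < length u" "u ! p = x" "u ! q = y"
      "(!) u ` {p<..<q} \<subseteq> D" unfolding short_gaps_def by blast
    moreover have "(!) (a # u) ` {Suc p<..<Suc q} \<subseteq> D"
      using q(5) unfolding image_nth_Cons .
    ultimately show "Suc p \<in> short_gaps (a # u) x D y"
      unfolding short_gaps_def
      by (intro CollectI exI[of _ "Suc q"] conjI) (assumption | simp)+
  qed
  have head: "0 \<in> short_gaps (a # u) x D y \<longleftrightarrow> a = x \<and> ?f u \<noteq> [] \<and> hd (?f u) = y"
  proof -
    have shift: "(!) (a # u) ` {0<..<Suc q} = (!) u ` {..<q}" for q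
    proof -
      have "{0<..<Suc q} = Suc ` {..<q}"
        (is "?L = ?R")
      proof (rule set_eqI)
        show "n \<in> ?L \<longleftrightarrow> n \<in> ?R" for n by (cases n) auto
      qed
      then show ?thesis by (auto simp: image_image)
    qed
    have "0 \<in> short_gaps (a # u) x D y \<longleftrightarrow>
      (\<exists>q. 0 < q \<and> q < length (a # u) \<and> a = x \<and> (a # u) ! q = y \<and> (!) (a # u) ` {0<..<q} \<subseteq> D)"
      unfolding short_gaps_def by simp
    also have "\<dots> \<longleftrightarrow> a = x \<and> (\<exists>q. q < length u \<and> u ! q = y \<and> (!) u ` {..<q} \<subseteq> D)"
      unfolding shift[symmetric]
      by (metis Suc_less_eq length_Cons nth_Cons_Suc zero_less_Suc not0_implies_Suc less_numeral_extra(3))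
    finally show ?thesis using hd_filter_iff[OF assms(2), of u] by blast
  qed
  have "card (short_gaps (a # u) x D y) = of_bool (0 \<in> short_gaps (a # u) x D y) + card (short_gaps u x D y)"
    using card_nat_split[of "\<lambda>p. p \<in> short_gaps (a # u) x D y", unfolded tail Collect_mem_eq]
    by (simp only: finite_gaps)
  also have "\<dots> = count (mset (adjacent (?f (a # u)))) (x, y)"
  proof (cases "?f u")
    case Nil
    then show ?thesis using Cons head by auto
  next
    case (Cons b v)
    then show ?thesis using Cons.IH head assms by auto
  qed
  finally show ?case by simp
qed

text \<open>Every position has only one exact set: of two different right ends carrying
  \<open>y\<close>, the earlier would lie strictly inside the longer interval and force
  \<open>y\<close> into \<open>D\<close>.\<close>

lemma card_short_gaps:
  assumes "finite D" "x \<notin> D" "y \<notin> D"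
  shows "card (short_gaps u x D y) = (\<Sum>S\<in>Pow D. card (gaps u x S y))"
proof -
  have "short_gaps u x D y = (\<Union>S\<in>Pow D. gaps u x S y)"
  proof (rule set_eqI)
    fix p
    show "p \<in> short_gaps u x D y \<longleftrightarrow> p \<in> (\<Union>S\<in>Pow D. gaps u x S y)"
    proof
      assume "p \<in> short_gaps u x D y"
      then obtain q where q: "p < q" "q < length u" "u ! p = x" "u ! q = y"
        "(!) u ` {p<..<q} \<subseteq> D" unfolding short_gaps_def by blast
      then have "gap_pair u p q" using assms unfolding gap_pair_def by blast
      then have "p \<in> gaps u x ((!) u ` {p<..<q}) y"
        using q(3,4) unfolding gaps_def by blast
      then show "p \<in> (\<Union>S\<in>Pow D. gaps u x S y)" using q(5) by blast
    next
      assume "p \<in> (\<Union>S\<in>Pow D. gaps u x S y)"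
      then show "p \<in> short_gaps u x D y"
        unfolding short_gaps_def gaps_def gap_pair_def by blast
    qed
  qed
  moreover have "gaps u x S y \<inter> gaps u x T y = {}" if "S \<subseteq> D" "T \<subseteq> D" "S \<noteq> T" for S T
  proof (rule ccontr)
    assume "\<not> ?thesis"
    then obtain p q r where
      q: "q < length u" "u ! q = y" "(!) u ` {p<..<q} = S" "p < q" and
      r: "r < length u" "u ! r = y" "(!) u ` {p<..<r} = T" "p < r"
      unfolding gaps_def gap_pair_def by blast
    have sub: "y \<in> D" if "s < t" "u ! s = y" "p < s" "(!) u ` {p<..<t} \<subseteq> D" for s t
    proof -
      have "u ! s \<in> (!) u ` {p<..<t}" using that(1,3) by (intro imageI) simp
      then show ?thesis using that(2,4) by auto
    qed
    have "q \<noteq> r"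
    proof
      assume "q = r"
      then show False using that(3) unfolding q(3)[symmetric] r(3)[symmetric] by simp
    qed
    then have "q < r \<or> r < q" by linarith
    then have "y \<in> D"
      using sub[OF _ q(2,4), of r, unfolded r(3)] sub[OF _ r(2,4), of q, unfolded q(3)] that(1,2)
      by blast
    then show False using assms by simp
  qed
  then have "card (\<Union>S\<in>Pow D. gaps u x S y) = (\<Sum>S\<in>Pow D. card (gaps u x S y))"
    using assms(1) finite_gaps(1)[of u x _ y] by (intro card_UN_disjoint ballI impI) (simp_all del: Int_iff)
  ultimately show ?thesis by (simp only:)
qed

lemma padded_nth_None:
  assumes "r < length (padded w)" "padded w ! r = None"
  shows "r = 0 \<or> r = Suc (length w)"
  using assms by (cases r) (auto simp: padded_def nth_append split: if_splits)

lemma gaps_padded_None: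
  assumes "None \<in> S"
  shows "gaps (padded w) x S y = {}"
proof (rule ccontr)
  assume "\<not> ?thesis"
  then obtain p q where pq: "p < q" "q < length (padded w)"
    and S: "(!) (padded w) ` {p<..<q} = S"
    unfolding gaps_def gap_pair_def by auto
  have "None \<in> (!) (padded w) ` {p<..<q}" using assms unfolding S .
  then obtain r where "r \<in> {p<..<q}" "padded w ! r = None" by (metis imageE)
  then show False using pq padded_nth_None[of r w] by (auto simp: padded_def)
qed

lemma padded_filter: "padded (filter (\<lambda>x. x \<notin> D) w) = filter (\<lambda>x. x \<notin> Some ` D) (padded w)"
proof -
  have "filter (\<lambda>x. x \<notin> Some ` D) (map Some w) = map Some (filter (\<lambda>x. x \<notin> D) w)"
    by (induction w) auto
  then show ?thesis by (auto simp: padded_def)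
qed

lemma set_adjacentD: "(x, y) \<in> set (adjacent v) \<Longrightarrow> x \<in> set v \<and> y \<in> set v"
  by (induction v rule: induct_list012) auto

text \<open>Summing over the subsets of \<open>D\<close> gives one direction. Conversely the system
  is triangular: in the sum for the deleted set \<open>S\<close>, the term of \<open>S\<close>
  itself is the only one not already known from the proper subsets.\<close>

theorem same_adjacencies_iff_gaps:
  "same_adjacencies w w' \<longleftrightarrow>
     (\<forall>x S y. card (gaps (padded w) x S y) = card (gaps (padded w') x S y))"
proof
  assume *: "\<forall>x S y. card (gaps (padded w) x S y) = card (gaps (padded w') x S y)"
  show "same_adjacencies w w'"
    unfolding same_adjacencies_def
  proof (intro allI impI multiset_eqI)
    fix D :: "'a set" and p :: "'a option \<times> 'a option"
    assume D: "finite D"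
    obtain x y where p: "p = (x, y)" by (cases p)
    show "count (mset (adjacent (padded (filter (\<lambda>x. x \<notin> D) w)))) p =
      count (mset (adjacent (padded (filter (\<lambda>x. x \<notin> D) w')))) p"
    proof (cases "x \<in> Some ` D \<or> y \<in> Some ` D")
      case True
      then have "p \<notin> set (adjacent (filter (\<lambda>x. x \<notin> Some ` D) u))" for u
        unfolding p by (auto dest: set_adjacentD)
      then have "count (mset (adjacent (filter (\<lambda>x. x \<notin> Some ` D) u))) p = 0" for u
        by (simp only: count_eq_zero_iff set_mset_mset not_False_eq_True)
      then show ?thesis unfolding padded_filter by (simp only:)
    next
      case False
      then show ?thesis
        unfolding p padded_filter using D *
        by (simp add: count_adjacent_filter card_short_gaps del: count_mset)
    qed
  qed
next
  assume *: "same_adjacencies w w'"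
  have short: "card (short_gaps (padded w) x D y) = card (short_gaps (padded w') x D y)"
    if "finite D" "None \<notin> D" "x \<notin> D" "y \<notin> D" for x D y
  proof -
    \<comment> \<open>Deleted sets consist of letters, while \<open>S\<close> is a set of options. A
      set containing the marker \<open>None\<close> is not of this form and is treated
      apart.\<close>
    have D: "D = Some ` the ` D"
    proof -
      have "Some (the z) = id z" if "z \<in> D" for z
        using that \<open>None \<notin> D\<close> by (cases z) auto
      then have "(\<lambda>z. Some (the z)) ` D = id ` D" by (rule image_cong[OF HOL.refl])
      then show ?thesis by (simp add: image_image)
    qed
    have "mset (adjacent (padded (filter (\<lambda>x. x \<notin> the ` D) w))) =
      mset (adjacent (padded (filter (\<lambda>x. x \<notin> the ` D) w')))"
      by (rule *[THEN same_adjacenciesD])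
    then show ?thesis
      unfolding padded_filter D[symmetric]
      by (simp only: count_adjacent_filter[OF that(3,4), symmetric])
  qed
  have "card (gaps (padded w) x S y) = card (gaps (padded w') x S y)"
    if "finite S" for x S y
    using that
  proof (induction S rule: finite_psubset_induct)
    case (psubset S)
    show ?case
    proof (cases "None \<in> S \<or> x \<in> S \<or> y \<in> S")
      case True
      then have "gaps (padded u) x S y = {}" for u :: "'a list"
        using gaps_padded_None[of S u x y] by (auto simp: gaps_def gap_pair_def)
      then show ?thesis by simp
    next
      case False
      have "(\<Sum>T\<in>Pow S. card (gaps u x T y)) =
        card (gaps u x S y) + (\<Sum>T\<in>Pow S - {S}. card (gaps u x T y))" for u :: "'a option list"
        using psubset.hyps by (intro sum.remove) auto
      moreover have "(\<Sum>T\<in>Pow S - {S}. card (gaps (padded w) x T y)) =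
        (\<Sum>T\<in>Pow S - {S}. card (gaps (padded w') x T y))"
        by (rule sum.cong) (use psubset.IH in auto)
      ultimately show ?thesis
        using short[of S x y] False psubset.hyps card_short_gaps[of S x y] by simp
    qed
  qed
  moreover have "gaps u x S y = {}" if "infinite S" for u x S and y :: "'a option"
    using that by (auto simp: gaps_def)
  ultimately show "\<forall>x S y. card (gaps (padded w) x S y) = card (gaps (padded w') x S y)"
    by (metis)
qed

section \<open>Both words in a single string\<close>

definition glued :: "'a list \<Rightarrow> 'a list \<Rightarrow> 'a option list" where
  "glued w w' = (None # map Some w) @ padded w'"

text \<open>Requiring that no \<open>None\<close> lies in between keeps both ends in the same word.\<close>

definition inner_pair :: "'a option list \<Rightarrow> nat \<Rightarrow> nat \<Rightarrow> bool" where
  "inner_pair u p q \<longleftrightarrow> p < q \<and> q < length u \<and>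
     (\<forall>r. p < r \<longrightarrow> r < q \<longrightarrow> u ! r \<noteq> None \<and> u ! r \<noteq> u ! p \<and> u ! r \<noteq> u ! q)"

text \<open>Two pairs of positions are similar when they name the same triple \<open>x\<close>,
  \<open>S\<close>, \<open>y\<close>.\<close>

definition similar :: "'a list \<Rightarrow> nat \<Rightarrow> nat \<Rightarrow> nat \<Rightarrow> nat \<Rightarrow> bool" where
  "similar u p q p' q' \<longleftrightarrow> u ! p = u ! p' \<and> u ! q = u ! q' \<and>
     (!) u ` {p<..<q} = (!) u ` {p'<..<q'}"

lemma length_padded: "length (padded w) = length w + 2"
  by (simp add: padded_def)

text \<open>There are three markers and not four: the one at position \<open>Suc (length w)\<close>
  closes the first word and opens the second.\<close>

lemma length_glued: "length (glued w w') = length w + length w' + 3"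
  by (simp add: glued_def length_padded)

lemma glued_left: "c \<le> Suc (length w) \<Longrightarrow> glued w w' ! c = padded w ! c"
  by (auto simp: glued_def padded_def nth_append nth_Cons' split: if_splits)

lemma glued_right: "glued w w' ! (c + Suc (length w)) = padded w' ! c"
  by (simp add: glued_def nth_append)

text \<open>Serves both halves of the glued string: \<open>d\<close> is the offset of the padded
  word \<open>v\<close> inside \<open>u\<close>, namely 0 or \<open>Suc (length w)\<close>.\<close>

lemma inner_pair_iff_gap_pair:
  assumes "length v = n" "\<And>c. c \<le> q - p \<Longrightarrow> p \<le> q \<Longrightarrow> u ! (p + d + c) = v ! (p + c)"
    and "\<And>r. p < r \<Longrightarrow> r < q \<Longrightarrow> q < n \<Longrightarrow> v ! r \<noteq> None"
    and "q < n" "q + d < length u"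
  shows "inner_pair u (p + d) (q + d) \<longleftrightarrow> gap_pair v p q"
    and "p < q \<Longrightarrow> (!) u ` {p + d<..<q + d} = (!) v ` {p<..<q}"
proof -
  have eq: "u ! (c + d) = v ! c" if "p \<le> c" "c \<le> q" for c
    using assms(2)[of "c - p"] that by (simp add: algebra_simps)
  have im: "{p + d<..<q + d} = (\<lambda>c. c + d) ` {p<..<q}"
  proof (rule set_eqI)
    fix r show "r \<in> {p + d<..<q + d} \<longleftrightarrow> r \<in> (\<lambda>c. c + d) ` {p<..<q}"
      by (auto simp: image_iff intro!: bexI[of _ "r - d"])
  qed
  show img: "(!) u ` {p + d<..<q + d} = (!) v ` {p<..<q}" if "p < q"
    unfolding im image_image by (rule image_cong) (auto simp: eq)
  have "inner_pair u (p + d) (q + d) \<longleftrightarrow> p < q \<and>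
    (\<forall>z \<in> (!) u ` {p + d<..<q + d}. z \<noteq> None \<and> z \<noteq> u ! (p + d) \<and> z \<noteq> u ! (q + d))"
    using assms(5) by (auto simp: inner_pair_def)
  also have "\<dots> \<longleftrightarrow> p < q \<and> (\<forall>z \<in> (!) v ` {p<..<q}. z \<noteq> None \<and> z \<noteq> v ! p \<and> z \<noteq> v ! q)"
    using img eq[of p] eq[of q] by (metis less_imp_le order.refl)
  also have "\<dots> \<longleftrightarrow> gap_pair v p q"
  proof -
    have "\<forall>z \<in> (!) v ` {p<..<q}. z \<noteq> None" using assms(3,4) by auto
    then show ?thesis using assms(1,4) unfolding gap_pair_def by blast
  qed
  finally show "inner_pair u (p + d) (q + d) \<longleftrightarrow> gap_pair v p q" .
qed

lemma glued_left_pairs: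
  "{p'. \<exists>q'. inner_pair (glued w w') p' q' \<and> similar (glued w w') p q p' q' \<and> q' \<le> Suc (length w)} =
   gaps (padded w) (glued w w' ! p) ((!) (glued w w') ` {p<..<q}) (glued w w' ! q)"
proof -
  let ?u = "glued w w'"
  have pair: "inner_pair ?u p q \<longleftrightarrow> gap_pair (padded w) p q"
    "p < q \<Longrightarrow> (!) ?u ` {p<..<q} = (!) (padded w) ` {p<..<q}" if "q \<le> Suc (length w)" for p q
  proof -
    have *: "length (padded w) = length w + 2" by (rule length_padded)
    have none: "padded w ! r \<noteq> None" if "p < r" "r < q" for r
      using padded_nth_None[of r w] that \<open>q \<le> Suc (length w)\<close> by (auto simp: *)
    have nth: "?u ! (p + 0 + c) = padded w ! (p + c)" if "c \<le> q - p" "p \<le> q" for c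
      using glued_left[of "p + c" w w'] that \<open>q \<le> Suc (length w)\<close> by simp
    show "inner_pair ?u p q \<longleftrightarrow> gap_pair (padded w) p q"
      using inner_pair_iff_gap_pair(1)[of "padded w" "length w + 2" q p ?u 0] * none nth that
      by (simp add: length_glued)
    show "(!) ?u ` {p<..<q} = (!) (padded w) ` {p<..<q}" if "p < q"
      using inner_pair_iff_gap_pair(2)[of "padded w" "length w + 2" q p ?u 0] * none nth that \<open>q \<le> Suc (length w)\<close>
      by (simp add: length_glued)
  qed
  have bound: "q \<le> Suc (length w)" "p < q" if "gap_pair (padded w) p q" for p q
    using that by (auto simp: gap_pair_def length_padded)
  have key: "inner_pair ?u p' q' \<and> similar ?u p q p' q' \<and> q' \<le> Suc (length w) \<longleftrightarrow>
    gap_pair (padded w) p' q' \<and> padded w ! p' = ?u ! p \<and> padded w ! q' = ?u ! q \<and>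
      (!) (padded w) ` {p'<..<q'} = (!) ?u ` {p<..<q}" for p' q'
  proof (cases "q' \<le> Suc (length w) \<and> p' < q'")
    case True
    then have "?u ! p' = padded w ! p'" "?u ! q' = padded w ! q'" by (simp_all add: glued_left)
    then show ?thesis
      using pair[of q' p'] True unfolding similar_def by metis
  next
    case False
    then show ?thesis using bound[of p' q'] by (auto simp: inner_pair_def)
  qed
  show ?thesis unfolding gaps_def key by (rule HOL.refl)
qed

lemma glued_right_pairs:
  "{p'. \<exists>q'. inner_pair (glued w w') p' q' \<and> similar (glued w w') p q p' q' \<and> Suc (length w) \<le> p'} =
   (\<lambda>c. c + Suc (length w)) `
     gaps (padded w') (glued w w' ! p) ((!) (glued w w') ` {p<..<q}) (glued w w' ! q)"
    (is "?L = ?f ` ?R")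
proof -
  let ?u = "glued w w'" and ?M = "Suc (length w)"
  have key: "inner_pair ?u (p' + ?M) (q' + ?M) \<and> similar ?u p q (p' + ?M) (q' + ?M) \<longleftrightarrow>
    gap_pair (padded w') p' q' \<and> padded w' ! p' = ?u ! p \<and> padded w' ! q' = ?u ! q \<and>
      (!) (padded w') ` {p'<..<q'} = (!) ?u ` {p<..<q}" for p' q'
  proof (cases "q' < length w' + 2 \<and> p' < q'")
    case True
    have none: "padded w' ! r \<noteq> None" if "p' < r" "r < q'" for r
      using padded_nth_None[of r w'] that True by (auto simp: length_padded)
    have nth: "?u ! (p' + ?M + c) = padded w' ! (p' + c)" for c
      using glued_right[of w w' "p' + c"] by (simp add: ac_simps)
    have "inner_pair ?u (p' + ?M) (q' + ?M) \<longleftrightarrow> gap_pair (padded w') p' q'"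
      "(!) ?u ` {p' + ?M<..<q' + ?M} = (!) (padded w') ` {p'<..<q'}"
      using True inner_pair_iff_gap_pair[of "padded w'" "length w' + 2" q' p' ?u ?M, OF length_padded nth none]
      by (simp_all add: length_glued)
    then show ?thesis
      unfolding similar_def glued_right by metis
  next
    case False
    then show ?thesis by (auto simp: inner_pair_def gap_pair_def length_padded length_glued)
  qed
  show ?thesis
  proof (rule set_eqI)
    fix p'
    show "p' \<in> ?L \<longleftrightarrow> p' \<in> ?f ` ?R"
    proof
      assume "p' \<in> ?L"
      then obtain q' where q: "inner_pair ?u p' q'" "similar ?u p q p' q'" "?M \<le> p'" by blast
      then have "?M \<le> q'" by (simp add: inner_pair_def)
      then have "p' = (p' - ?M) + ?M" "q' = (q' - ?M) + ?M" using q(3) by simp_all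
      then have "p' - ?M \<in> ?R" unfolding gaps_def using q(1,2) key[of "p' - ?M" "q' - ?M"] by auto
      then show "p' \<in> ?f ` ?R" using q(3) by (intro image_eqI[of _ _ "p' - ?M"]) auto
    next
      assume "p' \<in> ?f ` ?R"
      then obtain c where c: "c \<in> ?R" "p' = c + ?M" by blast
      then obtain q' where "inner_pair ?u (c + ?M) (q' + ?M)" "similar ?u p q (c + ?M) (q' + ?M)"
        unfolding gaps_def using key[of c] by blast
      then show "p' \<in> ?L" using c(2) by auto
    qed
  qed
qed

text \<open>A triple that no inner pair realises has count 0 in both words, so only realised triples
  need to be compared. The middle marker separates the pairs of the two words.\<close>

theorem same_adjacencies_iff_glued:
  "same_adjacencies w w' \<longleftrightarrow>
    (\<forall>p q. inner_pair (glued w w') p q \<longrightarrow>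
      card {p'. \<exists>q'. inner_pair (glued w w') p' q' \<and> similar (glued w w') p q p' q' \<and> q' \<le> Suc (length w)} =
      card {p'. \<exists>q'. inner_pair (glued w w') p' q' \<and> similar (glued w w') p q p' q' \<and> Suc (length w) \<le> p'})"
    (is "_ \<longleftrightarrow> (\<forall>p q. ?I p q \<longrightarrow> card (?A p q) = card (?B p q))")
proof -
  let ?u = "glued w w'"
  have A: "?A p q = gaps (padded w) (?u ! p) ((!) ?u ` {p<..<q}) (?u ! q)" for p q
    by (rule glued_left_pairs)
  have B: "card (?B p q) = card (gaps (padded w') (?u ! p) ((!) ?u ` {p<..<q}) (?u ! q))" for p q
    unfolding glued_right_pairs by (rule card_image) (simp add: inj_on_def)
  have "(\<forall>x S y. card (gaps (padded w) x S y) = card (gaps (padded w') x S y)) \<longleftrightarrow>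
    (\<forall>p q. ?I p q \<longrightarrow> card (?A p q) = card (?B p q))"
  proof
    assume "\<forall>x S y. card (gaps (padded w) x S y) = card (gaps (padded w') x S y)"
    then show "\<forall>p q. ?I p q \<longrightarrow> card (?A p q) = card (?B p q)" unfolding B unfolding A by blast
  next
    assume *: "\<forall>p q. ?I p q \<longrightarrow> card (?A p q) = card (?B p q)"
    show "\<forall>x S y. card (gaps (padded w) x S y) = card (gaps (padded w') x S y)"
    proof (intro allI)
      fix x S y
      show "card (gaps (padded w) x S y) = card (gaps (padded w') x S y)"
      proof (cases "\<exists>p q. ?I p q \<and> ?u ! p = x \<and> (!) ?u ` {p<..<q} = S \<and> ?u ! q = y")
        case True
        then obtain p q where "?I p q" "?u ! p = x" "(!) ?u ` {p<..<q} = S" "?u ! q = y" by blast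
        with * show ?thesis unfolding B unfolding A by blast
      next
        case False
        have none: "padded v ! r \<noteq> None" if "gap_pair (padded v) p q" "p < r" "r < q" for v :: "'a list" and p q r
          using padded_nth_None[of r v] that by (auto simp: gap_pair_def length_padded)
        have "gaps (padded w) x S y = {}"
        proof (rule ccontr)
          assume "\<not> ?thesis"
          then obtain p q where g: "gap_pair (padded w) p q" "padded w ! p = x" "padded w ! q = y"
            "(!) (padded w) ` {p<..<q} = S" unfolding gaps_def by blast
          have "q < length w + 2" "p < q" using g(1) by (auto simp: gap_pair_def length_padded)
          moreover have "?u ! (p + 0 + c) = padded w ! (p + c)" if "c \<le> q - p" "p \<le> q" for c
            using glued_left[of "p + c" w w'] that \<open>q < length w + 2\<close> by simp
          ultimately have "?I p q" "(!) ?u ` {p<..<q} = S" "?u ! p = x" "?u ! q = y"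
            using g none[OF g(1)] glued_left[of p w w'] glued_left[of q w w']
              inner_pair_iff_gap_pair[of "padded w" "length w + 2" q p ?u 0]
            by (auto simp: length_padded length_glued)
          then show False using False by blast
        qed
        moreover have "gaps (padded w') x S y = {}"
        proof (rule ccontr)
          let ?M = "Suc (length w)"
          assume "\<not> ?thesis"
          then obtain p q where g: "gap_pair (padded w') p q" "padded w' ! p = x" "padded w' ! q = y"
            "(!) (padded w') ` {p<..<q} = S" unfolding gaps_def by blast
          have "q < length w' + 2" "p < q" using g(1) by (auto simp: gap_pair_def length_padded)
          moreover have nth: "?u ! (p + ?M + c) = padded w' ! (p + c)" for c
            using glued_right[of w w' "p + c"] by (simp add: ac_simps)
          ultimately have "?I (p + ?M) (q + ?M)" "(!) ?u ` {p + ?M<..<q + ?M} = S"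
            using g inner_pair_iff_gap_pair[of "padded w'" "length w' + 2" q p ?u ?M, OF length_padded nth none[OF g(1)]]
            by (auto simp: length_glued)
          moreover have "?u ! (p + ?M) = x" "?u ! (q + ?M) = y" using g(2,3) unfolding glued_right by auto
          ultimately show False using False by blast
        qed
        ultimately show ?thesis by simp
      qed
    qed
  qed
  then show ?thesis unfolding same_adjacencies_iff_gaps .
qed

section \<open>Structured programs for Turing machines\<close>

datatype prog =
    Act "nat list \<Rightarrow> nat list \<times> move list"
  | Seq prog prog
  | Cond "nat list \<Rightarrow> bool" prog prog
  | While "nat list \<Rightarrow> bool" prog

definition apply_act :: "nat list \<times> move list \<Rightarrow> tape list \<Rightarrow> tape list" where
  "apply_act a ts = map (\<lambda>(t, a, m). tape_update a m t) (zip ts (zip (fst a) (snd a)))"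

text \<open>The counts are the exact numbers of machine steps of the compiled code: a test takes one
  step, and one jump follows a then-branch or a loop body.\<close>

inductive exec :: "prog \<Rightarrow> tape list \<Rightarrow> nat \<Rightarrow> tape list \<Rightarrow> bool" where
  Act: "exec (Act f) ts 1 (apply_act (f (map tape_read ts)) ts)"
| Seq: "exec P ts n ts' \<Longrightarrow> exec Q ts' m ts'' \<Longrightarrow> exec (Seq P Q) ts (n + m) ts''"
| CondT: "t (map tape_read ts) \<Longrightarrow> exec P ts n ts' \<Longrightarrow> exec (Cond t P Q) ts (1 + n + 1) ts'"
| CondF: "\<not> t (map tape_read ts) \<Longrightarrow> exec Q ts n ts' \<Longrightarrow> exec (Cond t P Q) ts (1 + n) ts'"
| WhileF: "\<not> t (map tape_read ts) \<Longrightarrow> exec (While t P) ts 1 ts"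
| WhileT: "t (map tape_read ts) \<Longrightarrow> exec P ts n ts' \<Longrightarrow> exec (While t P) ts' m ts'' \<Longrightarrow>
    exec (While t P) ts (1 + n + 1 + m) ts''"

type_synonym instr = "nat list \<Rightarrow> nat \<times> nat list \<times> move list"

definition branch :: "(nat list \<Rightarrow> bool) \<Rightarrow> nat \<Rightarrow> nat \<Rightarrow> instr" where
  "branch t p q s = (if t s then p else q, s, replicate (length s) MStay)"

text \<open>Jump targets are absolute, so the code depends on its start address \<open>b\<close>;
  control leaves at the first address after the code. A \<open>branch\<close> with constantly true
  test is an unconditional jump, and its target 0 is a dummy.\<close>

fun assemble :: "nat \<Rightarrow> prog \<Rightarrow> instr list" where
  "assemble b (Act f) = [\<lambda>s. (b + 1, f s)]"
| "assemble b (Seq P Q) = (let c = assemble b P in c @ assemble (b + length c) Q)"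
| "assemble b (Cond t P Q) =
    (let c = assemble (b + 1) P; d = assemble (b + 2 + length c) Q
     in [branch t (b + 1) (b + 2 + length c)] @ c @
        [branch (\<lambda>_. True) (b + 2 + length c + length d) 0] @ d)"
| "assemble b (While t P) =
    (let c = assemble (b + 1) P
     in [branch t (b + 1) (b + 2 + length c)] @ c @ [branch (\<lambda>_. True) b 0])"

fun wf_prog :: "nat \<Rightarrow> nat \<Rightarrow> prog \<Rightarrow> bool" where
  "wf_prog k g (Act f) \<longleftrightarrow> (\<forall>s. length s = k \<longrightarrow> length (fst (f s)) = k \<and> length (snd (f s)) = k \<and>
     (set s \<subseteq> {..<g} \<longrightarrow> set (fst (f s)) \<subseteq> {..<g}))"
| "wf_prog k g (Seq P Q) \<longleftrightarrow> wf_prog k g P \<and> wf_prog k g Q"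
| "wf_prog k g (Cond t P Q) \<longleftrightarrow> wf_prog k g P \<and> wf_prog k g Q"
| "wf_prog k g (While t P) \<longleftrightarrow> wf_prog k g P"

definition wf_instr :: "nat \<Rightarrow> nat \<Rightarrow> nat \<Rightarrow> instr \<Rightarrow> bool" where
  "wf_instr k g n i \<longleftrightarrow> (\<forall>s. length s = k \<longrightarrow> set s \<subseteq> {..<g} \<longrightarrow>
     fst (i s) \<le> n \<and> length (fst (snd (i s))) = k \<and> set (fst (snd (i s))) \<subseteq> {..<g} \<and>
     length (snd (snd (i s))) = k)"

lemma wf_instr_mono: "wf_instr k g n i \<Longrightarrow> n \<le> m \<Longrightarrow> wf_instr k g m i"
  by (fastforce simp: wf_instr_def)

lemma wf_instr_branch: "p \<le> n \<Longrightarrow> q \<le> n \<Longrightarrow> wf_instr k g n (branch t p q)"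
  by (simp add: wf_instr_def branch_def)

lemma wf_comp: "wf_prog k g P \<Longrightarrow> i \<in> set (assemble b P) \<Longrightarrow> wf_instr k g (b + length (assemble b P)) i"
proof (induction P arbitrary: b i)
  case (Act f)
  then show ?case by (auto simp: wf_instr_def)
next
  case (Seq P Q)
  then show ?case by (fastforce simp: Let_def intro: wf_instr_mono)
next
  case (Cond t P Q)
  then show ?case
    by (fastforce simp: Let_def intro: wf_instr_mono intro!: wf_instr_branch)
next
  case (While t P)
  then show ?case
    by (fastforce simp: Let_def intro: wf_instr_mono intro!: wf_instr_branch)
qed

section \<open>Correctness of the compiled machine\<close>

locale machine =
  fixes M :: tm and code :: "instr list"
  assumes transition: "q < length code \<Longrightarrow> transition M q = code ! q"
    and halting: "length code \<le> accept_state M" "length code \<le> reject_state M"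
begin

lemma tm_step_code:
  assumes "q < length code"
  shows "tm_step M (q, ts) =
    (fst ((code ! q) (map tape_read ts)), apply_act (snd ((code ! q) (map tape_read ts))) ts)"
  using assms halting transition
  by (auto simp: tm_step_def apply_act_def split: prod.splits)

lemma apply_act_stay:
  "apply_act (map tape_read ts, replicate (length ts) MStay) ts = ts"
  by (induction ts) (auto simp: apply_act_def tape_update_def tape_read_def move_offset_def)

lemma tm_step_branch:
  assumes "q < length code" "code ! q = branch t p p'"
  shows "tm_step M (q, ts) = (if t (map tape_read ts) then p else p', ts)"
  using tm_step_code[OF assms(1), of ts] assms(2) apply_act_stay[of ts]
  by (simp add: branch_def)

text \<open>The induction is on the execution, because the rest of a loop run is a run of the same
  loop. The context \<open>pre\<close>, \<open>post\<close> lets the hypotheses apply to subprograms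
  at their actual addresses.\<close>

lemma exec_comp:
  assumes "exec P ts n ts'" "code = pre @ assemble (length pre) P @ post"
  shows "(tm_step M ^^ n) (length pre, ts) = (length pre + length (assemble (length pre) P), ts')"
  using assms
proof (induction arbitrary: pre post rule: exec.induct)
  case (Act f ts)
  then show ?case by (simp add: tm_step_code)
next
  case (Seq P ts n ts' Q m ts'')
  let ?c = "assemble (length pre) P"
  have "(tm_step M ^^ n) (length pre, ts) = (length pre + length ?c, ts')"
    using Seq.prems by (intro Seq.IH(1)) (simp add: Let_def)
  moreover have "(tm_step M ^^ m) (length (pre @ ?c), ts') =
      (length (pre @ ?c) + length (assemble (length (pre @ ?c)) Q), ts'')"
    using Seq.prems by (intro Seq.IH(2)) (simp add: Let_def)
  ultimately show ?case
    by (simp add: funpow_add[of m n, unfolded add.commute[of m]] Let_def)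
next
  case (CondT t ts P n ts' Q)
  let ?b = "length pre"
  let ?c = "assemble (?b + 1) P"
  let ?d = "assemble (?b + 2 + length ?c) Q"
  let ?i = "branch t (?b + 1) (?b + 2 + length ?c)"
  let ?j = "branch (\<lambda>_. True) (?b + 2 + length ?c + length ?d) 0"
  have code: "code = pre @ [?i] @ ?c @ [?j] @ ?d @ post"
    using CondT.prems by (simp add: Let_def)
  have 1: "tm_step M (?b, ts) = (?b + 1, ts)"
    using CondT.hyps tm_step_branch[of ?b t "?b + 1" "?b + 2 + length ?c"] by (simp add: code)
  have 2: "(tm_step M ^^ n) (length (pre @ [?i]), ts) = (length (pre @ [?i]) + length (assemble (length (pre @ [?i])) P), ts')"
    using code by (intro CondT.IH) simp
  have 3: "tm_step M (?b + 1 + length ?c, ts') = (?b + 2 + length ?c + length ?d, ts')"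
    using tm_step_branch[of "?b + 1 + length ?c" "\<lambda>_. True" "?b + 2 + length ?c + length ?d" 0]
    by (simp add: code nth_append)
  have "(tm_step M ^^ (1 + n + 1)) (?b, ts) = tm_step M ((tm_step M ^^ n) (tm_step M (?b, ts)))"
    by (simp add: funpow_swap1)
  then show ?case using 1 2 3 by (simp add: Let_def)
next
  case (CondF t ts Q n ts' P)
  let ?b = "length pre"
  let ?c = "assemble (?b + 1) P"
  let ?d = "assemble (?b + 2 + length ?c) Q"
  let ?i = "branch t (?b + 1) (?b + 2 + length ?c)"
  let ?j = "branch (\<lambda>_. True) (?b + 2 + length ?c + length ?d) 0"
  let ?pre = "pre @ [?i] @ ?c @ [?j]"
  have code: "code = pre @ [?i] @ ?c @ [?j] @ ?d @ post"
    using CondF.prems by (simp add: Let_def)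
  have 1: "tm_step M (?b, ts) = (?b + 2 + length ?c, ts)"
    using CondF.hyps tm_step_branch[of ?b t "?b + 1" "?b + 2 + length ?c"] by (simp add: code)
  have 2: "(tm_step M ^^ n) (length ?pre, ts) = (length ?pre + length (assemble (length ?pre) Q), ts')"
    using code by (intro CondF.IH) simp
  have "(tm_step M ^^ (1 + n)) (?b, ts) = (tm_step M ^^ n) (tm_step M (?b, ts))"
    by (simp add: funpow_swap1)
  then show ?case using 1 2 by (simp add: Let_def)
next
  case (WhileF t ts P)
  then show ?case by (simp add: Let_def tm_step_branch nth_append)
next
  case (WhileT t ts P n ts' m ts'')
  let ?b = "length pre"
  let ?c = "assemble (?b + 1) P"
  let ?i = "branch t (?b + 1) (?b + 2 + length ?c)"
  let ?j = "branch (\<lambda>_. True) ?b 0"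
  have code: "code = pre @ [?i] @ ?c @ [?j] @ post"
    using WhileT.prems by (simp add: Let_def)
  have 1: "tm_step M (?b, ts) = (?b + 1, ts)"
    using WhileT.hyps tm_step_branch[of ?b t "?b + 1" "?b + 2 + length ?c"] by (simp add: code)
  have 2: "(tm_step M ^^ n) (length (pre @ [?i]), ts) = (length (pre @ [?i]) + length (assemble (length (pre @ [?i])) P), ts')"
    using code by (intro WhileT.IH(1)) simp
  have 3: "tm_step M (?b + 1 + length ?c, ts') = (?b, ts')"
    using tm_step_branch[of "?b + 1 + length ?c" "\<lambda>_. True" ?b 0] by (simp add: code nth_append)
  have 4: "(tm_step M ^^ m) (?b, ts') = (?b + length (assemble ?b (While t P)), ts'')"
    using WhileT.prems by (intro WhileT.IH(2))
  have "(tm_step M ^^ (1 + n + 1 + m)) (?b, ts) =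
      (tm_step M ^^ m) (tm_step M ((tm_step M ^^ n) (tm_step M (?b, ts))))"
  proof -
    have "1 + n + 1 + m = m + (1 + (n + 1))" by simp
    then show ?thesis by (simp only: funpow_add o_apply funpow.simps funpow_swap1 id_apply One_nat_def)
  qed
  then show ?case using 1 2 3 4 by simp
qed

end

text \<open>State \<open>n\<close>, the exit of the code, carries out the final test
  \<open>t\<close>; the two states after it halt.\<close>

definition tm_of :: "nat \<Rightarrow> nat \<Rightarrow> prog \<Rightarrow> (nat list \<Rightarrow> bool) \<Rightarrow> tm" where
  "tm_of k g P t =
     (let n = length (assemble 0 P) in
      \<lparr>num_tapes = k, num_symbols = g, num_states = n + 3, start_state = 0,
       accept_state = n + 1, reject_state = n + 2,
       transition = \<lambda>q s. if q < n then (assemble 0 P ! q) s else branch t (n + 1) (n + 2) s\<rparr>)"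

lemma wf_tm_of:
  assumes "wf_prog k g P" "1 \<le> k" "3 \<le> g"
  shows "wf_tm (tm_of k g P t)"
proof -
  have "wf_instr k g (length (assemble 0 P)) (assemble 0 P ! q)" if "q < length (assemble 0 P)" for q
    using wf_comp[OF assms(1), of "assemble 0 P ! q" 0] that by simp
  then show ?thesis
    using assms(2,3)
    by (fastforce simp: wf_tm_def tm_of_def Let_def branch_def wf_instr_def split: prod.splits)
qed

definition runs :: "nat \<Rightarrow> prog \<Rightarrow> tape list \<Rightarrow> tape list \<Rightarrow> bool" where
  "runs T P ts ts' \<longleftrightarrow> (\<exists>n\<le>T. exec P ts n ts')"

lemma state_after_tm_of:
  assumes "runs T P (input_tape x # replicate (k - 1) blank_tape) ts"
  shows "state_after (tm_of k g P t) x (T + 1) =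
    (if t (map tape_read ts) then accept_state (tm_of k g P t) else reject_state (tm_of k g P t))"
proof -
  let ?M = "tm_of k g P t" and ?n = "length (assemble 0 P)"
  let ?code = "assemble 0 P @ [branch t (?n + 1) (?n + 2)]"
  interpret machine ?M ?code
    by unfold_locales (auto simp: tm_of_def Let_def nth_append)
  obtain m where m: "m \<le> T" "exec P (input_tape x # replicate (k - 1) blank_tape) m ts"
    using assms by (auto simp: runs_def)
  have "(tm_step ?M ^^ m) (0, input_tape x # replicate (k - 1) blank_tape) = (?n, ts)"
    using exec_comp[OF m(2), of "[]" "[branch t (?n + 1) (?n + 2)]"] by simp
  moreover have "start_config ?M x = (0, input_tape x # replicate (k - 1) blank_tape)"
    by (simp add: start_config_def tm_of_def Let_def)
  moreover have "tm_step ?M (?n, ts) = (if t (map tape_read ts) then ?n + 1 else ?n + 2, ts)"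
    using tm_step_branch[of ?n t "?n + 1" "?n + 2"] by simp
  ultimately have "(tm_step ?M ^^ Suc m) (start_config ?M x) =
      (if t (map tape_read ts) then ?n + 1 else ?n + 2, ts)"
    by simp
  then have *: "state_after ?M x (Suc m) = (if t (map tape_read ts) then accept_state ?M else reject_state ?M)"
    by (simp add: state_after_def) (simp add: tm_of_def Let_def)
  then have "state_after ?M x (T + 1) = state_after ?M x (Suc m)"
    using m(1) by (intro state_after_mono) (simp_all split: if_splits)
  with * show ?thesis by simp
qed

lemma class_P_I:
  fixes p :: "nat poly"
  assumes "wf_prog k g P" "1 \<le> k" "3 \<le> g"
    and "\<And>x. \<exists>ts. runs (poly p (length x)) P (input_tape x # replicate (k - 1) blank_tape) ts \<and>
      (t (map tape_read ts) \<longleftrightarrow> x \<in> L)"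
  shows "L \<in> class_P"
proof -
  have "(if x \<in> L then accepts_within (tm_of k g P t) x (poly (p + 1) (length x))
        else rejects_within (tm_of k g P t) x (poly (p + 1) (length x)))" for x
  proof -
    obtain ts where "runs (poly p (length x)) P (input_tape x # replicate (k - 1) blank_tape) ts"
      "t (map tape_read ts) \<longleftrightarrow> x \<in> L" using assms(4) by blast
    then show ?thesis using state_after_tm_of[of "poly p (length x)" P x k ts g t]
      by (simp add: accepts_within_def rejects_within_def)
  qed
  then show ?thesis using wf_tm_of[OF assms(1-3), of t] unfolding class_P_def by blast
qed

section \<open>Time bounds for structured programs\<close>

lemma runs_mono: "runs T P ts ts' \<Longrightarrow> T \<le> T' \<Longrightarrow> runs T' P ts ts'"
  unfolding runs_def using order_trans by blast

lemma runs_Act: "ts' = apply_act (f (map tape_read ts)) ts \<Longrightarrow> 1 \<le> T \<Longrightarrow> runs T (Act f) ts ts'"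
  using exec.Act[of f ts] unfolding runs_def by auto

lemma runs_Seq: "runs T P ts ts' \<Longrightarrow> runs U Q ts' ts'' \<Longrightarrow> T + U \<le> V \<Longrightarrow> runs V (Seq P Q) ts ts''"
  unfolding runs_def by (meson add_mono exec.Seq order_trans)

lemma runs_Cond:
  assumes "t (map tape_read ts) \<Longrightarrow> runs T P ts ts'" "\<not> t (map tape_read ts) \<Longrightarrow> runs T Q ts ts'"
    and "T + 2 \<le> U"
  shows "runs U (Cond t P Q) ts ts'"
proof (cases "t (map tape_read ts)")
  case True
  then obtain n where "n \<le> T" "exec P ts n ts'" using assms(1) by (auto simp: runs_def)
  then show ?thesis using exec.CondT[of t ts P n ts' Q] True assms(3)
    unfolding runs_def by (intro exI[of _ "1 + n + 1"]) auto
next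
  case False
  then obtain n where "n \<le> T" "exec Q ts n ts'" using assms(2) by (auto simp: runs_def)
  then show ?thesis using exec.CondF[of t ts Q n ts' P] False assms(3)
    unfolding runs_def by (intro exI[of _ "1 + n"]) auto
qed

text \<open>The family \<open>g\<close> lists the configurations between iterations. An iteration
  costs two extra steps, for the test and the jump back; the failing last test costs one.\<close>

lemma runs_While:
  assumes "\<And>i. i < n \<Longrightarrow> t (map tape_read (g i)) \<and> runs T P (g i) (g (Suc i))"
    and "\<not> t (map tape_read (g n))"
    and "n * (T + 2) + 1 \<le> U" "ts = g 0" "ts' = g n"
  shows "runs U (While t P) ts ts'"
proof -
  have "runs ((n - i) * (T + 2) + 1) (While t P) (g i) (g n)" if "i \<le> n" for i
    using that
  proof (induction i rule: inc_induct)
    case base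
    then show ?case using exec.WhileF[of t "g n" P] assms(2) by (auto simp: runs_def)
  next
    case (step i)
    obtain m where m: "m \<le> (n - Suc i) * (T + 2) + 1" "exec (While t P) (g (Suc i)) m (g n)"
      using step.IH by (auto simp: runs_def)
    obtain l where l: "l \<le> T" "exec P (g i) l (g (Suc i))"
      using assms(1)[OF step.hyps(2)] by (auto simp: runs_def)
    have "n - i = Suc (n - Suc i)" using step.hyps by simp
    then have "1 + l + 1 + m \<le> (n - i) * (T + 2) + 1"
      using m(1) l(1) by simp
    moreover have "exec (While t P) (g i) (1 + l + 1 + m) (g n)"
      using assms(1)[OF step.hyps(2)] l(2) m(2) by (intro exec.WhileT) auto
    ultimately show ?case unfolding runs_def by blast
  qed
  from this[of 0] show ?thesis using assms(3-5) by (auto intro: runs_mono)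
qed

section \<open>Programs that only move heads\<close>

definition cell :: "nat list \<Rightarrow> nat \<Rightarrow> nat" where
  "cell y p = (if p < length y then y ! p else 0)"

definition head_tape :: "nat list \<Rightarrow> nat \<Rightarrow> tape" where
  "head_tape y p = (\<lambda>i. if i < 0 then 0 else cell y (nat i), int p)"

text \<open>Tapes 0 and 1 hold the input and the automaton state, so head \<open>i\<close> works on
  tape \<open>2 + i\<close>. The symbol 5 will occur at position 0 only, which makes this a zero
  test for heads used as counters.\<close>

definition at_start :: "nat \<Rightarrow> nat list \<Rightarrow> bool" where
  "at_start i s \<longleftrightarrow> s ! (2 + i) = 5"

definition shift :: "nat set \<Rightarrow> nat set \<Rightarrow> prog" where
  "shift L R = Act (\<lambda>s. (s, map (\<lambda>j. if j < 2 then MStay else if j - 2 \<in> L then MLeft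
     else if j - 2 \<in> R then MRight else MStay) [0..<length s]))"

definition shifted :: "nat set \<Rightarrow> nat set \<Rightarrow> (nat \<Rightarrow> nat) \<Rightarrow> nat \<Rightarrow> nat" where
  "shifted L R h = (\<lambda>i. if i \<in> L then h i - 1 else if i \<in> R then h i + 1 else h i)"

definition skip :: prog where "skip = shift {} {}"

text \<open>Head 0 means false at position 0 and true at position 1, hence moves only if it differs
  from the wanted value.\<close>

definition set_flag :: "bool \<Rightarrow> prog" where
  "set_flag b = (if b then Cond (at_start 0) (shift {} {0}) skip
                 else Cond (at_start 0) skip (shift {0} {}))"

definition flag_test :: "(nat list \<Rightarrow> bool) \<Rightarrow> prog" where
  "flag_test t = Cond t (set_flag True) (set_flag False)"

definition rewind :: "nat \<Rightarrow> prog" where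
  "rewind i = While (\<lambda>s. \<not> at_start i s) (shift {i} {})"

definition regs :: "nat \<Rightarrow> nat \<Rightarrow> nat \<Rightarrow> nat \<Rightarrow> (nat \<Rightarrow> nat) \<Rightarrow> nat \<Rightarrow> nat" where
  "regs f s a b e i =
     (if i = 0 then f else if i = 1 then s else if i = 2 then a else if i = 3 then b else e (i - 4))"

lemma regs_simps [simp]:
  "regs f s a b e 0 = f" "regs f s a b e (Suc 0) = s" "regs f s a b e 2 = a"
  "regs f s a b e 3 = b" "regs f s a b e (4 + i) = e i"
  by (simp_all add: regs_def)

lemma tape_update_same: "tape_update (tape_read t) d t = (fst t, snd t + move_offset d)"
  by (simp add: tape_update_def tape_read_def)

text \<open>The two tapes \<open>aux\<close> stay unchanged during evaluation, and \<open>m\<close>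
  is the number of variables. The first blank, at \<open>length y\<close>, marks the end of a
  sweep.\<close>

locale heads =
  fixes aux :: "tape list" and y :: "nat list" and m :: nat
  assumes aux: "length aux = 2"
    and y_long: "1 < length y"
    and y_start: "y ! 0 = 5"
    and y_inner: "\<And>p. 0 < p \<Longrightarrow> p < length y \<Longrightarrow> y ! p \<noteq> 5 \<and> y ! p \<noteq> 0"
begin

definition conf :: "(nat \<Rightarrow> nat) \<Rightarrow> tape list" where
  "conf h = aux @ map (\<lambda>i. head_tape y (h i)) [0..<4 + m]"

lemma cell_5_iff [simp]: "cell y p = 5 \<longleftrightarrow> p = 0"
  using y_start y_inner[of p] y_long by (cases "p = 0") (auto simp: cell_def)

lemma cell_0_iff [simp]: "cell y p = 0 \<longleftrightarrow> length y \<le> p"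
  using y_start y_inner[of p] y_long by (cases "p = 0") (auto simp: cell_def)

lemma length_conf: "length (conf h) = 6 + m"
  by (simp add: conf_def aux)

lemma conf_nth: "i < 4 + m \<Longrightarrow> conf h ! (2 + i) = head_tape y (h i)"
  by (simp add: conf_def aux nth_append)

lemma read_conf [simp]: "i < 4 + m \<Longrightarrow> map tape_read (conf h) ! (2 + i) = cell y (h i)"
  using length_conf conf_nth[of i h] by (simp add: tape_read_def head_tape_def)

lemma at_start_conf [simp]: "i < 4 + m \<Longrightarrow> at_start i (map tape_read (conf h)) \<longleftrightarrow> h i = 0"
  unfolding at_start_def by (simp only: read_conf cell_5_iff)

text \<open>A head moving left must not stand at 0, where the truncated subtraction in
  \<open>shifted\<close> and the two-way infinite tape would disagree.\<close>

lemma runs_shift: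
  assumes "\<And>i. i \<in> L \<Longrightarrow> 0 < h i" "h' = shifted L R h" "1 \<le> T"
  shows "runs T (shift L R) (conf h) (conf h')"
  unfolding shift_def
proof (rule runs_Act[OF _ assms(3)], rule nth_equalityI)
  show "length (conf h') = length (apply_act (map tape_read (conf h), map (\<lambda>j. if j < 2 then MStay
      else if j - 2 \<in> L then MLeft else if j - 2 \<in> R then MRight else MStay)
      [0..<length (map tape_read (conf h))]) (conf h))"
    by (simp add: apply_act_def length_conf)
next
  fix j assume "j < length (conf h')"
  then have j: "j < 6 + m" by (simp add: length_conf)
  show "conf h' ! j = apply_act (map tape_read (conf h), map (\<lambda>j. if j < 2 then MStay
      else if j - 2 \<in> L then MLeft else if j - 2 \<in> R then MRight else MStay)
      [0..<length (map tape_read (conf h))]) (conf h) ! j"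
  proof (cases "j < 2")
    case True
    then have "conf h' ! j = conf h ! j" by (simp add: conf_def aux nth_append)
    then show ?thesis
      using j True by (simp add: apply_act_def length_conf tape_update_same move_offset_def)
  next
    case False
    define i where "i = j - 2"
    have i: "j = 2 + i" "i < 4 + m"
      using j False by (auto simp: i_def)
    have r: "conf h ! Suc (Suc i) = head_tape y (h i)" for h
      using conf_nth[OF i(2), of h] by simp
    show ?thesis
      using j assms(1)[of i] assms(2)
      by (auto simp: i apply_act_def length_conf tape_update_same move_offset_def r head_tape_def
          shifted_def)
  qed
qed

lemma runs_skip: "1 \<le> T \<Longrightarrow> runs T skip (conf h) (conf h)"
  unfolding skip_def by (rule runs_shift) (auto simp: shifted_def)

lemma runs_set_flag:
  assumes "f \<le> 1" "3 \<le> T"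
  shows "runs T (set_flag c) (conf (regs f s a b e)) (conf (regs (of_bool c) s a b e))"
proof -
  have f: "f = 0 \<or> f = 1" using assms(1) by linarith
  have inc: "runs 1 (shift {} {0}) (conf (regs 0 s a b e)) (conf (regs 1 s a b e))"
    by (rule runs_shift) (auto simp: regs_def shifted_def)
  have dec: "runs 1 (shift {0} {}) (conf (regs 1 s a b e)) (conf (regs 0 s a b e))"
    by (rule runs_shift) (auto simp: regs_def shifted_def)
  have stay: "runs 1 skip (conf h) (conf h)" for h
    by (rule runs_skip) simp
  show ?thesis
    unfolding set_flag_def using f assms(2) inc dec stay
    by (cases c) (auto intro!: runs_Cond[where T = 1])
qed

lemma runs_flag_test:
  assumes "f \<le> 1" "5 \<le> T" "c \<longleftrightarrow> t (map tape_read (conf (regs f s a b e)))"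
  shows "runs T (flag_test t) (conf (regs f s a b e)) (conf (regs (of_bool c) s a b e))"
  unfolding flag_test_def
  using assms runs_set_flag[OF assms(1), of 3 True] runs_set_flag[OF assms(1), of 3 False]
  by (intro runs_Cond[where T = 3]) auto

lemma runs_rewind:
  assumes "i < 4 + m" "h i \<le> n" "3 * n + 1 \<le> T"
  shows "runs T (rewind i) (conf h) (conf (h(i := 0)))"
  unfolding rewind_def
proof (rule runs_While[where n = "h i" and T = 1 and g = "\<lambda>t. conf (h(i := h i - t))"])
  fix t assume "t < h i"
  then show "\<not> at_start i (map tape_read (conf (h(i := h i - t)))) \<and>
    runs 1 (shift {i} {}) (conf (h(i := h i - t))) (conf (h(i := h i - Suc t)))"
    using assms(1) by (auto intro!: runs_shift simp: shifted_def)
qed (use assms in auto)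

end

section \<open>A logic with counting\<close>

definition digit :: "nat \<Rightarrow> bool" where
  "digit a \<longleftrightarrow> a = 1 \<or> a = 2"

text \<open>At the end marker of a letter this is the name of the letter, in the order in which a
  head moving left meets its digits.\<close>

definition digits_before :: "nat list \<Rightarrow> nat \<Rightarrow> nat list" where
  "digits_before y p = takeWhile digit (rev (take p y))"

datatype fm =
    Sym nat "nat set"
  | Less nat nat
  | Same nat nat
  | Neg fm
  | Conj fm fm
  | Ex nat fm
  | EqCount nat fm fm

fun sat :: "nat list \<Rightarrow> (nat \<Rightarrow> nat) \<Rightarrow> fm \<Rightarrow> bool" where
  "sat y e (Sym i A) \<longleftrightarrow> y ! e i \<in> A"
| "sat y e (Less i j) \<longleftrightarrow> e i < e j"
| "sat y e (Same i j) \<longleftrightarrow> 0 < e i \<and> 0 < e j \<and> digits_before y (e i) = digits_before y (e j)"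
| "sat y e (Neg \<phi>) \<longleftrightarrow> \<not> sat y e \<phi>"
| "sat y e (Conj \<phi> \<psi>) \<longleftrightarrow> sat y e \<phi> \<and> sat y e \<psi>"
| "sat y e (Ex i \<phi>) \<longleftrightarrow> (\<exists>k<length y. sat y (e(i := k)) \<phi>)"
| "sat y e (EqCount i \<phi> \<psi>) \<longleftrightarrow>
     card {k. k < length y \<and> sat y (e(i := k)) \<phi>} = card {k. k < length y \<and> sat y (e(i := k)) \<psi>}"

fun bound_vars :: "fm \<Rightarrow> nat set" where
  "bound_vars (Neg \<phi>) = bound_vars \<phi>"
| "bound_vars (Conj \<phi> \<psi>) = bound_vars \<phi> \<union> bound_vars \<psi>"
| "bound_vars (Ex i \<phi>) = insert i (bound_vars \<phi>)"
| "bound_vars (EqCount i \<phi> \<psi>) = insert i (bound_vars \<phi> \<union> bound_vars \<psi>)"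
| "bound_vars _ = {}"

text \<open>There is only one pair of counting heads, so the arguments of \<open>EqCount\<close>
  must not count themselves.\<close>

fun count_free :: "fm \<Rightarrow> bool" where
  "count_free (Neg \<phi>) \<longleftrightarrow> count_free \<phi>"
| "count_free (Conj \<phi> \<psi>) \<longleftrightarrow> count_free \<phi> \<and> count_free \<psi>"
| "count_free (Ex i \<phi>) \<longleftrightarrow> count_free \<phi>"
| "count_free (EqCount i \<phi> \<psi>) \<longleftrightarrow> False"
| "count_free _ \<longleftrightarrow> True"

text \<open>A quantifier expects its variable at position 0 and returns it there; within its scope
  the variable must therefore not be bound again.\<close>

fun wf_fm :: "nat \<Rightarrow> fm \<Rightarrow> bool" where
  "wf_fm m (Sym i A) \<longleftrightarrow> i < m"
| "wf_fm m (Less i j) \<longleftrightarrow> i < m \<and> j < m"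
| "wf_fm m (Same i j) \<longleftrightarrow> i < m \<and> j < m"
| "wf_fm m (Neg \<phi>) \<longleftrightarrow> wf_fm m \<phi>"
| "wf_fm m (Conj \<phi> \<psi>) \<longleftrightarrow> wf_fm m \<phi> \<and> wf_fm m \<psi>"
| "wf_fm m (Ex i \<phi>) \<longleftrightarrow> i < m \<and> i \<notin> bound_vars \<phi> \<and> wf_fm m \<phi>"
| "wf_fm m (EqCount i \<phi> \<psi>) \<longleftrightarrow> i < m \<and> i \<notin> bound_vars \<phi> \<and> i \<notin> bound_vars \<psi> \<and>
     wf_fm m \<phi> \<and> wf_fm m \<psi> \<and> count_free \<phi> \<and> count_free \<psi>"

abbreviation at_end :: "nat \<Rightarrow> nat list \<Rightarrow> bool" where
  "at_end i s \<equiv> s ! (2 + i) = 0"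

text \<open>Head 0 is the flag, head 1 a scratch counter, heads 2 and 3 serve \<^const>\<open>EqCount\<close>, and
  head \<open>4 + i\<close> is the variable \<open>i\<close>.\<close>

fun prog_of :: "fm \<Rightarrow> prog" where
  "prog_of (Sym i A) = flag_test (\<lambda>s. s ! (2 + (4 + i)) \<in> A)"
| "prog_of (Less i j) =
     Seq (While (\<lambda>s. \<not> at_start (4 + i) s \<and> \<not> at_start (4 + j) s) (shift {4 + i, 4 + j} {1}))
    (Seq (flag_test (\<lambda>s. at_start (4 + i) s \<and> \<not> at_start (4 + j) s))
         (While (\<lambda>s. \<not> at_start 1 s) (shift {1} {4 + i, 4 + j})))"
| "prog_of (Same i j) =
     Cond (\<lambda>s. \<not> at_start (4 + i) s \<and> \<not> at_start (4 + j) s)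
      (Seq (shift {4 + i, 4 + j} {1})
      (Seq (While (\<lambda>s. s ! (2 + (4 + i)) = s ! (2 + (4 + j)) \<and> digit (s ! (2 + (4 + i))))
              (shift {4 + i, 4 + j} {1}))
      (Seq (flag_test (\<lambda>s. \<not> digit (s ! (2 + (4 + i))) \<and> \<not> digit (s ! (2 + (4 + j)))))
           (While (\<lambda>s. \<not> at_start 1 s) (shift {1} {4 + i, 4 + j})))))
      (set_flag False)"
| "prog_of (Neg \<phi>) = Seq (prog_of \<phi>) (flag_test (at_start 0))"
| "prog_of (Conj \<phi> \<psi>) = Seq (prog_of \<phi>) (Cond (at_start 0) skip (prog_of \<psi>))"
| "prog_of (Ex i \<phi>) =
     Seq (set_flag False)
    (Seq (While (\<lambda>s. at_start 0 s \<and> \<not> at_end (4 + i) s)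
           (Seq (prog_of \<phi>) (Cond (at_start 0) (shift {} {4 + i}) skip)))
         (rewind (4 + i)))"
| "prog_of (EqCount i \<phi> \<psi>) =
     Seq (While (\<lambda>s. \<not> at_end (4 + i) s)
           (Seq (prog_of \<phi>) (Seq (Cond (at_start 0) skip (shift {} {2}))
           (Seq (prog_of \<psi>) (Seq (Cond (at_start 0) skip (shift {} {3}))
                (shift {} {4 + i}))))))
    (Seq (rewind (4 + i))
    (Seq (While (\<lambda>s. \<not> at_start 2 s \<and> \<not> at_start 3 s) (shift {2, 3} {}))
    (Seq (flag_test (\<lambda>s. at_start 2 s \<and> at_start 3 s))
    (Seq (rewind 2) (rewind 3)))))"

text \<open>The factor \<open>[:0, 1:]\<close> is the tape length, which bounds the iterations of a
  sweep; the constants are generous.\<close>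

fun time_of :: "fm \<Rightarrow> nat poly" where
  "time_of (Sym i A) = [:10:]"
| "time_of (Less i j) = [:10, 6:]"
| "time_of (Same i j) = [:20, 6:]"
| "time_of (Neg \<phi>) = time_of \<phi> + [:10:]"
| "time_of (Conj \<phi> \<psi>) = time_of \<phi> + time_of \<psi> + [:10:]"
| "time_of (Ex i \<phi>) = [:0, 1:] * (time_of \<phi> + [:10:]) + [:10, 3:]"
| "time_of (EqCount i \<phi> \<psi>) = [:0, 1:] * (time_of \<phi> + time_of \<psi> + [:10:]) + [:20, 12:]"

lemma wf_prog_of: "2 \<le> k \<Longrightarrow> wf_prog k g (prog_of \<phi>)"
  by (induction \<phi>) (simp_all add: shift_def flag_test_def set_flag_def skip_def rewind_def)

section \<open>Running the atomic formulas\<close>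

definition retreat :: "nat \<Rightarrow> nat \<Rightarrow> nat \<Rightarrow> (nat \<Rightarrow> nat) \<Rightarrow> nat \<Rightarrow> nat" where
  "retreat i j k e = (\<lambda>x. if x = i \<or> x = j then e x - k else e x)"

lemma retreat_0 [simp]: "retreat i j 0 e = e"
  by (simp add: retreat_def fun_eq_iff)

lemma retreat_simps [simp]: "retreat i j k e i = e i - k" "retreat i j k e j = e j - k"
  by (simp_all add: retreat_def)

text \<open>\<open>k\<close> is the first place without a common element satisfying
  \<open>P\<close>. If neither entry there satisfies \<open>P\<close>, both prefixes stop at
  \<open>k\<close>; otherwise one of them goes on, and the other stops or goes on differently. This
  is the final test of the program for \<open>Same\<close>.\<close>

lemma takeWhile_eq_iff_nth:
  assumes "k < length xs" "k < length ys" "take k xs = take k ys"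
    and "\<And>l. l < k \<Longrightarrow> P (xs ! l)" and "\<not> (xs ! k = ys ! k \<and> P (xs ! k))"
  shows "takeWhile P xs = takeWhile P ys \<longleftrightarrow> \<not> P (xs ! k) \<and> \<not> P (ys ! k)"
proof
  have P': "P (ys ! l)" if "l < k" for l
    using assms(3) assms(4)[OF that] that by (metis nth_take)
  have longer: "k < length (takeWhile P zs)" "takeWhile P zs ! k = zs ! k"
    if "k < length zs" "\<And>l. l < k \<Longrightarrow> P (zs ! l)" "P (zs ! k)" for zs
  proof -
    have "Suc k \<le> length (takeWhile P zs)"
      using that by (intro length_takeWhile_less_P_nth) (auto simp: less_Suc_eq)
    then show "k < length (takeWhile P zs)" by simp
    then show "takeWhile P zs ! k = zs ! k" by (rule takeWhile_nth)
  qed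
  have holds: "P (zs ! k)" if "k < length (takeWhile P zs)" for zs
    using that by (metis nth_mem set_takeWhileD takeWhile_nth)
  show "\<not> P (xs ! k) \<and> \<not> P (ys ! k)" if "takeWhile P xs = takeWhile P ys"
    using longer[OF assms(1,4)] longer[OF assms(2) P'] holds[of xs] holds[of ys] that assms(5)
    by metis
  assume "\<not> P (xs ! k) \<and> \<not> P (ys ! k)"
  then have "takeWhile P xs = take k xs" "takeWhile P ys = take k ys"
    using assms(1,2,4) P' by (intro takeWhile_eq_take_P_nth; simp)+
  then show "takeWhile P xs = takeWhile P ys" using assms(3) by simp
qed

context heads
begin

lemma runs_down:
  assumes "k < e i" "k < e j" "1 \<le> T"
  shows "runs T (shift {4 + i, 4 + j} {1}) (conf (regs f k a b (retreat i j k e)))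
    (conf (regs f (Suc k) a b (retreat i j (Suc k) e)))"
  using assms by (intro runs_shift) (auto simp: shifted_def regs_def retreat_def fun_eq_iff)

lemma runs_up:
  assumes "k < e i" "k < e j" "1 \<le> T"
  shows "runs T (shift {1} {4 + i, 4 + j}) (conf (regs f (Suc k) a b (retreat i j (Suc k) e)))
    (conf (regs f k a b (retreat i j k e)))"
  using assms by (intro runs_shift) (auto simp: shifted_def regs_def retreat_def fun_eq_iff)

lemma runs_restore:
  assumes "k \<le> e i" "k \<le> e j" "3 * k + 1 \<le> T"
  shows "runs T (While (\<lambda>s. \<not> at_start 1 s) (shift {1} {4 + i, 4 + j}))
    (conf (regs f k a b (retreat i j k e))) (conf (regs f 0 a b e))"
proof (rule runs_While[where n = k and T = 1 and g = "\<lambda>t. conf (regs f (k - t) a b (retreat i j (k - t) e))"])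
  fix t assume t: "t < k"
  have "runs 1 (shift {1} {4 + i, 4 + j}) (conf (regs f (Suc (k - Suc t)) a b (retreat i j (Suc (k - Suc t)) e)))
    (conf (regs f (k - Suc t) a b (retreat i j (k - Suc t) e)))"
    using assms t by (intro runs_up) auto
  then show "\<not> at_start 1 (map tape_read (conf (regs f (k - t) a b (retreat i j (k - t) e)))) \<and>
    runs 1 (shift {1} {4 + i, 4 + j}) (conf (regs f (k - t) a b (retreat i j (k - t) e)))
      (conf (regs f (k - Suc t) a b (retreat i j (k - Suc t) e)))"
    using t by (simp add: Suc_diff_Suc)
qed (use assms in auto)

text \<open>Both heads descend in step until the lower one reaches 0. The scratch head counts the
  steps, so that the positions can be restored exactly.\<close>

lemma runs_Less:
  assumes "i < m" "j < m" "e i < length y" "e j < length y" "f \<le> 1" "10 + 6 * length y \<le> T"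
  shows "runs T (prog_of (Less i j)) (conf (regs f 0 a b e)) (conf (regs (of_bool (e i < e j)) 0 a b e))"
proof -
  let ?k = "min (e i) (e j)"
  have 1: "runs (3 * length y + 1)
    (While (\<lambda>s. \<not> at_start (4 + i) s \<and> \<not> at_start (4 + j) s) (shift {4 + i, 4 + j} {1}))
    (conf (regs f 0 a b e)) (conf (regs f ?k a b (retreat i j ?k e)))"
    by (rule runs_While[where n = ?k and T = 1 and g = "\<lambda>t. conf (regs f t a b (retreat i j t e))"])
      (use assms in \<open>auto intro!: runs_down[unfolded One_nat_def]\<close>)
  have 2: "runs 5 (flag_test (\<lambda>s. at_start (4 + i) s \<and> \<not> at_start (4 + j) s))
    (conf (regs f ?k a b (retreat i j ?k e))) (conf (regs (of_bool (e i < e j)) ?k a b (retreat i j ?k e)))"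
    using assms by (intro runs_flag_test) (auto simp: min_def)
  have 3: "runs (3 * length y + 1) (While (\<lambda>s. \<not> at_start 1 s) (shift {1} {4 + i, 4 + j}))
    (conf (regs (of_bool (e i < e j)) ?k a b (retreat i j ?k e))) (conf (regs (of_bool (e i < e j)) 0 a b e))"
    using assms by (intro runs_restore) auto
  show ?thesis
    using assms(6) unfolding prog_of.simps by (intro runs_Seq[OF 1 runs_Seq[OF 2 3 order.refl]]) simp
qed

lemma rev_take_nth: "l < p \<Longrightarrow> p \<le> length y \<Longrightarrow> rev (take p y) ! l = y ! (p - Suc l)"
  by (simp add: rev_nth)

text \<open>The first step leaves the two markers; then the heads go left as long as they see the
  same digit. The start symbol 5 is not a digit, so the loop ends before a head leaves position
  0.\<close>

lemma runs_Same:
  assumes "i < m" "j < m" "e i < length y" "e j < length y" "f \<le> 1" "20 + 6 * length y \<le> T"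
  shows "runs T (prog_of (Same i j)) (conf (regs f 0 a b e)) (conf (regs (of_bool (sat y e (Same i j))) 0 a b e))"
proof -
  let ?st = "\<lambda>f k. conf (regs f k a b (retreat i j k e))"
  let ?go = "\<lambda>s. s ! (2 + (4 + i)) = s ! (2 + (4 + j)) \<and> digit (s ! (2 + (4 + i)))"
  let ?stop = "\<lambda>s. \<not> digit (s ! (2 + (4 + i))) \<and> \<not> digit (s ! (2 + (4 + j)))"
  let ?c = "of_bool (sat y e (Same i j)) :: nat"
  have body: "runs (16 + 6 * length y)
      (Seq (shift {4 + i, 4 + j} {1})
      (Seq (While ?go (shift {4 + i, 4 + j} {1}))
      (Seq (flag_test ?stop) (While (\<lambda>s. \<not> at_start 1 s) (shift {1} {4 + i, 4 + j})))))
      (conf (regs f 0 a b e)) (conf (regs ?c 0 a b e))"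
    if pos: "0 < e i" "0 < e j"
  proof -
    let ?xs = "rev (take (e i) y)" and ?ys = "rev (take (e j) y)"
    let ?Q = "\<lambda>k. k < e i \<and> k < e j \<longrightarrow> \<not> (?xs ! k = ?ys ! k \<and> digit (?xs ! k))"
    define k where "k = (LEAST k. ?Q k)"
    have nth: "?xs ! l = y ! (e i - Suc l)" if "l < e i" for l
      using that assms by (simp add: rev_take_nth)
    have nth': "?ys ! l = y ! (e j - Suc l)" if "l < e j" for l
      using that assms by (simp add: rev_take_nth)
    have "?Q (min (e i) (e j))" by linarith
    then have Qk: "?Q k" unfolding k_def by (rule LeastI)
    have before: "k' < e i \<and> k' < e j \<and> ?xs ! k' = ?ys ! k' \<and> digit (?xs ! k')" if "k' < k" for k'
      using not_less_Least[of k' ?Q] that unfolding k_def by blast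
    have k: "k < e i" "k < e j"
    proof -
      have nd: "\<not> digit (y ! 0)" by (simp add: y_start digit_def)
      have *: "l \<noteq> e i - 1 \<and> l \<noteq> e j - 1" if "l < k" for l
        using before[OF that] nth[of l] nth'[of l] nd pos by auto
      then have "e i - 1 \<ge> k" "e j - 1 \<ge> k" using linorder_not_less by blast+
      then show "k < e i" "k < e j" using pos by auto
    qed
    have same: "sat y e (Same i j) \<longleftrightarrow> \<not> digit (?xs ! k) \<and> \<not> digit (?ys ! k)"
    proof -
      have "take k ?xs = take k ?ys"
        using k before assms by (intro nth_equalityI) auto
      then have "takeWhile digit ?xs = takeWhile digit ?ys \<longleftrightarrow> \<not> digit (?xs ! k) \<and> \<not> digit (?ys ! k)"
      proof (rule takeWhile_eq_iff_nth[rotated 2])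
        show "digit (?xs ! l)" if "l < k" for l using before[OF that] by blast
        show "\<not> (?xs ! k = ?ys ! k \<and> digit (?xs ! k))" using Qk k by blast
      qed (use k assms in auto)
      then show ?thesis using pos by (simp add: digits_before_def)
    qed
    have cells: "cell y (e i - Suc l) = ?xs ! l" "cell y (e j - Suc l) = ?ys ! l" if "l \<le> k" for l
      using that k nth[of l] nth'[of l] assms by (auto simp: cell_def)
    have rd: "map tape_read (?st f' (Suc l)) ! (2 + (4 + i)) = ?xs ! l"
      "map tape_read (?st f' (Suc l)) ! (2 + (4 + j)) = ?ys ! l" if "l \<le> k" for l f'
      using cells[OF that] assms(1,2)
      by (simp_all only: read_conf regs_simps retreat_simps nat_add_left_cancel_less)
    have 0: "runs 1 (shift {4 + i, 4 + j} {1}) (?st f 0) (?st f 1)"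
      using pos runs_down[of 0 e i j 1 f a b] by simp
    have 1: "runs (3 * length y + 1) (While ?go (shift {4 + i, 4 + j} {1})) (?st f 1) (?st f (Suc k))"
    proof (rule runs_While[where n = k and T = 1 and g = "\<lambda>t. ?st f (Suc t)"])
      fix t assume t: "t < k"
      have "?go (map tape_read (?st f (Suc t)))"
        unfolding rd[OF less_imp_le[OF t]] using before[OF t] by blast
      moreover have "runs 1 (shift {4 + i, 4 + j} {1}) (?st f (Suc t)) (?st f (Suc (Suc t)))"
        using t k by (intro runs_down) auto
      ultimately show "?go (map tape_read (?st f (Suc t))) \<and>
        runs 1 (shift {4 + i, 4 + j} {1}) (?st f (Suc t)) (?st f (Suc (Suc t)))" ..
    next
      show "\<not> ?go (map tape_read (?st f (Suc k)))"
        unfolding rd[OF order.refl] using Qk k by blast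
    qed (use k assms in auto)
    have 2: "runs 5 (flag_test ?stop) (?st f (Suc k)) (?st ?c (Suc k))"
    proof (rule runs_flag_test)
      show "sat y e (Same i j) = ?stop (map tape_read (?st f (Suc k)))"
        unfolding rd[OF order.refl] by (rule same)
    qed (use assms in auto)
    have 3: "runs (3 * length y + 1) (While (\<lambda>s. \<not> at_start 1 s) (shift {1} {4 + i, 4 + j}))
      (?st ?c (Suc k)) (conf (regs ?c 0 a b e))"
      using k assms by (intro runs_restore) auto
    have "runs (16 + 6 * length y)
      (Seq (shift {4 + i, 4 + j} {1})
      (Seq (While ?go (shift {4 + i, 4 + j} {1}))
      (Seq (flag_test ?stop) (While (\<lambda>s. \<not> at_start 1 s) (shift {1} {4 + i, 4 + j})))))
      (?st f 0) (conf (regs ?c 0 a b e))"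
      by (intro runs_Seq[OF 0 runs_Seq[OF 1 runs_Seq[OF 2 3 order.refl] order.refl]]) simp
    then show ?thesis by simp
  qed
  have test: "at_start (4 + l) (map tape_read (conf (regs f 0 a b e))) \<longleftrightarrow> e l = 0" if "l < m" for l
    using that by simp
  show ?thesis
    unfolding prog_of.simps
  proof (rule runs_Cond)
    assume "\<not> at_start (4 + i) (map tape_read (conf (regs f 0 a b e))) \<and>
      \<not> at_start (4 + j) (map tape_read (conf (regs f 0 a b e)))"
    then show "runs (16 + 6 * length y)
      (Seq (shift {4 + i, 4 + j} {1})
      (Seq (While ?go (shift {4 + i, 4 + j} {1}))
      (Seq (flag_test ?stop) (While (\<lambda>s. \<not> at_start 1 s) (shift {1} {4 + i, 4 + j})))))
      (conf (regs f 0 a b e)) (conf (regs ?c 0 a b e))"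
      using body test assms(1,2) by blast
  next
    assume "\<not> (\<not> at_start (4 + i) (map tape_read (conf (regs f 0 a b e))) \<and>
      \<not> at_start (4 + j) (map tape_read (conf (regs f 0 a b e))))"
    then have "\<not> sat y e (Same i j)" using test assms(1,2) by auto
    then show "runs (16 + 6 * length y) (set_flag False) (conf (regs f 0 a b e)) (conf (regs ?c 0 a b e))"
      using runs_set_flag[OF assms(5), of "16 + 6 * length y" False]
      by (simp del: sat.simps)
  qed (use assms(6) in simp)
qed

end

section \<open>Running quantifiers and counting\<close>

context heads
begin

lemma regs_upd: "(regs f s a b e)(4 + i := v) = regs f s a b (e(i := v))"
  by (auto simp: regs_def fun_eq_iff)

lemma runs_count_if:
  assumes "3 \<le> T"
  shows "runs T (Cond (at_start 0) skip (shift {} {2})) (conf (regs (of_bool q) 0 a b e))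
      (conf (regs (of_bool q) 0 (a + of_bool q) b e))"
    "runs T (Cond (at_start 0) skip (shift {} {3})) (conf (regs (of_bool q) 0 a b e))
      (conf (regs (of_bool q) 0 a (b + of_bool q) e))"
    "runs T (Cond (at_start 0) (shift {} {4 + i}) skip) (conf (regs (of_bool q) 0 a b e))
      (conf (regs (of_bool q) 0 a b (e(i := e i + of_bool (\<not> q)))))"
proof -
  have "runs 1 (shift {} {2}) (conf (regs f 0 a b e)) (conf (regs f 0 (Suc a) b e))" for f
    by (rule runs_shift) (auto simp: shifted_def regs_def)
  moreover have "runs 1 (shift {} {3}) (conf (regs f 0 a b e)) (conf (regs f 0 a (Suc b) e))" for f
    by (rule runs_shift) (auto simp: shifted_def regs_def)
  moreover have "runs 1 (shift {} {4 + i}) (conf (regs f 0 a b e)) (conf (regs f 0 a b (e(i := Suc (e i)))))" for f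
    by (rule runs_shift) (auto simp: shifted_def regs_def fun_eq_iff)
  moreover have "runs 1 skip (conf h) (conf h)" for h
    by (rule runs_skip) simp
  ultimately show
    "runs T (Cond (at_start 0) skip (shift {} {2})) (conf (regs (of_bool q) 0 a b e))
      (conf (regs (of_bool q) 0 (a + of_bool q) b e))"
    "runs T (Cond (at_start 0) skip (shift {} {3})) (conf (regs (of_bool q) 0 a b e))
      (conf (regs (of_bool q) 0 a (b + of_bool q) e))"
    "runs T (Cond (at_start 0) (shift {} {4 + i}) skip) (conf (regs (of_bool q) 0 a b e))
      (conf (regs (of_bool q) 0 a b (e(i := e i + of_bool (\<not> q)))))"
    using assms by (auto intro!: runs_Cond[where T = 1])
qed

lemma card_less_Suc:
  "card {k. k < Suc t \<and> P k} = card {k. k < t \<and> P k} + of_bool (P t)"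
proof -
  have "{k. k < Suc t \<and> P k} = (if P t then insert t {k. k < t \<and> P k} else {k. k < t \<and> P k})"
    by (auto simp: less_Suc_eq)
  then show ?thesis by auto
qed

text \<open>Success leaves the flag set, which ends the sweep without advancing the variable. With a
  witness there are hence \<open>Suc ?L\<close> iterations, and the variable stops at the least
  witness \<open>?L\<close> before it is rewound.\<close>

lemma runs_Ex:
  assumes IH: "\<And>k. k < length y \<Longrightarrow>
      runs T (prog_of \<phi>) (conf (regs 0 0 a b (e(i := k))))
        (conf (regs (of_bool (sat y (e(i := k)) \<phi>)) 0 a b (e(i := k))))"
    and "i < m" "e i = 0" "f \<le> 1"
    and U: "length y * (T + 5) + 5 + 3 * length y \<le> U"
  shows "runs U (prog_of (Ex i \<phi>)) (conf (regs f 0 a b e))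
    (conf (regs (of_bool (sat y e (Ex i \<phi>))) 0 a b e))"
proof -
  let ?n = "length y"
  let ?P = "\<lambda>k. sat y (e(i := k)) \<phi>"
  let ?L = "LEAST k. ?P k"
  define found where "found \<longleftrightarrow> (\<exists>k<?n. ?P k)"
  define N where "N = (if found then Suc ?L else ?n)"
  define g where "g t = (if \<exists>k<t. ?P k then conf (regs 1 0 a b (e(i := ?L)))
    else conf (regs 0 0 a b (e(i := t))))" for t
  have gnone: "g t = conf (regs 0 0 a b (e(i := t)))" if "\<not> (\<exists>k<t. ?P k)" for t
    unfolding g_def using that by (rule if_not_P)
  have gsome: "g t = conf (regs 1 0 a b (e(i := ?L)))" if "\<exists>k<t. ?P k" for t
    unfolding g_def using that by (rule if_P)
  have L: "?P ?L" "?L < ?n" if found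
    using that unfolding found_def by (auto intro: LeastI Least_le[THEN le_less_trans])
  have N: "N \<le> ?n" using L by (auto simp: N_def Suc_le_eq)
  have none: "\<not> (\<exists>k<t. ?P k)" if "t < N" for t
  proof
    assume "\<exists>k<t. ?P k"
    then obtain k where k: "k < t" "?P k" by blast
    then have found using that N unfolding found_def by (intro exI[of _ k]) simp
    then have "k < ?L" using k that by (simp add: N_def)
    then show False using not_less_Least k by blast
  qed
  have 1: "runs 3 (set_flag False) (conf (regs f 0 a b e)) (g 0)"
    using runs_set_flag[OF \<open>f \<le> 1\<close>, of 3 False 0 a b e] \<open>e i = 0\<close>
    by (simp add: g_def fun_upd_idem)
  have 2: "runs (?n * (T + 5) + 1) (While (\<lambda>s. at_start 0 s \<and> \<not> at_end (4 + i) s)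
      (Seq (prog_of \<phi>) (Cond (at_start 0) (shift {} {4 + i}) skip))) (g 0) (g N)"
  proof (rule runs_While[where n = N and T = "T + 3" and g = g])
    fix t assume t: "t < N"
    have gt: "g t = conf (regs 0 0 a b (e(i := t)))" by (rule gnone[OF none[OF t]])
    have "t < ?n" using t N by simp
    have test: "at_start 0 (map tape_read (g t))" "\<not> at_end (4 + i) (map tape_read (g t))"
      unfolding gt using \<open>t < ?n\<close> \<open>i < m\<close> by (simp_all only: read_conf at_start_conf) simp_all
    have gS: "g (Suc t) = conf (regs (of_bool (?P t)) 0 a b
      ((e(i := t))(i := (e(i := t)) i + of_bool (\<not> ?P t))))"
    proof (cases "?P t")
      case True
      then have "?L = t" using none[OF t] by (intro Least_equality) (auto simp: not_less[symmetric])
      have "g (Suc t) = conf (regs 1 0 a b (e(i := ?L)))" by (rule gsome) (use True in blast)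
      then show ?thesis using True \<open>?L = t\<close> by simp
    next
      case False
      then have "\<not> (\<exists>k<Suc t. ?P k)" using none[OF t] less_Suc_eq by blast
      from gnone[OF this] show ?thesis using False by simp
    qed
    have "runs (T + 3) (Seq (prog_of \<phi>) (Cond (at_start 0) (shift {} {4 + i}) skip)) (g t) (g (Suc t))"
      unfolding gt gS by (rule runs_Seq[OF IH[OF \<open>t < ?n\<close>] runs_count_if(3)[OF order.refl]]) auto
    with test show "(at_start 0 (map tape_read (g t)) \<and> \<not> at_end (4 + i) (map tape_read (g t))) \<and>
      runs (T + 3) (Seq (prog_of \<phi>) (Cond (at_start 0) (shift {} {4 + i}) skip)) (g t) (g (Suc t))"
      by blast
  next
    show "\<not> (at_start 0 (map tape_read (g N)) \<and> \<not> at_end (4 + i) (map tape_read (g N)))"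
    proof (cases found)
      case True
      then have "\<exists>k<N. ?P k" using L by (auto simp: N_def)
      then have "g N = conf (regs 1 0 a b (e(i := ?L)))" by (rule gsome)
      then show ?thesis by simp
    next
      case False
      then have "g N = conf (regs 0 0 a b (e(i := ?n)))"
      using gnone[of ?n] by (simp only: N_def found_def if_False simp_thms)
      then have "at_end (4 + i) (map tape_read (g N))" using \<open>i < m\<close> by (simp only: read_conf) simp
      then show ?thesis by blast
    qed
  next
    show "N * (T + 3 + 2) + 1 \<le> ?n * (T + 5) + 1" using mult_le_mono1[OF N, of "T + 5"] by (simp add: ac_simps)
  qed auto
  obtain v where v: "g N = conf (regs (of_bool found) 0 a b (e(i := v)))" "v \<le> ?n"
  proof (cases found)
    case True
    then have "\<exists>k<N. ?P k" using L by (auto simp: N_def)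
    then show ?thesis using True L that[of ?L] by (simp add: gsome)
  next
    case False
    then have "g N = conf (regs 0 0 a b (e(i := ?n)))"
      using gnone[of ?n] by (simp only: N_def found_def if_False simp_thms)
    then show ?thesis using False that[of ?n] by simp
  qed
  have 3: "runs (3 * ?n + 1) (rewind (4 + i)) (g N) (conf (regs (of_bool found) 0 a b e))"
  proof -
    have "(regs (of_bool found) 0 a b (e(i := v)))(4 + i := 0) = regs (of_bool found) 0 a b e"
      unfolding regs_upd using \<open>e i = 0\<close> by (simp add: fun_upd_idem)
    then show ?thesis
      using runs_rewind[of "4 + i" "regs (of_bool found) 0 a b (e(i := v))" ?n "3 * ?n + 1"] v \<open>i < m\<close>
      by simp
  qed
  have "found = sat y e (Ex i \<phi>)" by (simp add: found_def)
  then show ?thesis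
    unfolding prog_of.simps using U 3
    by (intro runs_Seq[OF 1 runs_Seq[OF 2 _ order.refl]]) auto
qed

text \<open>The cardinalities grow as positions of heads 2 and 3, which are then lowered together
  until one is 0; they were equal iff both are 0 by then. Rewinding both makes them available for
  the next use.\<close>

lemma runs_EqCount:
  assumes IH: "\<And>k f a b. k < length y \<Longrightarrow> f \<le> 1 \<Longrightarrow>
      runs T (prog_of \<phi>) (conf (regs f 0 a b (e(i := k))))
        (conf (regs (of_bool (sat y (e(i := k)) \<phi>)) 0 a b (e(i := k))))"
    and IH': "\<And>k f a b. k < length y \<Longrightarrow> f \<le> 1 \<Longrightarrow>
      runs T' (prog_of \<psi>) (conf (regs f 0 a b (e(i := k))))
        (conf (regs (of_bool (sat y (e(i := k)) \<psi>)) 0 a b (e(i := k))))"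
    and "i < m" "e i = 0" "f \<le> 1"
    and U: "length y * (T + T' + 10) + 20 + 12 * length y \<le> U"
  shows "runs U (prog_of (EqCount i \<phi> \<psi>)) (conf (regs f 0 0 0 e))
    (conf (regs (of_bool (sat y e (EqCount i \<phi> \<psi>))) 0 0 0 e))"
proof -
  let ?n = "length y"
  let ?P = "\<lambda>k. sat y (e(i := k)) \<phi>" and ?Q = "\<lambda>k. sat y (e(i := k)) \<psi>"
  let ?cP = "\<lambda>t. card {k. k < t \<and> ?P k}" and ?cQ = "\<lambda>t. card {k. k < t \<and> ?Q k}"
  \<comment> \<open>The flag is not reset between iterations: iteration \<open>t\<close> starts with
    the value of the second formula at \<open>t - 1\<close>.\<close>
  define fl where "fl t = (if t = 0 then f else of_bool (?Q (t - 1)))" for t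
  have fl: "fl t \<le> 1" for t using \<open>f \<le> 1\<close> by (simp add: fl_def)
  let ?g = "\<lambda>t. conf (regs (fl t) 0 (?cP t) (?cQ t) (e(i := t)))"
  have le: "?cP t \<le> t" "?cQ t \<le> t" for t
    using card_mono[of "{..<t}" "{k. k < t \<and> ?P k}"] card_mono[of "{..<t}" "{k. k < t \<and> ?Q k}"] by auto
  have 1: "runs (?n * (T + T' + 9) + 1) (While (\<lambda>s. \<not> at_end (4 + i) s)
           (Seq (prog_of \<phi>) (Seq (Cond (at_start 0) skip (shift {} {2}))
           (Seq (prog_of \<psi>) (Seq (Cond (at_start 0) skip (shift {} {3}))
                (shift {} {4 + i})))))) (conf (regs f 0 0 0 e)) (?g ?n)"
  proof (rule runs_While[where n = ?n and T = "T + T' + 7" and g = ?g])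
    fix t assume t: "t < ?n"
    have test: "\<not> at_end (4 + i) (map tape_read (?g t))"
      using \<open>i < m\<close> t by (simp only: read_conf) simp
    have inc: "runs 1 (shift {} {4 + i}) (conf (regs f 0 a b (e(i := t)))) (conf (regs f 0 a b (e(i := Suc t))))" for f a b
      by (rule runs_shift) (auto simp: shifted_def regs_def fun_eq_iff)
    have "runs (T + T' + 7) (Seq (prog_of \<phi>) (Seq (Cond (at_start 0) skip (shift {} {2}))
           (Seq (prog_of \<psi>) (Seq (Cond (at_start 0) skip (shift {} {3}))
                (shift {} {4 + i}))))) (?g t)
      (conf (regs (of_bool (?Q t)) 0 (?cP t + of_bool (?P t)) (?cQ t + of_bool (?Q t)) (e(i := Suc t))))"
      by (rule runs_Seq[OF IH[OF t fl] runs_Seq[OF runs_count_if(1)[OF order.refl]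
            runs_Seq[OF IH'[OF t] runs_Seq[OF runs_count_if(2)[OF order.refl] inc order.refl]
              order.refl] order.refl]]) auto
    moreover have "fl (Suc t) = of_bool (?Q t)" by (simp add: fl_def)
    ultimately have "runs (T + T' + 7) (Seq (prog_of \<phi>) (Seq (Cond (at_start 0) skip (shift {} {2}))
           (Seq (prog_of \<psi>) (Seq (Cond (at_start 0) skip (shift {} {3}))
                (shift {} {4 + i}))))) (?g t) (?g (Suc t))"
      by (simp only: card_less_Suc)
    with test show "\<not> at_end (4 + i) (map tape_read (?g t)) \<and> runs (T + T' + 7)
      (Seq (prog_of \<phi>) (Seq (Cond (at_start 0) skip (shift {} {2}))
           (Seq (prog_of \<psi>) (Seq (Cond (at_start 0) skip (shift {} {3}))
                (shift {} {4 + i}))))) (?g t) (?g (Suc t))" by blast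
  next
    show "\<not> \<not> at_end (4 + i) (map tape_read (?g ?n))"
      using \<open>i < m\<close> by (simp only: read_conf) simp
  qed (use \<open>e i = 0\<close> in \<open>auto simp: fl_def fun_upd_idem\<close>)
  have 2: "runs (3 * ?n + 1) (rewind (4 + i)) (?g ?n) (conf (regs (fl ?n) 0 (?cP ?n) (?cQ ?n) e))"
  proof -
    let ?h = "regs (fl ?n) 0 (?cP ?n) (?cQ ?n) (e(i := ?n))"
    have "?h(4 + i := 0) = regs (fl ?n) 0 (?cP ?n) (?cQ ?n) e"
      unfolding regs_upd using \<open>e i = 0\<close> by (simp add: fun_upd_idem)
    moreover have "runs (3 * ?n + 1) (rewind (4 + i)) (conf ?h) (conf (?h(4 + i := 0)))"
      using \<open>i < m\<close> by (intro runs_rewind[where n = ?n]) auto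
    ultimately show ?thesis by simp
  qed
  let ?k = "min (?cP ?n) (?cQ ?n)"
  let ?g' = "\<lambda>f t. conf (regs f 0 (?cP ?n - t) (?cQ ?n - t) e)"
  have 3: "runs (3 * ?n + 1) (While (\<lambda>s. \<not> at_start 2 s \<and> \<not> at_start 3 s) (shift {2, 3} {}))
    (?g' (fl ?n) 0) (?g' (fl ?n) ?k)"
  proof (rule runs_While[where n = ?k and T = 1 and g = "?g' (fl ?n)"])
    fix t assume t: "t < ?k"
    have "runs 1 (shift {2, 3} {}) (?g' (fl ?n) t) (?g' (fl ?n) (Suc t))"
      using t by (intro runs_shift) (auto simp: shifted_def regs_def fun_eq_iff)
    then show "(\<not> at_start 2 (map tape_read (?g' (fl ?n) t)) \<and> \<not> at_start 3 (map tape_read (?g' (fl ?n) t))) \<and>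
      runs 1 (shift {2, 3} {}) (?g' (fl ?n) t) (?g' (fl ?n) (Suc t))"
      using t by simp
  next
    show "?k * (1 + 2) + 1 \<le> 3 * ?n + 1" using le[of ?n] by simp
  qed auto
  let ?s = "sat y e (EqCount i \<phi> \<psi>)"
  have s: "?s \<longleftrightarrow> ?cP ?n = ?cQ ?n" by simp
  have 4: "runs 5 (flag_test (\<lambda>s. at_start 2 s \<and> at_start 3 s)) (?g' (fl ?n) ?k) (?g' (of_bool ?s) ?k)"
    unfolding s using fl by (intro runs_flag_test) auto
  let ?h = "regs (of_bool ?s) 0 (?cP ?n - ?k) (?cQ ?n - ?k) e"
  have 5: "runs (3 * ?n + 1) (rewind 2) (conf ?h) (conf (?h(2 := 0)))"
    using le[of ?n] by (intro runs_rewind[where n = ?n]) auto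
  have 6: "runs (3 * ?n + 1) (rewind 3) (conf (?h(2 := 0))) (conf (?h(2 := 0, 3 := 0)))"
    using le[of ?n] by (intro runs_rewind[where n = ?n]) auto
  have "?h(2 := 0, 3 := 0) = regs (of_bool ?s) 0 0 0 e"
    by (auto simp: regs_def fun_eq_iff)
  with 6 have 6: "runs (3 * ?n + 1) (rewind 3) (conf (?h(2 := 0))) (conf (regs (of_bool ?s) 0 0 0 e))"
    by simp
  have 2: "runs (3 * ?n + 1) (rewind (4 + i)) (?g ?n) (?g' (fl ?n) 0)"
    using 2 by simp
  show ?thesis
    unfolding prog_of.simps
    by (rule runs_Seq[OF 1 runs_Seq[OF 2 runs_Seq[OF 3 runs_Seq[OF 4 runs_Seq[OF 5 6 order.refl]
      order.refl] order.refl] order.refl]]) (use U in \<open>simp add: algebra_simps\<close>)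
qed

text \<open>All heads except the flag return to their places, so subformulas can be run one after
  another; the flag may have either value at the start.\<close>

theorem runs_prog_of:
  assumes "wf_fm m \<phi>" "\<And>x. x < m \<Longrightarrow> e x < length y" "\<And>x. x \<in> bound_vars \<phi> \<Longrightarrow> e x = 0"
    and "f \<le> 1" "count_free \<phi> \<or> a = 0 \<and> b = 0"
  shows "runs (poly (time_of \<phi>) (length y)) (prog_of \<phi>) (conf (regs f 0 a b e))
    (conf (regs (of_bool (sat y e \<phi>)) 0 a b e))"
  using assms
proof (induction \<phi> arbitrary: e f a b)
  case (Sym i A)
  then have "cell y (e i) = y ! e i" by (auto simp: cell_def)
  then have "map tape_read (conf (regs f 0 a b e)) ! (2 + (4 + i)) = y ! e i"
    using Sym.prems(1) by (simp only: read_conf regs_simps nat_add_left_cancel_less wf_fm.simps)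
  then show ?case
    unfolding prog_of.simps using Sym.prems(4) by (intro runs_flag_test) auto
next
  case (Less i j)
  then have "runs (poly (time_of (Less i j)) (length y)) (prog_of (Less i j)) (conf (regs f 0 a b e))
    (conf (regs (of_bool (e i < e j)) 0 a b e))"
    by (intro runs_Less) auto
  then show ?case by (simp only: sat.simps)
next
  case (Same i j)
  then show ?case by (intro runs_Same) auto
next
  case (Neg \<phi>)
  have "runs (poly (time_of \<phi>) (length y)) (prog_of \<phi>) (conf (regs f 0 a b e))
    (conf (regs (of_bool (sat y e \<phi>)) 0 a b e))"
    using Neg.prems by (intro Neg.IH) auto
  moreover have "runs 5 (flag_test (at_start 0)) (conf (regs (of_bool (sat y e \<phi>)) 0 a b e))
    (conf (regs (of_bool (\<not> sat y e \<phi>)) 0 a b e))"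
    by (intro runs_flag_test) auto
  ultimately show ?case unfolding prog_of.simps sat.simps by (rule runs_Seq) simp
next
  case (Conj \<phi> \<psi>)
  have 1: "runs (poly (time_of \<phi>) (length y)) (prog_of \<phi>) (conf (regs f 0 a b e))
    (conf (regs (of_bool (sat y e \<phi>)) 0 a b e))"
    using Conj.prems by (intro Conj.IH(1)) auto
  have 2: "runs (poly (time_of \<psi>) (length y)) (prog_of \<psi>) (conf (regs (of_bool (sat y e \<phi>)) 0 a b e))
    (conf (regs (of_bool (sat y e \<psi>)) 0 a b e))"
    using Conj.prems by (intro Conj.IH(2)) auto
  have "runs (poly (time_of \<psi>) (length y) + 3) (Cond (at_start 0) skip (prog_of \<psi>))
    (conf (regs (of_bool (sat y e \<phi>)) 0 a b e))
    (conf (regs (of_bool (sat y e \<phi> \<and> sat y e \<psi>)) 0 a b e))"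
  proof (rule runs_Cond)
    assume "at_start 0 (map tape_read (conf (regs (of_bool (sat y e \<phi>)) 0 a b e)))"
    then have "\<not> sat y e \<phi>" by simp
    then show "runs (poly (time_of \<psi>) (length y) + 1) skip (conf (regs (of_bool (sat y e \<phi>)) 0 a b e))
      (conf (regs (of_bool (sat y e \<phi> \<and> sat y e \<psi>)) 0 a b e))"
      by (simp add: runs_skip)
  next
    assume "\<not> at_start 0 (map tape_read (conf (regs (of_bool (sat y e \<phi>)) 0 a b e)))"
    then have "sat y e \<phi>" by simp
    then show "runs (poly (time_of \<psi>) (length y) + 1) (prog_of \<psi>) (conf (regs (of_bool (sat y e \<phi>)) 0 a b e))
      (conf (regs (of_bool (sat y e \<phi> \<and> sat y e \<psi>)) 0 a b e))"
      using runs_mono[OF 2] by simp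
  qed simp
  with 1 show ?case unfolding prog_of.simps sat.simps by (rule runs_Seq) simp
next
  case (Ex i \<phi>)
  show ?case
  proof (rule runs_Ex[where T = "poly (time_of \<phi>) (length y)"])
    fix k assume "k < length y"
    then show "runs (poly (time_of \<phi>) (length y)) (prog_of \<phi>) (conf (regs 0 0 a b (e(i := k))))
      (conf (regs (of_bool (sat y (e(i := k)) \<phi>)) 0 a b (e(i := k))))"
      using Ex.prems by (intro Ex.IH) auto
  qed (use Ex.prems in \<open>auto simp: algebra_simps\<close>)
next
  case (EqCount i \<phi> \<psi>)
  have [simp]: "a = 0" "b = 0" using EqCount.prems(5) by auto
  show ?case
    unfolding \<open>a = 0\<close> \<open>b = 0\<close>
  proof (rule runs_EqCount[where T = "poly (time_of \<phi>) (length y)" and T' = "poly (time_of \<psi>) (length y)"])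
    fix k f and a b :: nat assume k: "k < length y" "f \<le> (1 :: nat)"
    then show "runs (poly (time_of \<phi>) (length y)) (prog_of \<phi>) (conf (regs f 0 a b (e(i := k))))
      (conf (regs (of_bool (sat y (e(i := k)) \<phi>)) 0 a b (e(i := k))))"
      using EqCount.prems by (intro EqCount.IH(1)) auto
    show "runs (poly (time_of \<psi>) (length y)) (prog_of \<psi>) (conf (regs f 0 a b (e(i := k))))
      (conf (regs (of_bool (sat y (e(i := k)) \<psi>)) 0 a b (e(i := k))))"
      using k EqCount.prems by (intro EqCount.IH(2)) auto
  qed (use EqCount.prems in \<open>auto simp: algebra_simps\<close>)
qed

end

section \<open>Reading the input\<close>

text \<open>Tape symbols: 1 and 2 are the binary digits 0 and 1, 3 ends a letter, 4 separates the two
  words, 5 and 6 mark the beginning and the end. The states 0 to 3 of the automaton are: at the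
  beginning of a word, after a letter, after the digit 1, after the digit 0; the states 4 to 7 are
  the same for the second word, and 8 is the failure state.\<close>

definition block_symbol :: "bool \<Rightarrow> bool \<Rightarrow> nat" where
  "block_symbol c d = (if c then (if d then 2 else 1) else (if d then 4 else 3))"

definition next_state :: "nat \<Rightarrow> nat \<Rightarrow> nat" where
  "next_state q a =
     (if 8 \<le> q then 8
      else if a = 1 then (if q < 4 then 3 else 7)
      else if a = 2 then (if q < 4 then 2 else 6)
      else if a = 3 then (if q = 3 \<or> q = 7 then 8 else if q < 4 then 1 else 5)
      else (if q = 1 then 4 else 8))"

text \<open>State \<open>q < 9\<close> means that a whole number of blocks has been read; in state
  \<open>9 + 2 * q + of_bool c\<close> the bit \<open>c\<close> of the current block has been read as well.\<close>

definition scan_step :: "nat \<Rightarrow> bool \<Rightarrow> nat \<times> nat list" where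
  "scan_step q d =
     (if q < 9 then (9 + 2 * q + of_bool d, [])
      else let a = block_symbol (odd (q - 9)) d in (next_state ((q - 9) div 2) a, [a]))"

definition scan :: "nat \<times> nat list \<Rightarrow> bool list \<Rightarrow> nat \<times> nat list" where
  "scan = foldl (\<lambda>(q, z) d. let (q', u) = scan_step q d in (q', z @ u))"

text \<open>The automaton state is the single symbol on tape 1. The working tapes are identical
  copies with equal head positions, so what tape 2 shows can be written back to all of them.\<close>

definition scan_action :: "nat list \<Rightarrow> nat list \<times> move list" where
  "scan_action s =
     (case scan_step (s ! 1) (s ! 0 = 2) of (q, u) \<Rightarrow>
        (s ! 0 # q # replicate (length s - 2) (if u = [] then s ! 2 else hd u),
         MRight # MStay # replicate (length s - 2) (if u = [] then MStay else MRight)))"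

definition write_action :: "nat \<Rightarrow> move \<Rightarrow> nat list \<Rightarrow> nat list \<times> move list" where
  "write_action a d s = (s ! 0 # s ! 1 # replicate (length s - 2) a,
     MStay # MStay # replicate (length s - 2) d)"

definition decide :: "nat \<Rightarrow> fm \<Rightarrow> prog" where
  "decide m \<phi> =
     Seq (Act (write_action 5 MRight))
    (Seq (While (\<lambda>s. s ! 0 \<noteq> 0) (Act scan_action))
    (Seq (Act (write_action 6 MStay))
         (Cond (\<lambda>s. s ! 1 = 5)
           (Seq (While (\<lambda>s. \<not> at_start 0 s) (shift {..<4 + m} {})) (prog_of \<phi>)) skip)))"

lemma next_state_less: "next_state q a < 9"
  by (simp add: next_state_def)

text \<open>The alphabet contains the automaton states, the largest of which is
  \<open>9 + 2 * 8 + 1\<close>, that is 26; hence the bound 30.\<close>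

lemma wf_decide: "wf_prog (6 + m) 30 (decide m \<phi>)"
proof -
  have "wf_prog (6 + m) 30 (Act scan_action)"
    using next_state_less
    by (auto simp: scan_action_def scan_step_def block_symbol_def Let_def less_trans[OF next_state_less]
      subset_iff split: prod.splits if_splits)
  moreover have "wf_prog (6 + m) 30 (Act (write_action a d))" if "a < 30" for a d
    using that by (auto simp: write_action_def subset_iff)
  moreover have "wf_prog (6 + m) 30 (prog_of \<phi>)" by (rule wf_prog_of) simp
  ultimately show ?thesis by (simp add: decide_def shift_def skip_def)
qed

definition state_tape :: "nat \<Rightarrow> tape" where
  "state_tape q = ((\<lambda>_. 0)(0 := q), 0)"

definition scanning :: "nat \<Rightarrow> bool list \<Rightarrow> nat \<Rightarrow> nat \<times> nat list \<Rightarrow> tape list" where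
  "scanning m x i c = (fst (input_tape x), int i) # state_tape (fst c) #
     replicate (4 + m) (head_tape (5 # snd c) (Suc (length (snd c))))"

lemma cell_append: "cell (z @ [a]) p = (if p = length z then a else cell z p)"
  by (auto simp: cell_def nth_append)

lemma head_tape_write:
  "tape_update a d (head_tape z (length z)) =
    (fst (head_tape (z @ [a]) 0), int (length z) + move_offset d)"
  by (auto simp: tape_update_def head_tape_def cell_append fun_eq_iff)

lemma tape_read_head_tape: "tape_read (head_tape z p) = cell z p"
  by (simp add: tape_read_def head_tape_def)

lemma state_tape_simps:
  "tape_update a MStay (state_tape q) = state_tape a" "tape_read (state_tape q) = q"
  by (simp_all add: tape_update_def state_tape_def tape_read_def move_offset_def)

lemma tape_read_input:
  "tape_read (fst (input_tape x), int i) = (if i < length x then if x ! i then 2 else 1 else 0)"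
  by (simp add: tape_read_def input_tape_def)

lemma runs_write:
  assumes "1 \<le> T"
  shows "runs T (Act (write_action a d)) (t # state_tape q # replicate (4 + m) (head_tape z (length z)))
    (t # state_tape q # replicate (4 + m) (fst (head_tape (z @ [a]) 0), int (length z) + move_offset d))"
  by (rule runs_Act[OF _ assms])
    (simp add: write_action_def apply_act_def head_tape_write state_tape_simps tape_update_same move_offset_def)

lemma runs_scan_action:
  assumes "i < length x"
  shows "runs 1 (Act scan_action) (scanning m x i c) (scanning m x (Suc i) (scan c [x ! i]))"
proof (rule runs_Act)
  obtain q z where c: "c = (q, z)" by (cases c)
  let ?h = "head_tape (5 # z) (Suc (length z))"
  have r: "map tape_read (scanning m x i c) =
    (if x ! i then 2 else 1) # q # replicate (4 + m) 0"
    using assms by (simp add: scanning_def c tape_read_input state_tape_simps tape_read_head_tape cell_def)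
  have stay: "tape_update 0 MStay ?h = ?h"
    using tape_update_same[of ?h MStay]
    by (simp add: tape_read_head_tape cell_def move_offset_def)
  have wr: "tape_update a MRight ?h = head_tape (5 # z @ [a]) (Suc (Suc (length z)))" for a
    using head_tape_write[of a MRight "5 # z"] by (simp add: move_offset_def head_tape_def)
  have inp: "tape_update (if x ! i then 2 else 1) MRight (fst (input_tape x), int i) =
      (fst (input_tape x), int (Suc i))"
    using tape_update_same[of "(fst (input_tape x), int i)" MRight] assms
    by (simp add: tape_read_input move_offset_def)
  show "scanning m x (Suc i) (scan c [x ! i]) =
    apply_act (scan_action (map tape_read (scanning m x i c))) (scanning m x i c)"
    unfolding r using inp
    by (auto simp: scan_action_def apply_act_def scanning_def c scan_def scan_step_def Let_def
      state_tape_simps stay wr)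
qed simp

lemma scan_symbols: "set (snd (scan (q, z) x)) \<subseteq> set z \<union> {1, 2, 3, 4}"
proof (induction x arbitrary: q z)
  case (Cons d x)
  have "scan (q, z) (d # x) = scan (fst (scan_step q d), z @ snd (scan_step q d)) x"
    by (simp add: scan_def split_beta Let_def)
  moreover have "set (snd (scan_step q d)) \<subseteq> {1, 2, 3, 4}"
    by (auto simp: scan_step_def Let_def block_symbol_def)
  ultimately show ?case using Cons[of "fst (scan_step q d)" "z @ snd (scan_step q d)"] by auto
qed (auto simp: scan_def)

lemma scan_length: "length (snd (scan (q, z) x)) \<le> length z + length x"
proof (induction x arbitrary: q z)
  case (Cons d x)
  have "scan (q, z) (d # x) = scan (fst (scan_step q d), z @ snd (scan_step q d)) x"
    by (simp add: scan_def split_beta Let_def)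
  moreover have "length (snd (scan_step q d)) \<le> 1"
    by (auto simp: scan_step_def Let_def)
  ultimately show ?case using Cons[of "fst (scan_step q d)" "z @ snd (scan_step q d)"] by simp
qed (simp add: scan_def)

definition scanned :: "bool list \<Rightarrow> nat list" where
  "scanned x = 5 # snd (scan (0, []) x) @ [6]"

lemma length_scanned: "length (scanned x) \<le> length x + 2"
  using scan_length[of 0 "[]" x] by (simp add: scanned_def)

text \<open>The answer is read from two places: tape 1 shows 5 iff the input has the right form, and
  in that case the flag holds the value of the formula.\<close>

lemma runs_decide:
  assumes "wf_fm m \<phi>" "0 < m"
  shows "\<exists>ts. runs (3 * length x + 20 + 3 * length (scanned x) + poly (time_of \<phi>) (length (scanned x)))
      (decide m \<phi>) (input_tape x # replicate (6 + m - 1) blank_tape) ts \<and>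
    (map tape_read ts ! 1 = 5 \<and> \<not> at_start 0 (map tape_read ts) \<longleftrightarrow>
      fst (scan (0, []) x) = 5 \<and> sat (scanned x) (\<lambda>_. 0) \<phi>)"
proof -
  let ?y = "scanned x" and ?c = "\<lambda>i. scan (0, []) (take i x)"
  obtain q z where c: "scan (0, []) x = (q, z)" by (cases "scan (0, []) x")
  have y: "?y = 5 # z @ [6]" by (simp add: scanned_def c)
  have zs: "set z \<subseteq> {1, 2, 3, 4}" using scan_symbols[of 0 "[]" x] by (simp add: c)
  define aux where "aux = [(fst (input_tape x), int (length x)), state_tape q]"
  interpret heads aux ?y m
  proof
    fix p assume "0 < p" "p < length ?y"
    then have "?y ! p \<in> set (z @ [6])"
      using nth_mem[of "p - 1" "z @ [6]"] unfolding y by (cases p) simp_all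
    then show "?y ! p \<noteq> 5 \<and> ?y ! p \<noteq> 0" using zs by auto
  qed (auto simp: aux_def y)
  have start: "input_tape x # replicate (6 + m - 1) blank_tape =
      (fst (input_tape x), 0) # state_tape 0 # replicate (4 + m) (head_tape [] (length []))"
  proof -
    have "replicate (6 + m - 1) blank_tape = blank_tape # replicate (4 + m) blank_tape"
      by (simp add: numeral_eq_Suc)
    moreover have "blank_tape = state_tape 0" "blank_tape = head_tape [] (length [])"
      "input_tape x = (fst (input_tape x), 0)"
      by (simp_all add: blank_tape_def state_tape_def head_tape_def cell_def fun_eq_iff input_tape_def)
    ultimately show ?thesis by metis
  qed
  have 1: "runs 1 (Act (write_action 5 MRight)) (input_tape x # replicate (6 + m - 1) blank_tape)
      (scanning m x 0 (?c 0))"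
    by (subst start) (use runs_write[OF order.refl, of 5 MRight "(fst (input_tape x), 0)" 0 m "[]"]
      in \<open>simp add: scanning_def scan_def head_tape_def move_offset_def\<close>)
  have 2: "runs (3 * length x + 1) (While (\<lambda>s. s ! 0 \<noteq> 0) (Act scan_action)) (scanning m x 0 (?c 0))
      (scanning m x (length x) (q, z))"
  proof (rule runs_While[where n = "length x" and T = 1 and g = "\<lambda>i. scanning m x i (?c i)"])
    fix i assume i: "i < length x"
    have "scan (?c i) [x ! i] = ?c (Suc i)"
      using i by (simp add: scan_def take_Suc_conv_app_nth)
    then have "runs 1 (Act scan_action) (scanning m x i (?c i)) (scanning m x (Suc i) (?c (Suc i)))"
      using runs_scan_action[OF i, of m "?c i"] by simp
    moreover have "map tape_read (scanning m x i (?c i)) ! 0 \<noteq> 0"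
      using i by (simp add: scanning_def tape_read_input)
    ultimately show "map tape_read (scanning m x i (?c i)) ! 0 \<noteq> 0 \<and>
      runs 1 (Act scan_action) (scanning m x i (?c i)) (scanning m x (Suc i) (?c (Suc i)))" by blast
  qed (simp_all add: scanning_def tape_read_input c)
  have 3: "runs 1 (Act (write_action 6 MStay)) (scanning m x (length x) (q, z))
      (conf (\<lambda>_. Suc (length z)))"
    unfolding conf_def unfolding map_replicate_const length_upt aux_def y
    using runs_write[OF order.refl, of 6 MStay "(fst (input_tape x), int (length x))" q m "5 # z"]
    by (simp add: scanning_def head_tape_def move_offset_def)
  let ?T = "3 * length ?y + 1 + poly (time_of \<phi>) (length ?y)"
  let ?h = "if q = 5 then regs (of_bool (sat ?y (\<lambda>_. 0) \<phi>)) 0 0 0 (\<lambda>_. 0) else (\<lambda>_. Suc (length z))"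
  have q: "map tape_read (conf h) ! 1 = q" for h
    unfolding conf_def by (simp add: aux_def state_tape_simps)
  have 4: "runs (?T + 2) (Cond (\<lambda>s. s ! 1 = 5)
      (Seq (While (\<lambda>s. \<not> at_start 0 s) (shift {..<4 + m} {})) (prog_of \<phi>)) skip)
      (conf (\<lambda>_. Suc (length z))) (conf ?h)"
  proof (rule runs_Cond[OF _ _ order.refl])
    assume "map tape_read (conf (\<lambda>_. Suc (length z))) ! 1 = 5"
    then have "q = 5" by (simp only: q)
    let ?g = "\<lambda>t i. Suc (length z) - t"
    \<comment> \<open>After copying, all working heads stand at the same position, so testing one of
      them suffices to rewind all.\<close>
    have "runs (3 * length ?y + 1) (While (\<lambda>s. \<not> at_start 0 s) (shift {..<4 + m} {}))
        (conf (\<lambda>_. Suc (length z))) (conf (regs 0 0 0 0 (\<lambda>_. 0)))"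
    proof (rule runs_While[where n = "Suc (length z)" and T = 1 and g = "\<lambda>t. conf (?g t)"])
      fix t assume "t < Suc (length z)"
      moreover have "conf (?g (Suc t)) = conf (shifted {..<4 + m} {} (?g t))"
        by (simp add: conf_def shifted_def)
      ultimately show "\<not> at_start 0 (map tape_read (conf (?g t))) \<and>
        runs 1 (shift {..<4 + m} {}) (conf (?g t)) (conf (?g (Suc t)))"
        by (auto intro: runs_shift)
    next
      show "conf (regs 0 0 0 0 (\<lambda>_. 0)) = conf (?g (Suc (length z)))"
        by (simp add: conf_def regs_def)
    qed (simp, simp add: y, simp)
    moreover have "runs (poly (time_of \<phi>) (length ?y)) (prog_of \<phi>) (conf (regs 0 0 0 0 (\<lambda>_. 0)))
        (conf (regs (of_bool (sat ?y (\<lambda>_. 0) \<phi>)) 0 0 0 (\<lambda>_. 0)))"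
      using assms by (intro runs_prog_of) (auto simp: y)
    ultimately show "runs ?T (Seq (While (\<lambda>s. \<not> at_start 0 s) (shift {..<4 + m} {})) (prog_of \<phi>))
        (conf (\<lambda>_. Suc (length z))) (conf ?h)"
      unfolding if_P[OF \<open>q = 5\<close>] by (rule runs_Seq[OF _ _ order.refl])
  next
    assume "map tape_read (conf (\<lambda>_. Suc (length z))) ! 1 \<noteq> 5"
    then have "q \<noteq> 5" unfolding q .
    then show "runs ?T skip (conf (\<lambda>_. Suc (length z))) (conf ?h)"
      by (simp add: runs_skip)
  qed
  have "runs (3 * length x + 20 + 3 * length ?y + poly (time_of \<phi>) (length ?y)) (decide m \<phi>)
      (input_tape x # replicate (6 + m - 1) blank_tape) (conf ?h)"
    unfolding decide_def
    by (rule runs_Seq[OF 1 runs_Seq[OF 2 runs_Seq[OF 3 4 order.refl] order.refl]]) simp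
  moreover have "map tape_read (conf ?h) ! 1 = 5 \<and> \<not> at_start 0 (map tape_read (conf ?h)) \<longleftrightarrow>
      q = 5 \<and> sat ?y (\<lambda>_. 0) \<phi>"
    unfolding q by (cases "q = 5") simp_all
  ultimately show ?thesis unfolding c by auto
qed

theorem class_P_by_formula:
  assumes "wf_fm m \<phi>" "0 < m"
    and "\<And>x. x \<in> L \<longleftrightarrow> fst (scan (0, []) x) = 5 \<and> sat (scanned x) (\<lambda>_. 0) \<phi>"
  shows "L \<in> class_P"
proof (rule class_P_I)
  \<comment> \<open>The working tapes hold at most \<open>length x + 2\<close> symbols, which is the
    reason for composing with \<open>[:2, 1:]\<close>.\<close>
  let ?p = "[:20, 3:] + pcompose ([:0, 3:] + time_of \<phi>) [:2, 1:]"
  show "wf_prog (6 + m) 30 (decide m \<phi>)" by (rule wf_decide)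
  fix x
  obtain ts where ts: "runs (3 * length x + 20 + 3 * length (scanned x) + poly (time_of \<phi>) (length (scanned x)))
      (decide m \<phi>) (input_tape x # replicate (6 + m - 1) blank_tape) ts"
    "map tape_read ts ! 1 = 5 \<and> \<not> at_start 0 (map tape_read ts) \<longleftrightarrow> x \<in> L"
    using runs_decide[OF assms(1,2), of x] assms(3) by blast
  have "poly ([:0, 3:] + time_of \<phi>) (length (scanned x)) \<le> poly ([:0, 3:] + time_of \<phi>) (length x + 2)"
    by (rule poly_nat_mono[OF length_scanned])
  then have "3 * length x + 20 + 3 * length (scanned x) + poly (time_of \<phi>) (length (scanned x))
      \<le> poly ?p (length x)"
    by (simp add: poly_pcompose algebra_simps)
  then show "\<exists>ts. runs (poly ?p (length x)) (decide m \<phi>) (input_tape x # replicate (6 + m - 1) blank_tape) ts \<and>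
      ((\<lambda>s. s ! 1 = 5 \<and> \<not> at_start 0 s) (map tape_read ts) \<longleftrightarrow> x \<in> L)"
    using ts runs_mono by blast
qed simp_all

section \<open>Recognition of encoded identities\<close>

fun digits :: "nat \<Rightarrow> nat list" where
  "digits n = (if n = 0 then [] else (if odd n then 2 else 1) # digits (n div 2))"

declare digits.simps [simp del]

lemma digits_simps [simp]:
  "digits 0 = []" "digits (Suc (2 * n)) = 2 # digits n" "0 < n \<Longrightarrow> digits (2 * n) = 1 # digits n"
  by (subst digits.simps; simp)+

definition letter_code :: "nat \<Rightarrow> nat list" where
  "letter_code n = digits n @ [3]"

definition word_code :: "nat list \<Rightarrow> nat list" where
  "word_code w = concat (map letter_code w)"

definition block_bits :: "nat \<Rightarrow> bool list" where
  "block_bits a = (if a = 1 then [True, False] else if a = 2 then [True, True]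
     else if a = 3 then [False, False] else [False, True])"

lemma block_bits_simps [simp]:
  "block_bits (Suc 0) = [True, False]" "block_bits 2 = [True, True]"
  "block_bits 3 = [False, False]" "block_bits 4 = [False, True]"
  by (simp_all add: block_bits_def)

lemma next_state_simps:
  "q < 8 \<Longrightarrow> next_state q (Suc 0) = (if q < 4 then 3 else 7)"
  "q < 8 \<Longrightarrow> next_state q 2 = (if q < 4 then 2 else 6)"
  "q < 8 \<Longrightarrow> q \<noteq> 3 \<Longrightarrow> q \<noteq> 7 \<Longrightarrow> next_state q 3 = (if q < 4 then Suc 0 else 5)"
  "next_state 3 3 = 8" "next_state 7 3 = 8" "next_state (Suc 0) 4 = 4"
  "q \<noteq> Suc 0 \<Longrightarrow> next_state q 4 = 8" "next_state 8 a = 8"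
  by (simp_all add: next_state_def)

lemma word_code_simps [simp]:
  "word_code [] = []" "word_code (n # w) = letter_code n @ word_code w"
  by (simp_all add: word_code_def)

lemma digits_set: "set (digits n) \<subseteq> {1, 2}"
  by (induction n rule: digits.induct) (subst digits.simps, auto)

lemma block_bits_letter: "concat (map block_bits (letter_code n)) = encode_letter n"
proof -
  have "concat (map block_bits (digits n)) = encode_nat n"
  proof (induction n rule: digits.induct)
    case (1 n)
    then show ?case
      by (subst digits.simps, subst encode_nat.simps) auto
  qed
  then show ?thesis by (simp add: letter_code_def encode_letter_def)
qed

lemma block_bits_word: "concat (map block_bits (word_code w)) = encode_word w"
  by (induction w) (simp_all add: block_bits_letter encode_word_def)

lemma word_code_set: "set (word_code w) \<subseteq> {1, 2, 3}"
proof (induction w)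
  case (Cons n w)
  then show ?case using digits_set[of n] by (auto simp: letter_code_def)
qed simp

lemma scan_block:
  assumes "q < 9"
  shows "scan (q, z) (c # d # x) =
    scan (next_state q (block_symbol c d), z @ [block_symbol c d]) x"
  using assms by (simp add: scan_def scan_step_def Let_def)

lemma scan_concat_blocks:
  assumes "q < 9" "set zs \<subseteq> {1, 2, 3, 4}"
  shows "scan (q, z) (concat (map block_bits zs)) = (foldl next_state q zs, z @ zs)"
  using assms
proof (induction zs arbitrary: q z)
  case (Cons a zs)
  obtain c d where cd: "block_bits a = [c, d]" "block_symbol c d = a"
  proof -
    have "a = 1 \<or> a = 2 \<or> a = 3 \<or> a = 4" using Cons.prems(2) by auto
    then show ?thesis
      by (elim disjE) (auto simp: block_symbol_def intro: that[of True False] that[of True True] that[of False False] that[of False True])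
  qed
  show ?case
    using Cons.IH[of "next_state q a" "z @ [a]"] Cons.prems next_state_less[of q a]
    by (simp add: cd scan_block)
qed (simp add: scan_def)

text \<open>An input of odd length stops inside a block, in a state of at least 9; an accepted one
  therefore splits into blocks.\<close>

lemma scan_acceptsD:
  assumes "fst (scan (q, z) x) = 5" "q < 9"
  shows "\<exists>zs. x = concat (map block_bits zs) \<and> set zs \<subseteq> {1, 2, 3, 4} \<and> foldl next_state q zs = 5"
  using assms
proof (induction x arbitrary: q z rule: induct_list012)
  case 1
  then show ?case by (intro exI[of _ "[]"]) (simp add: scan_def)
next
  case (2 d)
  then show ?case by (simp add: scan_def scan_step_def)
next
  case (3 c d x)
  let ?a = "block_symbol c d"
  obtain zs where "x = concat (map block_bits zs)" "set zs \<subseteq> {1, 2, 3, 4}"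
    "foldl next_state (next_state q ?a) zs = 5"
    using 3(1)[of "next_state q ?a" "z @ [?a]"] 3(3,4) next_state_less[of q ?a]
    by (simp add: scan_block) blast
  moreover have "block_bits ?a = [c, d]" "?a \<in> {1, 2, 3, 4}"
    by (auto simp: block_bits_def block_symbol_def)
  ultimately show ?case by (intro exI[of _ "?a # zs"]) auto
qed

text \<open>States 3 and 7 follow a digit 0 and refuse the end of a letter, so that the most
  significant digit is 1. In these states the rest of the letter must still have a digit, hence the
  side condition for \<open>n = 0\<close>.\<close>

lemma accepted_letter:
  assumes "q < 8" "n = 0 \<longrightarrow> q \<noteq> 3 \<and> q \<noteq> 7"
  shows "foldl next_state q (letter_code n) = (if q < 4 then 1 else 5)"
  using assms
proof (induction n arbitrary: q rule: digits.induct)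
  case (1 n)
  show ?case
  proof (cases "n = 0")
    case True
    then show ?thesis using 1 by (simp add: letter_code_def next_state_simps)
  next
    case False
    let ?a = "if odd n then 2 else 1 :: nat"
    have "n div 2 = 0 \<longrightarrow> odd n" using False by presburger
    then have "foldl next_state (next_state q ?a) (letter_code (n div 2)) =
        (if next_state q ?a < 4 then 1 else 5)"
      using 1 False by (intro 1(1)) (auto simp: next_state_simps)
    moreover have "letter_code n = ?a # letter_code (n div 2)"
      using False by (simp add: letter_code_def digits.simps[of n])
    ultimately show ?thesis using 1(2) by (auto simp: next_state_simps)
  qed
qed

lemma accepted_word:
  "foldl next_state 1 (word_code w) = 1" "w \<noteq> [] \<Longrightarrow> foldl next_state 0 (word_code w) = 1"
  "foldl next_state 5 (word_code w) = 5" "w \<noteq> [] \<Longrightarrow> foldl next_state 4 (word_code w) = 5"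
proof -
  show 1: "foldl next_state 1 (word_code w) = 1" for w
    by (induction w) (simp_all add: accepted_letter)
  show 5: "foldl next_state 5 (word_code w) = 5" for w
    by (induction w) (simp_all add: accepted_letter)
  show "w \<noteq> [] \<Longrightarrow> foldl next_state 0 (word_code w) = 1" "w \<noteq> [] \<Longrightarrow> foldl next_state 4 (word_code w) = 5"
    using 1 5 by (cases w; simp add: accepted_letter)+
qed

text \<open>What may remain to be read in state \<open>q < 4\<close>: the rest of the current letter in the states 2
  and 3, the rest of the current word, and then a continuation from \<open>R\<close>.\<close>

definition remainder :: "nat list set \<Rightarrow> nat \<Rightarrow> nat list \<Rightarrow> bool" where
  "remainder R q zs \<longleftrightarrow>
     (\<exists>w r. r \<in> R \<and> (if q = 0 then w \<noteq> [] \<and> zs = word_code w @ r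
       else if q = 1 then zs = word_code w @ r
       else \<exists>n. (q = 3 \<longrightarrow> 0 < n) \<and> zs = letter_code n @ word_code w @ r))"

text \<open>Digits come least significant first, so a digit in front of \<open>letter_code n\<close>
  turns \<open>n\<close> into \<open>2 * n\<close> or \<open>2 * n + 1\<close>. The former is a
  valid code only for \<open>0 < n\<close>, which is what state 3 remembers.\<close>

lemma remainder_step:
  "remainder R 1 zs \<Longrightarrow> q \<noteq> 3 \<Longrightarrow> remainder R q (3 # zs)"
  "remainder R 2 zs \<Longrightarrow> remainder R q (2 # zs)"
  "remainder R 3 zs \<Longrightarrow> remainder R q (1 # zs)"
proof -
  have letter: "remainder R q zs"
    if "zs = letter_code n @ word_code w @ r" "r \<in> R" "q = 3 \<longrightarrow> 0 < n" for q n w r zs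
  proof (cases "q \<le> 1")
    case True
    then show ?thesis unfolding remainder_def
      by (intro exI[of _ "n # w"] exI[of _ r]) (use that in auto)
  next
    case False
    then show ?thesis unfolding remainder_def
      by (intro exI[of _ w] exI[of _ r]) (use that in auto)
  qed
  show "remainder R q (3 # zs)" if rem: "remainder R 1 zs" and q: "q \<noteq> 3"
  proof -
    obtain w r where "zs = word_code w @ r" "r \<in> R"
      using rem by (auto simp: remainder_def)
    then show ?thesis using q by (intro letter[of _ 0 w r]) (auto simp: letter_code_def)
  qed
  show "remainder R q (2 # zs)" if rem: "remainder R 2 zs" for q
  proof -
    obtain n w r where "zs = letter_code n @ word_code w @ r" "r \<in> R"
      using rem by (auto simp: remainder_def)
    then show ?thesis by (intro letter[of _ "Suc (2 * n)" w r]) (auto simp: letter_code_def)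
  qed
  show "remainder R q (1 # zs)" if rem: "remainder R 3 zs" for q
  proof -
    obtain n w r where "zs = letter_code n @ word_code w @ r" "r \<in> R" "0 < n"
      using rem by (auto simp: remainder_def)
    then show ?thesis by (intro letter[of _ "2 * n" w r]) (auto simp: letter_code_def)
  qed
qed

lemma foldl_next_state_8: "foldl next_state 8 zs = 8"
  by (induction zs) (simp_all add: next_state_simps)

lemma accepted_second:
  assumes "foldl next_state (q + 4) zs = 5" "q < 4" "set zs \<subseteq> {1, 2, 3, 4}"
  shows "remainder {[]} q zs"
  using assms
proof (induction zs arbitrary: q)
  case Nil
  then have "q = 1" by simp
  then show ?case unfolding remainder_def by (intro exI[of _ "[]"]) simp
next
  case (Cons a zs)
  then consider "a = 1" | "a = 2" | "a = 3" | "a = 4" by auto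
  then show ?case
  proof cases
    case 1
    then show ?thesis using Cons.prems Cons.IH[of 3] remainder_step(3)[of "{[]}" zs q]
      by (auto simp: next_state_simps)
  next
    case 2
    then show ?thesis using Cons.prems Cons.IH[of 2] remainder_step(2)[of "{[]}" zs q]
      by (auto simp: next_state_simps)
  next
    case 3
    then have "q \<noteq> 3" using Cons.prems by (auto simp: next_state_simps foldl_next_state_8)
    with 3 show ?thesis using Cons.prems Cons.IH[of 1] remainder_step(1)[of "{[]}" zs q]
      by (auto simp: next_state_simps)
  next
    case 4
    then show ?thesis using Cons.prems by (auto simp: next_state_simps foldl_next_state_8)
  qed
qed

text \<open>Here a continuation is the separator followed by a complete second word. The input
  cannot end within the first word, because 5 is not among its states.\<close>

lemma accepted_first:
  assumes "foldl next_state q zs = 5" "q < 4" "set zs \<subseteq> {1, 2, 3, 4}"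
  shows "remainder {4 # zs' |zs'. remainder {[]} 0 zs'} q zs"
  using assms
proof (induction zs arbitrary: q)
  case (Cons a zs)
  let ?R = "{4 # zs' |zs'. remainder {[]} 0 zs'}"
  consider "a = 1" | "a = 2" | "a = 3" | "a = 4" using Cons.prems by auto
  then show ?case
  proof cases
    case 1
    then show ?thesis using Cons.prems Cons.IH[of 3] remainder_step(3)[of ?R zs q]
      by (auto simp: next_state_simps)
  next
    case 2
    then show ?thesis using Cons.prems Cons.IH[of 2] remainder_step(2)[of ?R zs q]
      by (auto simp: next_state_simps)
  next
    case 3
    then have "q \<noteq> 3" using Cons.prems by (auto simp: next_state_simps foldl_next_state_8)
    with 3 show ?thesis using Cons.prems Cons.IH[of 1] remainder_step(1)[of ?R zs q]
      by (auto simp: next_state_simps)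
  next
    case 4
    have "q = 1"
    proof (rule ccontr)
      assume "q \<noteq> 1"
      then show False using 4 Cons.prems by (simp add: next_state_simps foldl_next_state_8)
    qed
    with 4 have "a # zs \<in> ?R" using accepted_second[of 0 zs] Cons.prems by (auto simp: next_state_simps)
    then show ?thesis unfolding remainder_def \<open>q = 1\<close>
      by (intro exI[of _ "[]"] exI[of _ "a # zs"]) simp
  qed
qed simp

lemma accepted_iff:
  assumes "set zs \<subseteq> {1, 2, 3, 4}"
  shows "foldl next_state 0 zs = 5 \<longleftrightarrow>
    (\<exists>w w'. w \<noteq> [] \<and> w' \<noteq> [] \<and> zs = word_code w @ 4 # word_code w')"
proof
  assume "foldl next_state 0 zs = 5"
  then show "\<exists>w w'. w \<noteq> [] \<and> w' \<noteq> [] \<and> zs = word_code w @ 4 # word_code w'"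
    using accepted_first[of 0 zs] assms by (auto simp: remainder_def)
next
  assume "\<exists>w w'. w \<noteq> [] \<and> w' \<noteq> [] \<and> zs = word_code w @ 4 # word_code w'"
  then show "foldl next_state 0 zs = 5"
    by (auto simp: accepted_word next_state_simps)
qed

lemma scan_encode_identity:
  assumes "w \<noteq> []" "w' \<noteq> []"
  shows "scan (0, []) (encode_identity w w') = (5, word_code w @ 4 # word_code w')"
proof -
  let ?zs = "word_code w @ 4 # word_code w'"
  have "encode_identity w w' = concat (map block_bits ?zs)"
    by (simp add: encode_identity_def block_bits_word)
  moreover have "set ?zs \<subseteq> {1, 2, 3, 4}"
    using word_code_set[of w] word_code_set[of w'] by auto
  moreover have "foldl next_state 0 ?zs = 5"
    using assms by (simp add: accepted_word next_state_simps)
  ultimately show ?thesis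
    using scan_concat_blocks[of 0 ?zs "[]"] by simp
qed

theorem scan_accepts_iff:
  "fst (scan (0, []) x) = 5 \<longleftrightarrow> (\<exists>w w'. w \<noteq> [] \<and> w' \<noteq> [] \<and> x = encode_identity w w')"
proof
  assume "fst (scan (0, []) x) = 5"
  then obtain zs where zs: "x = concat (map block_bits zs)" "set zs \<subseteq> {1, 2, 3, 4}"
    "foldl next_state 0 zs = 5" using scan_acceptsD[of 0 "[]" x] by auto
  then obtain w w' where w: "w \<noteq> []" "w' \<noteq> []" "zs = word_code w @ 4 # word_code w'"
    using accepted_iff by blast
  then have "x = encode_identity w w'"
    unfolding zs(1) by (simp add: encode_identity_def block_bits_word)
  with w show "\<exists>w w'. w \<noteq> [] \<and> w' \<noteq> [] \<and> x = encode_identity w w'" by blast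
qed (auto simp: scan_encode_identity)

section \<open>Positions of tokens\<close>

text \<open>A token consists of the digits of a letter, or no digits, followed by a marker; its position is
  that of the marker.\<close>

definition token_code :: "nat list \<times> nat \<Rightarrow> nat list" where
  "token_code t = fst t @ [snd t]"

definition tokens_code :: "(nat list \<times> nat) list \<Rightarrow> nat list" where
  "tokens_code ts = concat (map token_code ts)"

definition token_pos :: "(nat list \<times> nat) list \<Rightarrow> nat \<Rightarrow> nat" where
  "token_pos ts k = length (tokens_code (take k ts)) + length (fst (ts ! k))"

definition wf_tokens :: "(nat list \<times> nat) list \<Rightarrow> bool" where
  "wf_tokens ts \<longleftrightarrow> (\<forall>t\<in>set ts. list_all digit (fst t) \<and> \<not> digit (snd t))"

lemma tokens_code_snoc: "tokens_code (ts @ [t]) = tokens_code ts @ fst t @ [snd t]"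
  by (simp add: tokens_code_def token_code_def)

lemma tokens_code_last:
  "wf_tokens ts \<Longrightarrow> ts \<noteq> [] \<Longrightarrow> \<not> digit (last (tokens_code ts))"
  by (induction ts rule: rev_induct) (simp_all add: tokens_code_snoc wf_tokens_def)

lemma token_pos_snoc: "k < length ts \<Longrightarrow> token_pos (ts @ [t]) k = token_pos ts k"
  by (simp add: token_pos_def nth_append)

text \<open>Induction from the right: appending a token changes neither the earlier positions nor
  the digits before them. The new token sees its own digits only, since whatever precedes it ends in
  a nondigit.\<close>

lemma token_pos_aux:
  assumes "wf_tokens ts"
  shows "(\<forall>k<length ts. token_pos ts k < length (tokens_code ts) \<and>
      tokens_code ts ! token_pos ts k = snd (ts ! k) \<and>
      digits_before (tokens_code ts) (token_pos ts k) = rev (fst (ts ! k))) \<and>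
    (\<forall>l<length ts. \<forall>k<l. token_pos ts k < token_pos ts l) \<and>
    (\<forall>p<length (tokens_code ts). \<not> digit (tokens_code ts ! p) \<longrightarrow>
      (\<exists>k<length ts. p = token_pos ts k))"
    (is "?A ts \<and> ?B ts \<and> ?C ts")
  using assms
proof (induction ts rule: rev_induct)
  case Nil
  then show ?case by (simp add: tokens_code_def)
next
  case (snoc t ts)
  let ?y = "tokens_code ts" and ?y' = "tokens_code (ts @ [t])"
  let ?n = "length ts" and ?d = "fst t"
  have wf: "wf_tokens ts" "list_all digit ?d"
    using snoc.prems by (simp_all add: wf_tokens_def)
  have IH: "?A ts" "?B ts" "?C ts" using snoc.IH[OF wf(1)] by blast+
  have y': "?y' = ?y @ ?d @ [snd t]" by (rule tokens_code_snoc)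
  have new: "token_pos (ts @ [t]) ?n = length ?y + length ?d"
    by (simp add: token_pos_def)
  note old = token_pos_snoc[of _ ts t]
  have "takeWhile digit (rev ?y) = []"
  proof (cases "?y = []")
    case False
    then have "\<not> digit (hd (rev ?y))"
    proof -
      have "ts \<noteq> []" using False by (auto simp: tokens_code_def)
      then show ?thesis using tokens_code_last[OF wf(1)] False by (simp add: hd_rev)
    qed
    then show ?thesis using False by (cases "rev ?y") auto
  qed simp
  then have "takeWhile digit (rev (?y @ ?d)) = rev ?d"
    using wf(2) takeWhile_append2[of "rev ?d" digit "rev ?y"] by (simp add: list_all_iff)
  then have digits_new: "digits_before ?y' (length ?y + length ?d) = rev ?d"
    by (simp add: digits_before_def y')
  have digits_old: "digits_before ?y' p = digits_before ?y p" if "p < length ?y" for p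
    using that by (simp add: digits_before_def y')
  have "?A (ts @ [t])"
  proof (intro allI impI)
    fix k assume "k < length (ts @ [t])"
    then consider "k < ?n" | "k = ?n" by fastforce
    then show "token_pos (ts @ [t]) k < length ?y' \<and> ?y' ! token_pos (ts @ [t]) k = snd ((ts @ [t]) ! k) \<and>
      digits_before ?y' (token_pos (ts @ [t]) k) = rev (fst ((ts @ [t]) ! k))"
    proof cases
      case 1
      then have "token_pos ts k < length ?y" "?y ! token_pos ts k = snd (ts ! k)"
        "digits_before ?y (token_pos ts k) = rev (fst (ts ! k))" using IH(1) by auto
      then show ?thesis using 1 by (simp add: old digits_old) (simp add: y' nth_append)
    next
      case 2
      then show ?thesis by (simp add: new digits_new) (simp add: y' nth_append)
    qed
  qed
  moreover have "?B (ts @ [t])"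
  proof (intro allI impI)
    fix l k assume "l < length (ts @ [t])" "k < l"
    then consider "l < ?n" | "l = ?n" "k < ?n" by fastforce
    then show "token_pos (ts @ [t]) k < token_pos (ts @ [t]) l"
      using IH(1,2) \<open>k < l\<close> by cases (auto simp: old new intro: trans_less_add1)
  qed
  moreover have "?C (ts @ [t])"
  proof (intro allI impI)
    fix p assume p: "p < length ?y'" "\<not> digit (?y' ! p)"
    show "\<exists>k<length (ts @ [t]). p = token_pos (ts @ [t]) k"
    proof (cases "p < length ?y")
      case True
      then have "\<not> digit (?y ! p)" using p by (simp add: y' nth_append)
      then obtain k where "k < ?n" "p = token_pos ts k" using IH(3) True by blast
      then show ?thesis using old[of k] by (intro exI[of _ k]) simp
    next
      case False
      have "\<not> p - length ?y < length ?d"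
      proof
        assume *: "p - length ?y < length ?d"
        then have "?y' ! p = ?d ! (p - length ?y)" using False by (simp add: y' nth_append)
        then show False using p(2) wf(2) * by (simp add: list_all_length)
      qed
      then have "p = length ?y + length ?d" using p(1) False by (simp add: y')
      then show ?thesis using new by (intro exI[of _ ?n]) simp
    qed
  qed
  ultimately show ?case by blast
qed

lemma token_pos:
  assumes "wf_tokens ts"
  shows "k < length ts \<Longrightarrow> token_pos ts k < length (tokens_code ts)"
    "k < length ts \<Longrightarrow> tokens_code ts ! token_pos ts k = snd (ts ! k)"
    "k < length ts \<Longrightarrow> digits_before (tokens_code ts) (token_pos ts k) = rev (fst (ts ! k))"
    "k < l \<Longrightarrow> l < length ts \<Longrightarrow> token_pos ts k < token_pos ts l"
    "p < length (tokens_code ts) \<Longrightarrow> \<not> digit (tokens_code ts ! p) \<Longrightarrow> \<exists>k<length ts. p = token_pos ts k"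
  using token_pos_aux[OF assms] by blast+

section \<open>The condition as a formula\<close>

definition Disj :: "fm \<Rightarrow> fm \<Rightarrow> fm" where
  "Disj \<phi> \<psi> = Neg (Conj (Neg \<phi>) (Neg \<psi>))"

definition Token :: "nat \<Rightarrow> fm" where
  "Token i = Sym i {3, 4, 5, 6}"

definition Ex_token :: "nat \<Rightarrow> fm \<Rightarrow> fm" where
  "Ex_token i \<phi> = Ex i (Conj (Token i) \<phi>)"

text \<open>The symbol 3 has to be tested because the letter 0 has no digits. Tokens ending in 4, 5
  or 6 all carry the label \<open>None\<close>.\<close>

definition Same_label :: "nat \<Rightarrow> nat \<Rightarrow> fm" where
  "Same_label i j = Disj (Conj (Conj (Sym i {3}) (Sym j {3})) (Same i j))
     (Conj (Neg (Sym i {3})) (Neg (Sym j {3})))"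

definition Inner_pair :: "nat \<Rightarrow> nat \<Rightarrow> nat \<Rightarrow> fm" where
  "Inner_pair p q r = Conj (Less p q) (Neg (Ex_token r (Conj (Conj (Less p r) (Less r q))
     (Disj (Neg (Sym r {3})) (Disj (Same_label r p) (Same_label r q))))))"

definition Covered :: "nat \<Rightarrow> nat \<Rightarrow> nat \<Rightarrow> nat \<Rightarrow> nat \<Rightarrow> nat \<Rightarrow> fm" where
  "Covered p q p' q' r r' = Neg (Ex_token r (Conj (Conj (Less p r) (Less r q))
     (Neg (Ex_token r' (Conj (Conj (Less p' r') (Less r' q')) (Same_label r r'))))))"

definition Similar :: fm where
  "Similar = Conj (Conj (Same_label 0 2) (Same_label 1 3))
     (Conj (Covered 0 1 2 3 4 5) (Covered 2 3 0 1 4 5))"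

text \<open>\<open>EqCount\<close> ranges over all positions, so \<open>Token 2\<close> restricts it
  to tokens. Variable 6 is pinned to the separator; \<open>side\<close> is negated because only a
  strict order is available.\<close>

definition Matching :: "fm \<Rightarrow> fm" where
  "Matching side = Conj (Token 2) (Ex_token 3 (Conj (Inner_pair 2 3 4) (Conj Similar
     (Ex_token 6 (Conj (Sym 6 {4}) (Neg side))))))"

definition Balanced :: fm where
  "Balanced = Neg (Ex_token 0 (Ex_token 1 (Conj (Inner_pair 0 1 4)
     (Neg (EqCount 2 (Matching (Less 6 3)) (Matching (Less 2 6)))))))"

lemmas fm_defs = Disj_def Token_def Ex_token_def Same_label_def Inner_pair_def Covered_def
  Similar_def Matching_def Balanced_def

lemma wf_Balanced: "wf_fm 7 Balanced"
  by (simp add: fm_defs)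

lemma sat_Disj: "sat y e (Disj \<phi> \<psi>) \<longleftrightarrow> sat y e \<phi> \<or> sat y e \<psi>"
  by (simp add: Disj_def)

text \<open>\<open>u\<close> holds the label of each token and \<open>mid\<close> the index of the
  separator. As the first label is \<open>None\<close>, no letter has its marker at position 0,
  where \<open>Same\<close> is false.\<close>

locale labelled_tokens =
  fixes ts :: "(nat list \<times> nat) list" and u :: "nat option list" and mid :: nat
  assumes wf: "wf_tokens ts"
    and marker: "\<And>k. k < length ts \<Longrightarrow> snd (ts ! k) \<in> {3, 4, 5, 6}"
    and length_u: "length u = length ts"
    and label_None: "\<And>k. k < length ts \<Longrightarrow> u ! k = None \<longleftrightarrow> snd (ts ! k) \<noteq> 3"
    and label_eq: "\<And>k l. k < length ts \<Longrightarrow> l < length ts \<Longrightarrow> u ! k \<noteq> None \<Longrightarrow> u ! l \<noteq> None \<Longrightarrow>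
      u ! k = u ! l \<longleftrightarrow> fst (ts ! k) = fst (ts ! l)"
    and first: "u ! 0 = None"
    and mid: "mid < length ts" "\<And>k. k < length ts \<Longrightarrow> snd (ts ! k) = 4 \<longleftrightarrow> k = mid"
begin

abbreviation "pos \<equiv> token_pos ts"
abbreviation "y \<equiv> tokens_code ts"
abbreviation "n \<equiv> length ts"

lemma pos_less_iff: "k < n \<Longrightarrow> l < n \<Longrightarrow> pos k < pos l \<longleftrightarrow> k < l"
  using token_pos(4)[OF wf, of k l] token_pos(4)[OF wf, of l k] by (metis less_asym nat_neq_iff)

lemma pos_inj: "k < n \<Longrightarrow> l < n \<Longrightarrow> pos k = pos l \<longleftrightarrow> k = l"
  using pos_less_iff by (metis less_irrefl nat_neq_iff)

lemma sat_Sym_pos: "e i = pos k \<Longrightarrow> k < n \<Longrightarrow> sat y e (Sym i A) \<longleftrightarrow> snd (ts ! k) \<in> A"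
  by (simp add: token_pos(2)[OF wf])

lemma sat_Token: "e i < length y \<Longrightarrow> sat y e (Token i) \<longleftrightarrow> (\<exists>k<n. e i = pos k)"
proof
  assume "e i < length y" "sat y e (Token i)"
  then show "\<exists>k<n. e i = pos k"
    using token_pos(5)[OF wf, of "e i"] by (auto simp: Token_def digit_def)
next
  assume "\<exists>k<n. e i = pos k"
  then obtain k where "k < n" "e i = pos k" by blast
  then show "sat y e (Token i)" unfolding Token_def using sat_Sym_pos marker by blast
qed

lemma sat_Ex_token: "sat y e (Ex_token i \<phi>) \<longleftrightarrow> (\<exists>k<n. sat y (e(i := pos k)) \<phi>)"
proof
  assume "sat y e (Ex_token i \<phi>)"
  then obtain p where p: "p < length y" "sat y (e(i := p)) (Token i)" "sat y (e(i := p)) \<phi>"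
    by (auto simp: Ex_token_def)
  then show "\<exists>k<n. sat y (e(i := pos k)) \<phi>" using sat_Token[of "e(i := p)" i] by auto
next
  assume "\<exists>k<n. sat y (e(i := pos k)) \<phi>"
  then obtain k where k: "k < n" "sat y (e(i := pos k)) \<phi>" by blast
  then have "sat y (e(i := pos k)) (Token i)" "pos k < length y"
    using sat_Token[of "e(i := pos k)" i] token_pos(1)[OF wf k(1)] by auto
  then show "sat y e (Ex_token i \<phi>)" using k(2) by (auto simp: Ex_token_def)
qed

lemma sat_Less_pos:
  "e i = pos k \<Longrightarrow> e j = pos l \<Longrightarrow> k < n \<Longrightarrow> l < n \<Longrightarrow> sat y e (Less i j) \<longleftrightarrow> k < l"
  by (simp add: pos_less_iff)

lemma sat_Same_label:
  assumes "e i = pos k" "e j = pos l" "k < n" "l < n"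
  shows "sat y e (Same_label i j) \<longleftrightarrow> u ! k = u ! l"
proof -
  have letter: "sat y e (Sym i {3}) \<longleftrightarrow> u ! k \<noteq> None" "sat y e (Sym j {3}) \<longleftrightarrow> u ! l \<noteq> None"
    using assms label_None by (simp_all add: sat_Sym_pos del: sat.simps)
  have "sat y e (Same i j) \<longleftrightarrow> u ! k = u ! l" if "u ! k \<noteq> None" "u ! l \<noteq> None"
  proof -
    have "0 < k" "0 < l" using that first by (metis neq0_conv)+
    then have "0 < pos k" "0 < pos l"
      using pos_less_iff[of 0 k] pos_less_iff[of 0 l] assms(3,4) by linarith+
    then show ?thesis
      using label_eq[OF assms(3,4) that] assms by (simp add: token_pos(3)[OF wf])
  qed
  then show ?thesis
    unfolding Same_label_def sat_Disj sat.simps(4,5) letter by (cases "u ! k"; cases "u ! l") auto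
qed

lemma sat_Inner_pair:
  assumes "e p = pos k" "e q = pos l" "k < n" "l < n" "r \<noteq> p" "r \<noteq> q"
  shows "sat y e (Inner_pair p q r) \<longleftrightarrow> inner_pair u k l"
proof -
  have "sat y (e(r := pos c)) (Conj (Conj (Less p r) (Less r q))
     (Disj (Neg (Sym r {3})) (Disj (Same_label r p) (Same_label r q)))) \<longleftrightarrow>
    k < c \<and> c < l \<and> (u ! c = None \<or> u ! c = u ! k \<or> u ! c = u ! l)" if "c < n" for c
    using assms that label_None[OF that] sat_Sym_pos[of "e(r := pos c)" r c "{3}"]
      sat_Less_pos[of "e(r := pos c)" p k r c] sat_Less_pos[of "e(r := pos c)" r c q l]
      sat_Same_label[of "e(r := pos c)" r c p k] sat_Same_label[of "e(r := pos c)" r c q l]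
    by (simp only: sat_Disj sat.simps(4,5) fun_upd_same fun_upd_other) auto
  then have "sat y e (Inner_pair p q r) \<longleftrightarrow> k < l \<and>
    \<not> (\<exists>c<n. k < c \<and> c < l \<and> (u ! c = None \<or> u ! c = u ! k \<or> u ! c = u ! l))"
    using sat_Less_pos[of e p k q l] assms
    unfolding Inner_pair_def sat.simps(4,5) sat_Ex_token by blast
  also have "\<dots> \<longleftrightarrow> inner_pair u k l"
    using assms(4) unfolding inner_pair_def length_u by (meson less_trans)
  finally show ?thesis .
qed

lemma sat_Covered:
  assumes "e p = pos k" "e q = pos l" "e p' = pos k'" "e q' = pos l'"
    and "k < n" "l < n" "k' < n" "l' < n" "distinct [p, q, p', q', r, r']"
  shows "sat y e (Covered p q p' q' r r') \<longleftrightarrow> (!) u ` {k<..<l} \<subseteq> (!) u ` {k'<..<l'}"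
proof -
  have "sat y (e(r := pos c, r' := pos d)) (Conj (Conj (Less p' r') (Less r' q')) (Same_label r r')) \<longleftrightarrow>
    k' < d \<and> d < l' \<and> u ! c = u ! d" if "c < n" "d < n" for c d
    using assms that
      sat_Less_pos[of "e(r := pos c, r' := pos d)" p' k' r' d]
      sat_Less_pos[of "e(r := pos c, r' := pos d)" r' d q' l']
      sat_Same_label[of "e(r := pos c, r' := pos d)" r c r' d]
    by (auto simp del: sat.simps(1-3,6-7))
  moreover have "sat y (e(r := pos c)) (Conj (Less p r) (Less r q)) \<longleftrightarrow> k < c \<and> c < l" if "c < n" for c
    using assms that sat_Less_pos[of "e(r := pos c)" p k r c] sat_Less_pos[of "e(r := pos c)" r c q l]
    by (auto simp del: sat.simps(1-3,6-7))
  ultimately have "sat y e (Covered p q p' q' r r') \<longleftrightarrow>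
    \<not> (\<exists>c<n. (k < c \<and> c < l) \<and> \<not> (\<exists>d<n. k' < d \<and> d < l' \<and> u ! c = u ! d))"
    unfolding Covered_def sat.simps(4) sat_Ex_token sat.simps(5)[of y _ "Conj (Less p r) (Less r q)"] by blast
  also have "\<dots> \<longleftrightarrow> (!) u ` {k<..<l} \<subseteq> (!) u ` {k'<..<l'}"
    using assms(6,8) by (auto simp: image_iff subset_iff) (metis less_trans greaterThanLessThan_iff)+
  finally show ?thesis .
qed

lemma sat_Similar:
  assumes "e 0 = pos k" "e 1 = pos l" "e 2 = pos k'" "e 3 = pos l'"
    and "k < n" "l < n" "k' < n" "l' < n"
  shows "sat y e Similar \<longleftrightarrow> similar u k l k' l'"
  unfolding Similar_def similar_def sat.simps(5)
  using sat_Same_label[of e 0 k 2 k'] sat_Same_label[of e 1 l 3 l']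
    sat_Covered[of e 0 k 1 l 2 k' 3 l' 4 5] sat_Covered[of e 2 k' 3 l' 0 k 1 l 4 5] assms
  by auto

lemma sat_Ex_mid:
  "sat y e (Ex_token 6 (Conj (Sym 6 {4}) \<phi>)) \<longleftrightarrow> sat y (e(6 := pos mid)) \<phi>"
proof -
  have "sat y (e(6 := pos k)) (Sym 6 {4}) \<longleftrightarrow> k = mid" if "k < n" for k
    using that mid(2)[OF that] sat_Sym_pos[of "e(6 := pos k)" 6 k "{4}"] by simp
  then show ?thesis unfolding sat_Ex_token sat.simps(5) using mid(1) by blast
qed

text \<open>Token positions are injective in the token index, so counting tape positions is counting
  indices.\<close>

lemma card_Matching:
  assumes "e 0 = pos k" "e 1 = pos l" "k < n" "l < n"
    and side: "\<And>k' l'. k' < n \<Longrightarrow> l' < n \<Longrightarrow>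
      sat y (e(2 := pos k', 3 := pos l', 6 := pos mid)) side \<longleftrightarrow> \<not> P k' l'"
  shows "card {p. p < length y \<and> sat y (e(2 := p)) (Matching side)} =
    card {k'. \<exists>l'. inner_pair u k' l' \<and> similar u k l k' l' \<and> P k' l'}" (is "card ?A = card ?B")
proof -
  have body: "sat y (e(2 := pos k', 3 := pos l')) (Conj (Inner_pair 2 3 4) (Conj Similar
     (Ex_token 6 (Conj (Sym 6 {4}) (Neg side))))) \<longleftrightarrow>
    inner_pair u k' l' \<and> similar u k l k' l' \<and> P k' l'" if "k' < n" "l' < n" for k' l'
    unfolding sat.simps(5) sat_Ex_mid sat.simps(4) side[OF that]
    using sat_Inner_pair[of "e(2 := pos k', 3 := pos l')" 2 k' 3 l' 4]
      sat_Similar[of "e(2 := pos k', 3 := pos l')" k l k' l'] assms(1-4) that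
    by simp
  have inner: "k' < n \<and> l' < n" if "inner_pair u k' l'" for k' l'
    using that by (auto simp: inner_pair_def length_u)
  have "?A = pos ` ?B"
  proof (rule set_eqI)
    fix p
    have "p \<in> ?A \<longleftrightarrow> (\<exists>k'<n. p = pos k' \<and> (\<exists>l'<n. inner_pair u k' l' \<and> similar u k l k' l' \<and> P k' l'))"
    proof
      assume p: "p \<in> ?A"
      then obtain k' where k': "k' < n" "p = pos k'"
        using sat_Token[of "e(2 := p)" 2] by (auto simp: Matching_def simp del: sat.simps(6))
      moreover have "\<exists>l'<n. inner_pair u k' l' \<and> similar u k l k' l' \<and> P k' l'"
        using p body[OF k'(1)] unfolding k'(2) Matching_def mem_Collect_eq sat.simps(5)[of y _ "Token 2"] sat_Ex_token
        by blast
      ultimately show "\<exists>k'<n. p = pos k' \<and> (\<exists>l'<n. inner_pair u k' l' \<and> similar u k l k' l' \<and> P k' l')"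
        by blast
    next
      assume "\<exists>k'<n. p = pos k' \<and> (\<exists>l'<n. inner_pair u k' l' \<and> similar u k l k' l' \<and> P k' l')"
      then obtain k' l' where k': "k' < n" "p = pos k'" "l' < n"
        "inner_pair u k' l' \<and> similar u k l k' l' \<and> P k' l'" by blast
      moreover have "p < length y" using token_pos(1)[OF wf k'(1)] k'(2) by simp
      moreover have "sat y (e(2 := p)) (Token 2)"
        using sat_Token[of "e(2 := p)" 2] k' \<open>p < length y\<close> by auto
      ultimately show "p \<in> ?A"
        using body[of k' l'] unfolding Matching_def mem_Collect_eq sat.simps(5)[of y _ "Token 2"] sat_Ex_token
        by blast
    qed
    also have "\<dots> \<longleftrightarrow> p \<in> pos ` ?B" using inner by blast
    finally show "p \<in> ?A \<longleftrightarrow> p \<in> pos ` ?B" .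
  qed
  moreover have "inj_on pos ?B" using inner pos_inj by (intro inj_onI) blast
  ultimately show ?thesis by (simp add: card_image)
qed

theorem sat_Balanced:
  "sat y e Balanced \<longleftrightarrow> (\<forall>k l. inner_pair u k l \<longrightarrow>
     card {k'. \<exists>l'. inner_pair u k' l' \<and> similar u k l k' l' \<and> l' \<le> mid} =
     card {k'. \<exists>l'. inner_pair u k' l' \<and> similar u k l k' l' \<and> mid \<le> k'})"
proof -
  have "sat y (e(0 := pos k, 1 := pos l)) (Conj (Inner_pair 0 1 4)
     (Neg (EqCount 2 (Matching (Less 6 3)) (Matching (Less 2 6))))) \<longleftrightarrow>
    inner_pair u k l \<and>
     card {k'. \<exists>l'. inner_pair u k' l' \<and> similar u k l k' l' \<and> l' \<le> mid} \<noteq>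
     card {k'. \<exists>l'. inner_pair u k' l' \<and> similar u k l k' l' \<and> mid \<le> k'}"
    if kl: "k < n" "l < n" for k l
  proof -
    let ?e = "e(0 := pos k, 1 := pos l)"
    have "card {p. p < length y \<and> sat y (?e(2 := p)) (Matching (Less 6 3))} =
      card {k'. \<exists>l'. inner_pair u k' l' \<and> similar u k l k' l' \<and> l' \<le> mid}"
    proof (rule card_Matching)
      fix k' l' assume "k' < n" "l' < n"
      then show "sat y (?e(2 := pos k', 3 := pos l', 6 := pos mid)) (Less 6 3) \<longleftrightarrow> \<not> l' \<le> mid"
        using sat_Less_pos[of "?e(2 := pos k', 3 := pos l', 6 := pos mid)" 6 mid 3 l'] mid(1) by (simp del: sat.simps add: not_le)
    qed (use kl in auto)
    moreover have "card {p. p < length y \<and> sat y (?e(2 := p)) (Matching (Less 2 6))} =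
      card {k'. \<exists>l'. inner_pair u k' l' \<and> similar u k l k' l' \<and> mid \<le> k'}"
    proof (rule card_Matching)
      fix k' l' assume "k' < n" "l' < n"
      then show "sat y (?e(2 := pos k', 3 := pos l', 6 := pos mid)) (Less 2 6) \<longleftrightarrow> \<not> mid \<le> k'"
        using sat_Less_pos[of "?e(2 := pos k', 3 := pos l', 6 := pos mid)" 2 k' 6 mid] mid(1) by (simp del: sat.simps add: not_le)
    qed (use kl in auto)
    moreover have "sat y ?e (Inner_pair 0 1 4) \<longleftrightarrow> inner_pair u k l"
      using sat_Inner_pair[of ?e 0 k 1 l 4] kl by simp
    ultimately show ?thesis unfolding sat.simps(4,5,7) by (simp only:)
  qed
  moreover have "k < n \<and> l < n" if "inner_pair u k l" for k l
    using that by (auto simp: inner_pair_def length_u)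
  ultimately show ?thesis
    unfolding Balanced_def sat.simps(4)[of y e] sat_Ex_token by blast
qed

end

section \<open>Tokens of an encoded identity\<close>

definition labels :: "nat list \<Rightarrow> nat list \<Rightarrow> (nat option \<times> nat) list" where
  "labels w w' = (None, 5) # map (\<lambda>n. (Some n, 3)) w @ (None, 4) # map (\<lambda>n. (Some n, 3)) w' @ [(None, 6)]"

definition identity_tokens :: "nat list \<Rightarrow> nat list \<Rightarrow> (nat list \<times> nat) list" where
  "identity_tokens w w' = map (\<lambda>(a, s). (case a of None \<Rightarrow> [] | Some n \<Rightarrow> digits n, s)) (labels w w')"

lemma digits_inject: "digits m = digits n \<longleftrightarrow> m = n"
proof
  show "digits m = digits n \<Longrightarrow> m = n"
  proof (induction m arbitrary: n rule: less_induct)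
    case (less m)
    show ?case
    proof (cases "m = 0 \<or> n = 0")
      case True
      then show ?thesis using less.prems
        by (auto simp: digits.simps[of m] digits.simps[of n] split: if_splits)
    next
      case False
      then have "odd m = odd n" "digits (m div 2) = digits (n div 2)"
        using less.prems by (auto simp: digits.simps[of m] digits.simps[of n] split: if_splits)
      then have "m div 2 = n div 2" "m mod 2 = n mod 2"
        using less.IH[of "m div 2"] False by (auto simp: mod2_eq_if)
      then show ?thesis by (metis div_mult_mod_eq)
    qed
  qed
qed simp

lemma map_fst_labels: "map fst (labels w w') = glued w w'"
  by (simp add: labels_def glued_def padded_def comp_def)

lemma labels_mem:
  "t \<in> set (labels w w') \<Longrightarrow> snd t \<in> {3, 4, 5, 6} \<and> (fst t = None \<longleftrightarrow> snd t \<noteq> 3)"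
  by (auto simp: labels_def)

lemma length_labels: "length (labels w w') = length w + length w' + 3"
  by (simp add: labels_def)

lemma labels_middle:
  "k < length (labels w w') \<Longrightarrow> snd (labels w w' ! k) = 4 \<longleftrightarrow> k = Suc (length w)"
  by (cases k) (auto simp: labels_def nth_append nth_Cons' split: if_splits)

lemma tokens_code_identity:
  assumes "w \<noteq> []" "w' \<noteq> []"
  shows "tokens_code (identity_tokens w w') = scanned (encode_identity w w')"
proof -
  have "concat (map (\<lambda>n. digits n @ [3]) v) = word_code v" for v
    by (induction v) (simp_all add: letter_code_def)
  then show ?thesis
    by (simp add: scanned_def scan_encode_identity[OF assms] tokens_code_def token_code_def
      identity_tokens_def labels_def comp_def)
qed

lemma sat_Balanced_iff:
  assumes "w \<noteq> []" "w' \<noteq> []"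
  shows "sat (scanned (encode_identity w w')) e Balanced \<longleftrightarrow> same_adjacencies w w'"
proof -
  let ?ts = "identity_tokens w w'" and ?c = "labels w w'"
  have nth: "?ts ! k = (case fst (?c ! k) of None \<Rightarrow> [] | Some n \<Rightarrow> digits n, snd (?c ! k))"
    "glued w w' ! k = fst (?c ! k)" "?c ! k \<in> set ?c" if "k < length ?ts" for k
    using that unfolding map_fst_labels[symmetric] by (simp_all add: identity_tokens_def split_beta)
  have len: "length ?ts = length ?c" by (simp add: identity_tokens_def)
  interpret labelled_tokens ?ts "glued w w'" "Suc (length w)"
  proof
    show "wf_tokens ?ts"
      using digits_set labels_mem[of _ w w']
      by (fastforce simp: wf_tokens_def identity_tokens_def list_all_iff digit_def split: option.splits)
    show "length (glued w w') = length ?ts"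
      by (simp add: len length_labels length_glued)
    show "glued w w' ! 0 = None" by (simp add: glued_def)
    show "Suc (length w) < length ?ts" by (simp add: len length_labels)
    fix k assume k: "k < length ?ts"
    show "snd (?ts ! k) \<in> {3, 4, 5, 6}" "glued w w' ! k = None \<longleftrightarrow> snd (?ts ! k) \<noteq> 3"
      using nth[OF k] labels_mem by auto
    show "snd (?ts ! k) = 4 \<longleftrightarrow> k = Suc (length w)"
      using nth(1)[OF k] labels_middle[of k w w'] k by (simp add: len)
    fix l assume l: "l < length ?ts"
    show "glued w w' ! k = glued w w' ! l \<longleftrightarrow> fst (?ts ! k) = fst (?ts ! l)"
      if "glued w w' ! k \<noteq> None" "glued w w' ! l \<noteq> None"
      using that unfolding nth[OF k] nth[OF l] by (auto simp: digits_inject)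
  qed
  show ?thesis
    unfolding tokens_code_identity[OF assms, symmetric] same_adjacencies_iff_glued
    by (rule sat_Balanced)
qed

theorem corollary1:
  shows "check_id TYPE(kauffman4) \<in> class_P"
proof (rule class_P_by_formula[OF wf_Balanced])
  fix x
  show "x \<in> check_id TYPE(kauffman4) \<longleftrightarrow>
    fst (scan (0, []) x) = 5 \<and> sat (scanned x) (\<lambda>_. 0) Balanced"
    unfolding check_id_def scan_accepts_iff
    using sat_Balanced_iff holds_identity_kauffman4_iff by blast
qed simp

end
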